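(* Let $K$ be the function field of a smooth projective geometrically integral curve over a $p$-adic field (a finite extension of $\mathbb{Q}_p$). Then any finite abelian group is a Galois group over $K$, i.e. for every finite abelian group $A$ there is a finite Galois extension $L/K$ with $\mathrm{Gal}(L/K)\cong A$. *)

theory Defs
  imports
    Complex_Main
    "HOL-Computational_Algebra.Primes"
    "HOL-Algebra.Algebraic_Closure"
    "HOL-Algebra.Bij"
begin

section \<open>The p-adic numbers and their finite extensions\<close>

definition padic_abs :: "nat \<Rightarrow> rat \<Rightarrow> real" where
  "padic_abs p q = (if q = 0 then 0 else
     real p powi (int (multiplicity (int p) (snd (quotient_of q)))
                - int (multiplicity (int p) (fst (quotient_of q)))))"

definition padic_Cauchy :: "nat \<Rightarrow> (nat \<Rightarrow> rat) \<Rightarrow> bool" where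
  "padic_Cauchy p x \<longleftrightarrow>
     (\<forall>e>0. \<exists>N. \<forall>i\<ge>N. \<forall>j\<ge>N. padic_abs p (x i - x j) < e)"

definition padic_Cauchy_ring :: "nat \<Rightarrow> (nat \<Rightarrow> rat) ring" where
  "padic_Cauchy_ring p =
     \<lparr>carrier = {x. padic_Cauchy p x},
      mult = (\<lambda>x y i. x i * y i), one = (\<lambda>_. 1),
      zero = (\<lambda>_. 0), add = (\<lambda>x y i. x i + y i)\<rparr>"

definition padic_null :: "nat \<Rightarrow> (nat \<Rightarrow> rat) set" where
  "padic_null p = {x. (\<lambda>i. padic_abs p (x i)) \<longlonglongrightarrow> 0}"

text \<open>The completion of the rationals for the p-adic absolute value.\<close>

definition Qp :: "nat \<Rightarrow> (nat \<Rightarrow> rat) set ring" where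
  "Qp p = padic_Cauchy_ring p Quot padic_null p"

definition padic_field :: "nat \<Rightarrow> 'a ring \<Rightarrow> bool" where
  "padic_field p k \<longleftrightarrow> field k \<and>
     (\<exists>h \<in> ring_hom (Qp p) k.
        ring.finite_dimension k (h ` carrier (Qp p)) (carrier k))"

section \<open>Polynomials in the variables 0, ..., n\<close>

text \<open>As in \<^theory>\<open>HOL-Algebra.Indexed_Polynomials\<close>, a monomial is a multiset of variables and a
  polynomial maps each monomial to its coefficient. That theory has no product of two
  polynomials; it is added here.\<close>

type_synonym 'a mpol = "nat multiset \<Rightarrow> 'a"

definition mpoly_ring :: "'a ring \<Rightarrow> nat \<Rightarrow> 'a mpol ring" where
  "mpoly_ring R n =
     \<lparr>carrier = ring.indexed_pset R {..n} (carrier R),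
      mult = (\<lambda>f g m. finsum R (\<lambda>a. f a \<otimes>\<^bsub>R\<^esub> g (m - a)) {a. a \<subseteq># m}),
      one = ring.indexed_const R \<one>\<^bsub>R\<^esub>,
      zero = ring.indexed_const R \<zero>\<^bsub>R\<^esub>,
      add = ring.indexed_padd R\<rparr>"

definition mpoly_eval :: "'a ring \<Rightarrow> 'a mpol \<Rightarrow> (nat \<Rightarrow> 'a) \<Rightarrow> 'a" where
  "mpoly_eval R f P =
     finsum R (\<lambda>m. f m \<otimes>\<^bsub>R\<^esub> finprod R (\<lambda>i. P i [^]\<^bsub>R\<^esub> count m i) (set_mset m))
       {m. f m \<noteq> \<zero>\<^bsub>R\<^esub>}"

definition mpoly_pderiv :: "'a ring \<Rightarrow> nat \<Rightarrow> 'a mpol \<Rightarrow> 'a mpol" where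
  "mpoly_pderiv R i f = (\<lambda>m. [Suc (count m i)] \<cdot>\<^bsub>R\<^esub> f (add_mset i m))"

definition homogeneous :: "'a ring \<Rightarrow> nat \<Rightarrow> 'a mpol \<Rightarrow> bool" where
  "homogeneous R d f \<longleftrightarrow> (\<forall>m. f m \<noteq> \<zero>\<^bsub>R\<^esub> \<longrightarrow> size m = d)"

definition hom_component :: "'a ring \<Rightarrow> nat \<Rightarrow> 'a mpol \<Rightarrow> 'a mpol" where
  "hom_component R d f = (\<lambda>m. if size m = d then f m else \<zero>\<^bsub>R\<^esub>)"

definition homogeneous_ideal :: "'a ring \<Rightarrow> nat \<Rightarrow> 'a mpol set \<Rightarrow> bool" where
  "homogeneous_ideal R n I \<longleftrightarrow> ideal I (mpoly_ring R n) \<and>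
     (\<forall>f\<in>I. \<forall>d. hom_component R d f \<in> I)"

section \<open>Projective schemes in n-space\<close>

text \<open>A homogeneous ideal \<open>I\<close> of \<open>k[x\<^sub>0, \<dots>, x\<^sub>n]\<close> stands for the closed subscheme
  \<open>X = Proj (k[x\<^sub>0, \<dots>, x\<^sub>n] / I)\<close> of projective n-space over \<open>k\<close>. The points of \<open>X\<close> are the
  homogeneous primes that contain \<open>I\<close> but not all of the variables.\<close>

definition proj_points :: "'a ring \<Rightarrow> nat \<Rightarrow> 'a mpol set \<Rightarrow> 'a mpol set set" where
  "proj_points k n I = {P. primeideal P (mpoly_ring k n) \<and> homogeneous_ideal k n P \<and>
     I \<subseteq> P \<and> (\<exists>i\<le>n. ring.indexed_var k i \<notin> P)}"

text \<open>The Krull dimension of the space \<open>X\<close>: its irreducible closed subsets are the closures of its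
  points, so chains of the former are chains of homogeneous primes.\<close>

definition proj_chain :: "'a ring \<Rightarrow> nat \<Rightarrow> 'a mpol set \<Rightarrow> nat \<Rightarrow> bool" where
  "proj_chain k n I d \<longleftrightarrow>
     (\<exists>C. (\<forall>j\<le>d. C j \<in> proj_points k n I) \<and> (\<forall>j<d. C j \<subset> C (Suc j)))"

definition proj_dim_eq :: "'a ring \<Rightarrow> nat \<Rightarrow> 'a mpol set \<Rightarrow> nat \<Rightarrow> bool" where
  "proj_dim_eq k n I d \<longleftrightarrow> proj_chain k n I d \<and> \<not> proj_chain k n I (Suc d)"

type_synonym 'a ac = "('a list \<times> nat) multiset \<Rightarrow> 'a"

text \<open>\<^const>\<open>ring.indexed_const\<close> is also the embedding of a field \<open>k\<close> into the library's algebraic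
  closure of \<open>k\<close>; it is applied to all coefficients of the polynomials in \<open>F\<close>.\<close>

definition to_closure :: "'a ring \<Rightarrow> 'a mpol set \<Rightarrow> 'a ac mpol set" where
  "to_closure k F = (\<lambda>f m. ring.indexed_const k (f m)) ` F"

text \<open>An integral \<open>X\<close> is given by a homogeneous prime ideal \<open>I\<close>; its base change to the algebraic
  closure is given by the extended ideal.\<close>

definition geometrically_integral :: "'a ring \<Rightarrow> nat \<Rightarrow> 'a mpol set \<Rightarrow> bool" where
  "geometrically_integral k n I \<longleftrightarrow>
     I \<in> proj_points k n I \<and>
     primeideal (genideal (mpoly_ring (field.alg_closure k) n) (to_closure k I))
       (mpoly_ring (field.alg_closure k) n)"

definition rows_independent :: "'a ring \<Rightarrow> nat \<Rightarrow> (nat \<Rightarrow> 'a) list \<Rightarrow> bool" where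
  "rows_independent R n vs \<longleftrightarrow>
     (\<forall>c. (\<forall>j<length vs. c j \<in> carrier R) \<and>
          (\<forall>i\<le>n. finsum R (\<lambda>j. c j \<otimes>\<^bsub>R\<^esub> (vs ! j) i) {..<length vs} = \<zero>\<^bsub>R\<^esub>)
        \<longrightarrow> (\<forall>j<length vs. c j = \<zero>\<^bsub>R\<^esub>))"

text \<open>The rank at \<open>P\<close> of the matrix with rows \<open>(\<partial>f/\<partial>x\<^sub>0, \<dots>, \<partial>f/\<partial>x\<^sub>n)\<close> for \<open>f \<in> F\<close>. The maximum
  exists, as at most \<open>n + 1\<close> rows are independent.\<close>

definition jacobian_rank :: "'a ring \<Rightarrow> nat \<Rightarrow> 'a mpol set \<Rightarrow> (nat \<Rightarrow> 'a) \<Rightarrow> nat" where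
  "jacobian_rank R n F P = (GREATEST r. \<exists>fs. length fs = r \<and> set fs \<subseteq> F \<and>
     rows_independent R n (map (\<lambda>f i. mpoly_eval R (mpoly_pderiv R i f) P) fs))"

text \<open>Smoothness of relative dimension \<open>d\<close> by the Jacobian criterion at every geometric point,
  given by homogeneous coordinates in the algebraic closure.\<close>

definition proj_smooth :: "'a ring \<Rightarrow> nat \<Rightarrow> 'a mpol set \<Rightarrow> nat \<Rightarrow> bool" where
  "proj_smooth k n I d \<longleftrightarrow>
     (let \<Omega> = field.alg_closure k; F = to_closure k I in
       \<forall>P. (\<forall>i\<le>n. P i \<in> carrier \<Omega>) \<and> (\<exists>i\<le>n. P i \<noteq> \<zero>\<^bsub>\<Omega>\<^esub>) \<and>
           (\<forall>f\<in>F. mpoly_eval \<Omega> f P = \<zero>\<^bsub>\<Omega>\<^esub>)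
         \<longrightarrow> jacobian_rank \<Omega> n F P + d = n)"

definition smooth_projective_curve :: "'a ring \<Rightarrow> nat \<Rightarrow> 'a mpol set \<Rightarrow> bool" where
  "smooth_projective_curve k n I \<longleftrightarrow>
     geometrically_integral k n I \<and> proj_dim_eq k n I 1 \<and> proj_smooth k n I 1"

section \<open>The function field\<close>

text \<open>The homogeneous fractions \<open>f/g\<close> of degree 0 with \<open>g \<notin> I\<close>, where \<open>f/g = f'/g'\<close> iff
  \<open>f g' - f' g \<in> I\<close>. For a homogeneous prime \<open>I\<close> this is the local ring of \<open>X\<close> at its generic point.\<close>

definition hom_fractions :: "'a ring \<Rightarrow> nat \<Rightarrow> 'a mpol set \<Rightarrow> ('a mpol \<times> 'a mpol) set" where
  "hom_fractions k n I =
     {(f, g). f \<in> carrier (mpoly_ring k n) \<and> g \<in> carrier (mpoly_ring k n) \<and> g \<notin> I \<and>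
        (\<exists>d. homogeneous k d f \<and> homogeneous k d g)}"

definition fraction_rel ::
    "'a ring \<Rightarrow> nat \<Rightarrow> 'a mpol set \<Rightarrow> (('a mpol \<times> 'a mpol) \<times> ('a mpol \<times> 'a mpol)) set" where
  "fraction_rel k n I =
     {((f, g), (f', g')). (f, g) \<in> hom_fractions k n I \<and> (f', g') \<in> hom_fractions k n I \<and>
        (f \<otimes>\<^bsub>mpoly_ring k n\<^esub> g') \<ominus>\<^bsub>mpoly_ring k n\<^esub> (f' \<otimes>\<^bsub>mpoly_ring k n\<^esub> g) \<in> I}"

definition function_field :: "'a ring \<Rightarrow> nat \<Rightarrow> 'a mpol set \<Rightarrow> ('a mpol \<times> 'a mpol) set ring" where
  "function_field k n I =
     (let S = mpoly_ring k n; E = fraction_rel k n I in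
     \<lparr>carrier = hom_fractions k n I // E,
      mult = (\<lambda>A B. \<Union>(f, g)\<in>A. \<Union>(f', g')\<in>B. E `` {(f \<otimes>\<^bsub>S\<^esub> f', g \<otimes>\<^bsub>S\<^esub> g')}),
      one = E `` {(\<one>\<^bsub>S\<^esub>, \<one>\<^bsub>S\<^esub>)},
      zero = E `` {(\<zero>\<^bsub>S\<^esub>, \<one>\<^bsub>S\<^esub>)},
      add = (\<lambda>A B. \<Union>(f, g)\<in>A. \<Union>(f', g')\<in>B.
               E `` {((f \<otimes>\<^bsub>S\<^esub> g') \<oplus>\<^bsub>S\<^esub> (f' \<otimes>\<^bsub>S\<^esub> g), g \<otimes>\<^bsub>S\<^esub> g')})\<rparr>)"

section \<open>Finite Galois extensions\<close>

definition galois_group :: "'a ring \<Rightarrow> 'a set \<Rightarrow> ('a \<Rightarrow> 'a) monoid" where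
  "galois_group L F = BijGroup (carrier L)
     \<lparr>carrier := {s \<in> ring_hom L L \<inter> Bij (carrier L). \<forall>x\<in>F. s x = x}\<rparr>"

definition finite_galois_extension :: "'a ring \<Rightarrow> 'a set \<Rightarrow> bool" where
  "finite_galois_extension L F \<longleftrightarrow> field L \<and> subfield F L \<and>
     ring.finite_dimension L F (carrier L) \<and>
     {x \<in> carrier L. \<forall>s \<in> carrier (galois_group L F). s x = x} = F"

end

theory Submission
  imports Defs "HOL-Number_Theory.Residues"
begin

text \<open>Only two properties of \<open>K\<close> matter: it has characteristic \<open>0\<close>, and it is finitely generated over \<open>k\<close>
  with an element \<open>t\<close> transcendental over \<open>k\<close>. Let \<open>B\<close> be the algebraic closure of \<open>k\<close> in an algebraic closure
  of \<open>K\<close>, and enlarge \<open>K\<close> to a finitely generated extension \<open>F\<close> of \<open>B\<close>. Comparing multiplicities of the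
  factors \<open>t - \<alpha>\<close> shows that there is \<open>d > 0\<close>, independent of \<open>N\<close>, such that an \<open>N\<close>-th root in \<open>F\<close> of a product
  \<open>\<Prod> (t - \<alpha>) ^ m \<alpha>\<close> with \<open>\<alpha> \<in> B\<close> forces \<open>N dvd d * m \<alpha>\<close> for all \<open>\<alpha>\<close>.

  Let \<open>n\<close> be a multiple of the exponent of \<open>A\<close>, put \<open>N = n * d\<close>, and adjoin to \<open>K\<close> a primitive \<open>N\<close>-th root of
  unity \<open>\<zeta>\<close> and \<open>N\<close>-th roots of all \<open>t - (i + 1) \<zeta>\<^sup>a\<close> with \<open>i < r\<close> and \<open>a\<close> coprime to \<open>N\<close>. The radicals are
  combined with the weights \<open>1 / a\<close> modulo \<open>N\<close>; since the Galois group of \<open>K(\<zeta>)/K\<close> acts on these combinations by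
  the cyclotomic character, their Kummer characters are fixed by it and yield a homomorphism from the whole
  Galois group \<open>E\<close> over \<open>K\<close> to \<open>(\<int>/N)\<^sup>r\<close>. By the bound above its image is large enough to map onto \<open>(\<int>/n)\<^sup>r\<close>
  and hence onto \<open>A\<close>; the fixed field of the kernel has Galois group \<open>A\<close>.\<close>

section \<open>Extension of field embeddings\<close>

text \<open>Kummer theory over a field without \<open>\<zeta>\<close> does not in general lead to
  abelian groups: conjugation acts on Kummer characters both through the roots of unity and through
  the radicands. The family of radicands indexed by \<open>a\<close> leaves room for a second
  cyclotomic twist that cancels the first, and the outcome is written down as an explicit function
  on automorphisms. The order of choices is the main obstacle. Since \<open>N\<close> is built from
  \<open>d\<close>, the number \<open>d\<close> must be fixed while \<open>\<zeta>\<close> is still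
  unknown; hence the field in which radicals are bounded contains all of \<open>B\<close>, and with
  it every root of unity. Multiplicities are read off from specializations
  \<open>t \<mapsto> \<alpha>\<close>, and algebraic steps from constant terms of minimal
  polynomials, in place of valuations and norms. The image of the homomorphism is controlled only
  through the characters that kill it. To turn this dual information into a quotient, the image is
  pulled back to a lattice in \<open>\<int>\<^sup>r\<close>, which is free and so has
  coordinates.\<close>

lemma (in domain) eval_map_hom:
  assumes F: "subring F R" and \<phi>: "\<phi> \<in> ring_hom (R\<lparr>carrier := F\<rparr>) R" and y: "y \<in> carrier R"
  shows "ring_hom_ring (F[X]) R (\<lambda>p. eval (map \<phi> p) y)"
proof -
  interpret Hom: ring_hom_ring "R\<lparr>carrier := F\<rparr>" R \<phi>
    using ring_hom_ringI2[OF subring_is_ring[OF F] ring_axioms \<phi>] .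
  have inF: "set p \<subseteq> F" if "p \<in> carrier (F[X])" for p
    using that polynomial_incl by (simp add: univ_poly_def)
  have inR: "set (map \<phi> p) \<subseteq> carrier R" if "p \<in> carrier (F[X])" for p
    using inF[OF that] Hom.hom_closed by auto
  have add: "eval (map \<phi> (p \<oplus>\<^bsub>F[X]\<^esub> q)) y = eval (map \<phi> p) y \<oplus> eval (map \<phi> q) y"
    if p: "p \<in> carrier (F[X])" and q: "q \<in> carrier (F[X])" for p q
  proof -
    have pq: "p \<oplus>\<^bsub>F[X]\<^esub> q \<in> carrier (F[X])"
      using p q univ_poly_is_ring[OF F] by (simp add: ring.ring_simprules)
    \<comment> \<open>On a subring \<open>\<phi>\<close> may kill leading coefficients, so mapping a
      sum agrees with adding the mapped lists only after \<open>normalize\<close>; evaluation does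
      not see the difference.\<close>
    have "eval (map \<phi> (p \<oplus>\<^bsub>F[X]\<^esub> q)) y = eval (normalize (map \<phi> (p \<oplus>\<^bsub>F[X]\<^esub> q))) y"
      using eval_normalize[OF inR[OF pq] y] by simp
    also have "\<dots> = eval (poly_add (map \<phi> p) (map \<phi> q)) y"
      using Hom.poly_add_hom'[of p q] inF[OF p] inF[OF q] poly_add_consistent[OF F]
      by (simp add: univ_poly_add)
    also have "\<dots> = eval (map \<phi> p) y \<oplus> eval (map \<phi> q) y"
      using eval_poly_add[OF inR[OF p] inR[OF q] y] .
    finally show ?thesis .
  qed
  have mult: "eval (map \<phi> (p \<otimes>\<^bsub>F[X]\<^esub> q)) y = eval (map \<phi> p) y \<otimes> eval (map \<phi> q) y"
    if p: "p \<in> carrier (F[X])" and q: "q \<in> carrier (F[X])" for p q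
  proof -
    have pq: "p \<otimes>\<^bsub>F[X]\<^esub> q \<in> carrier (F[X])"
      using p q univ_poly_is_ring[OF F] by (simp add: ring.ring_simprules)
    have "eval (map \<phi> (p \<otimes>\<^bsub>F[X]\<^esub> q)) y = eval (normalize (map \<phi> (p \<otimes>\<^bsub>F[X]\<^esub> q))) y"
      using eval_normalize[OF inR[OF pq] y] by simp
    also have "\<dots> = eval (poly_mult (map \<phi> p) (map \<phi> q)) y"
      using Hom.poly_mult_hom'[of p q] inF[OF p] inF[OF q] poly_mult_consistent[OF F]
      by (simp add: univ_poly_mult)
    also have "\<dots> = eval (map \<phi> p) y \<otimes> eval (map \<phi> q) y"
      using eval_poly_mult[OF inR[OF p] inR[OF q] y] .
    finally show ?thesis .
  qed
  have "(\<lambda>p. eval (map \<phi> p) y) \<in> ring_hom (F[X]) R"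
  proof (rule ring_hom_memI)
    show "eval (map \<phi> \<one>\<^bsub>F[X]\<^esub>) y = \<one>"
      using Hom.hom_one by (simp add: univ_poly_one y)
  qed (use add mult eval_in_carrier[OF inR y] in auto)
  then show ?thesis
    using ring_hom_ringI2[OF univ_poly_is_ring[OF F] ring_axioms] by blast
qed

text \<open>The simple extension is a quotient of \<open>F[X]\<close>, so a map on it is a map on
  polynomials that respects the kernel of evaluation at \<open>x\<close>. Asking only for
  \<open>ker\<close> covers two cases: for algebraic \<open>x\<close> the kernel is generated by
  \<open>Irr F x\<close>; for transcendental \<open>x\<close> it is zero and \<open>y\<close> is
  arbitrary, which yields specializations.\<close>

lemma (in domain) simple_extension_hom:
  assumes F: "subring F R" and \<phi>: "\<phi> \<in> ring_hom (R\<lparr>carrier := F\<rparr>) R"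
    and x: "x \<in> carrier R" and y: "y \<in> carrier R"
    and ker: "\<And>p. p \<in> carrier (F[X]) \<Longrightarrow> eval p x = \<zero> \<Longrightarrow> eval (map \<phi> p) y = \<zero>"
  obtains \<tau> where "\<tau> \<in> ring_hom (R\<lparr>carrier := simple_extension F x\<rparr>) R"
    "\<And>a. a \<in> F \<Longrightarrow> \<tau> a = \<phi> a" "\<tau> x = y"
    "\<And>p. p \<in> carrier (F[X]) \<Longrightarrow> \<tau> (eval p x) = eval (map \<phi> p) y"
proof -
  interpret Fring: ring "F[X]" using univ_poly_is_ring[OF F] .
  interpret Hom: ring_hom_ring "R\<lparr>carrier := F\<rparr>" R \<phi>
    using ring_hom_ringI2[OF subring_is_ring[OF F] ring_axioms \<phi>] .
  interpret A: ring_hom_ring "F[X]" R "\<lambda>p. eval p x" using eval_ring_hom[OF F x] .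
  interpret B: ring_hom_ring "F[X]" R "\<lambda>p. eval (map \<phi> p) y" using eval_map_hom[OF F \<phi> y] .
  define \<tau> where "\<tau> z = eval (map \<phi> (SOME p. p \<in> carrier (F[X]) \<and> eval p x = z)) y" for z
  have \<tau>: "\<tau> (eval p x) = eval (map \<phi> p) y" if p: "p \<in> carrier (F[X])" for p
  proof -
    define q where "q = (SOME q. q \<in> carrier (F[X]) \<and> eval q x = eval p x)"
    have q: "q \<in> carrier (F[X])" "eval q x = eval p x"
      using someI[of "\<lambda>q. q \<in> carrier (F[X]) \<and> eval q x = eval p x" p] p unfolding q_def by auto
    have "eval (q \<ominus>\<^bsub>F[X]\<^esub> p) x = \<zero>"
      using p q A.hom_closed[OF p] by (simp add: a_minus_def r_neg)
    then have "eval (map \<phi> (q \<ominus>\<^bsub>F[X]\<^esub> p)) y = \<zero>"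
      using ker[of "q \<ominus>\<^bsub>F[X]\<^esub> p"] p q by simp
    then have "eval (map \<phi> q) y \<ominus> eval (map \<phi> p) y = \<zero>"
      using p q by (simp add: a_minus_def)
    then show ?thesis
      using B.hom_closed[OF p] B.hom_closed[OF q(1)] unfolding \<tau>_def q_def[symmetric]
      by simp
  qed
  have img: "simple_extension F x = (\<lambda>p. eval p x) ` carrier (F[X])"
    using simple_extension_as_eval_img[OF subringE(1)[OF F] x] .
  have hom: "\<tau> \<in> ring_hom (R\<lparr>carrier := simple_extension F x\<rparr>) R"
  proof (rule ring_hom_memI)
    fix a b assume "a \<in> carrier (R\<lparr>carrier := simple_extension F x\<rparr>)"
      "b \<in> carrier (R\<lparr>carrier := simple_extension F x\<rparr>)"
    then obtain p q where pq: "p \<in> carrier (F[X])" "a = eval p x" "q \<in> carrier (F[X])" "b = eval q x"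
      unfolding img by auto
    show "\<tau> (a \<otimes>\<^bsub>R\<lparr>carrier := simple_extension F x\<rparr>\<^esub> b) = \<tau> a \<otimes> \<tau> b"
      using \<tau>[of "p \<otimes>\<^bsub>F[X]\<^esub> q"] \<tau>[of p] \<tau>[of q] pq by simp
    show "\<tau> (a \<oplus>\<^bsub>R\<lparr>carrier := simple_extension F x\<rparr>\<^esub> b) = \<tau> a \<oplus> \<tau> b"
      using \<tau>[of "p \<oplus>\<^bsub>F[X]\<^esub> q"] \<tau>[of p] \<tau>[of q] pq by simp
    show "\<tau> a \<in> carrier R" using \<tau> pq B.hom_closed by simp
  next
    show "\<tau> \<one>\<^bsub>R\<lparr>carrier := simple_extension F x\<rparr>\<^esub> = \<one>"
      using \<tau>[of "\<one>\<^bsub>F[X]\<^esub>"] by simp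
  qed
  have const: "\<tau> a = \<phi> a" if a: "a \<in> F" for a
  proof (cases "a = \<zero>")
    case True
    then show ?thesis using \<tau>[of "[]"] Hom.hom_zero by (simp add: univ_poly_def polynomial_def)
  next
    case False
    have aR: "a \<in> carrier R" "\<phi> a \<in> carrier R" using a subringE(1)[OF F] Hom.hom_closed[of a] by auto
    then show ?thesis using \<tau>[of "[a]"] a False x y by (simp add: univ_poly_def polynomial_def)
  qed
  have "\<tau> x = y"
  proof -
    have "\<phi> \<one> = \<one>" "\<phi> \<zero> = \<zero>" using Hom.hom_one Hom.hom_zero by auto
    then show ?thesis
      using \<tau>[OF var_closed(1)[OF F]] eval_var[OF x] y by (simp add: var_def)
  qed
  then show ?thesis using that hom const \<tau> by blast
qed

lemma (in domain) subfield_hom_inj: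
  assumes F: "subfield F R" and \<phi>: "\<phi> \<in> ring_hom (R\<lparr>carrier := F\<rparr>) R"
  shows "inj_on \<phi> F"
proof -
  interpret Hom: ring_hom_ring "R\<lparr>carrier := F\<rparr>" R \<phi>
    using ring_hom_ringI2[OF subring_is_ring[OF subfieldE(1)[OF F]] ring_axioms \<phi>] .
  have "\<phi> \<one> = \<one>" "\<one> \<in> F"
    using Hom.hom_one subringE(3)[OF subfieldE(1)[OF F]] by auto
  then have "\<phi> ` F \<noteq> {\<zero>}"
    using one_not_zero by (metis imageI singletonD)
  then show ?thesis
    using Hom.non_trivial_field_hom_imp_inj[OF subfield_iff(2)[OF F]] by simp
qed

lemma (in domain) subfield_hom_polynomial:
  assumes F: "subfield F R" and \<phi>: "\<phi> \<in> ring_hom (R\<lparr>carrier := F\<rparr>) R"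
    and p: "p \<in> carrier (F[X])"
  shows "map \<phi> p \<in> carrier (poly_ring R)"
proof -
  interpret Hom: ring_hom_ring "R\<lparr>carrier := F\<rparr>" R \<phi>
    using ring_hom_ringI2[OF subring_is_ring[OF subfieldE(1)[OF F]] ring_axioms \<phi>] .
  have "set p \<subseteq> F" using p polynomial_incl by (simp add: univ_poly_def)
  then have "set (map \<phi> p) \<subseteq> carrier R" using Hom.hom_closed by auto
  moreover have "p \<noteq> [] \<Longrightarrow> lead_coeff (map \<phi> p) \<noteq> \<zero>"
  proof
    assume "p \<noteq> []" and 0: "lead_coeff (map \<phi> p) = \<zero>"
    then have l: "lead_coeff p \<in> F" "lead_coeff p \<noteq> \<zero>" "\<phi> (lead_coeff p) = \<zero>"
      using p \<open>set p \<subseteq> F\<close> by (auto simp: univ_poly_def polynomial_def hd_map)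
    moreover have "\<phi> \<zero> = \<zero>" using Hom.hom_zero by simp
    moreover have "\<zero> \<in> F" using subringE(2)[OF subfieldE(1)[OF F]] .
    ultimately show False using subfield_hom_inj[OF F \<phi>] by (metis inj_onD)
  qed
  ultimately show ?thesis by (auto simp: univ_poly_def polynomial_def)
qed

lemma (in algebraically_closed) exists_root:
  assumes p: "p \<in> carrier (poly_ring L)" and deg: "degree p > 0"
  obtains x where "x \<in> carrier L" "eval p x = \<zero>"
proof -
  have "size (roots p) > 0"
    using roots_over_carrier[OF p] deg unfolding splitted_def by simp
  then obtain x where "x \<in># roots p" by (metis multiset_nonemptyE nonempty_has_size)
  then show ?thesis using that roots_mem_iff_is_root[OF p] unfolding is_root_def by blast
qed

text \<open>\<open>Irr F x\<close> divides every polynomial over \<open>F\<close> that vanishes at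
  \<open>x\<close>, so it is enough that \<open>y\<close> is a root of its image.\<close>

lemma (in algebraically_closed) hom_extends_to_simple_extension:
  assumes F: "subfield F L" and \<phi>: "\<phi> \<in> ring_hom (L\<lparr>carrier := F\<rparr>) L"
    and x: "x \<in> carrier L" "(algebraic over F) x"
    and y: "y \<in> carrier L" "eval (map \<phi> (Irr F x)) y = \<zero>"
  obtains \<tau> where "\<tau> \<in> ring_hom (L\<lparr>carrier := simple_extension F x\<rparr>) L"
    "\<And>a. a \<in> F \<Longrightarrow> \<tau> a = \<phi> a" "\<tau> x = y"
proof -
  note SF = subfieldE(1)[OF F]
  interpret B: ring_hom_ring "F[X]" L "\<lambda>p. eval (map \<phi> p) y" using eval_map_hom[OF SF \<phi> y(1)] .
  have ker: "eval (map \<phi> p) y = \<zero>" if p: "p \<in> carrier (F[X])" and 0: "eval p x = \<zero>" for p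
  proof -
    have "Irr F x divides\<^bsub>F[X]\<^esub> p"
      using Irr_minimal[OF F x p 0] pdivides_iff_shell[OF F IrrE(1)[OF F x] p] by simp
    then obtain q where q: "q \<in> carrier (F[X])" "p = Irr F x \<otimes>\<^bsub>F[X]\<^esub> q"
      unfolding factor_def by blast
    then show ?thesis
      using y(2) B.hom_mult[OF IrrE(1)[OF F x] q(1)] B.hom_closed[OF q(1)] by simp
  qed
  show ?thesis
    using simple_extension_hom[OF SF \<phi> x(1) y(1) ker] that by metis
qed

lemma (in algebraically_closed) exists_hom_root:
  assumes F: "subfield F L" and \<phi>: "\<phi> \<in> ring_hom (L\<lparr>carrier := F\<rparr>) L"
    and x: "x \<in> carrier L" "(algebraic over F) x"
  obtains y where "y \<in> carrier L" "eval (map \<phi> (Irr F x)) y = \<zero>"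
proof (rule exists_root)
  show "map \<phi> (Irr F x) \<in> carrier (poly_ring L)"
    using subfield_hom_polynomial[OF F \<phi> IrrE(1)[OF F x]] .
  show "degree (map \<phi> (Irr F x)) > 0"
    using pirreducible_degree[OF F IrrE(1,2)[OF F x]] by simp
qed blast

text \<open>Generators are adjoined from the end of the list. At each stage the map is injective, so
  the image of the next minimal polynomial keeps its degree and has a root.\<close>

lemma (in algebraically_closed) hom_extends_to_finite_extension:
  assumes F: "subfield F L" and \<phi>: "\<phi> \<in> ring_hom (L\<lparr>carrier := F\<rparr>) L"
    and xs: "set xs \<subseteq> carrier L" "\<And>x. x \<in> set xs \<Longrightarrow> (algebraic over F) x"
  obtains \<tau> where "\<tau> \<in> ring_hom (L\<lparr>carrier := finite_extension F xs\<rparr>) L"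
    "\<And>a. a \<in> F \<Longrightarrow> \<tau> a = \<phi> a"
  using xs
proof (induct xs arbitrary: thesis)
  case Nil
  then show ?case using \<phi> by simp
next
  case (Cons x xs)
  obtain \<tau> where \<tau>: "\<tau> \<in> ring_hom (L\<lparr>carrier := finite_extension F xs\<rparr>) L"
    "\<And>a. a \<in> F \<Longrightarrow> \<tau> a = \<phi> a"
    using Cons.hyps Cons.prems(2,3) by (metis list.set_intros(2) set_subset_Cons subset_trans)
  have xs: "set xs \<subseteq> carrier L" "x \<in> carrier L" using Cons.prems by auto
  have M: "subfield (finite_extension F xs) L"
    using finite_extension_is_subfield[OF F xs(1)] Cons.prems(3) by simp
  have incl: "F \<subseteq> finite_extension F xs"
    using finite_extension_incl[OF subfieldE(3)[OF F] xs(1)] .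
  have alg: "(algebraic over (finite_extension F xs)) x"
    using algebraic_mono[OF incl] Cons.prems(3) by simp
  obtain y where y: "y \<in> carrier L" "eval (map \<tau> (Irr (finite_extension F xs) x)) y = \<zero>"
    using exists_hom_root[OF M \<tau>(1) xs(2) alg] .
  obtain \<tau>' where "\<tau>' \<in> ring_hom (L\<lparr>carrier := simple_extension (finite_extension F xs) x\<rparr>) L"
    "\<And>a. a \<in> finite_extension F xs \<Longrightarrow> \<tau>' a = \<tau> a"
    using hom_extends_to_simple_extension[OF M \<tau>(1) xs(2) alg y] by blast
  then show ?case using Cons.prems(1)[of \<tau>'] \<tau>(2) incl by (metis finite_extension.simps foldr_Cons o_apply subsetD)
qed

section \<open>Conjugates in characteristic zero\<close>

lemma (in domain) coeff_linear_mult: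
  assumes a: "a \<in> carrier R" and q: "set q \<subseteq> carrier R"
  shows "coeff (poly_mult [\<one>, a] q) (Suc i) = a \<otimes> coeff q (Suc i) \<oplus> coeff q i"
proof -
  have "coeff (poly_mult [\<one>, a] q) (Suc i)
      = (\<Oplus>k \<in> {..Suc i}. coeff [\<one>, a] k \<otimes> coeff q (Suc i - k))"
    using poly_mult_coeff[of "[\<one>, a]" q] a q by simp
  also have "\<dots> = (\<Oplus>k \<in> {0, 1}. coeff [\<one>, a] k \<otimes> coeff q (Suc i - k))"
    by (rule add.finprod_mono_neutral_cong_right) (use a q in auto)
  also have "\<dots> = a \<otimes> coeff q (Suc i) \<oplus> coeff q i"
    using a q by (subst finsum_insert) auto
  finally show ?thesis .
qed

text \<open>Such a \<open>p\<close> is \<open>(X - z) ^ Suc n\<close>; the induction splits off one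
  factor \<open>X - z\<close> at a time. This coefficient takes the place of the derivative in
  proving separability.\<close>

lemma (in field) second_coeff_of_single_root:
  assumes "p \<in> carrier (poly_ring R)" "splitted p" "lead_coeff p = \<one>" "degree p = Suc n"
    and z: "z \<in> carrier R" and "\<And>y. y \<in> carrier R \<Longrightarrow> eval p y = \<zero> \<Longrightarrow> y = z"
  shows "coeff p n = \<ominus> ([Suc n] \<cdot> z)"
  using assms(1-4,6)
proof (induct n arbitrary: p)
  case (0 p)
  then obtain x where x: "x \<in># roots p"
    unfolding splitted_def by (metis degree_one_imp_singleton_roots One_nat_def multi_member_last)
  then have "x = z" "is_root p z"
    using 0 roots_mem_iff_is_root[OF 0(1)] unfolding is_root_def by auto
  obtain b where b: "p = [\<one>, b]" "b \<in> carrier R"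
    using 0 degree_oneE[of p "carrier R"] by (metis One_nat_def list.sel(1))
  have "b = \<ominus> z"
    using \<open>is_root p z\<close> b z minus_equality[of b z] unfolding is_root_def by (simp add: a_comm)
  then show ?case using b z by simp
next
  case (Suc n p)
  then obtain x where x: "x \<in># roots p"
    unfolding splitted_def by (metis less_zeroE multiset_nonemptyE size_empty zero_less_Suc)
  then have zr: "is_root p z"
    using Suc roots_mem_iff_is_root[OF Suc(2)] unfolding is_root_def by metis
  then obtain q where q: "q \<in> carrier (poly_ring R)" "p = [\<one>, \<ominus> z] \<otimes>\<^bsub>poly_ring R\<^esub> q"
    using is_root_imp_pdivides[OF Suc(2)] unfolding pdivides_def by blast
  have lin: "[\<one>, \<ominus> z] \<in> carrier (poly_ring R)"
    using z by (simp add: univ_poly_def polynomial_def)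
  have pm: "p = poly_mult [\<one>, \<ominus> z] q" using q(2) by (simp add: univ_poly_mult)
  have "q \<noteq> []" using Suc.prems(4) pm poly_mult_zero(2)[of "[\<one>, \<ominus> z]"] z by auto
  have pol: "polynomial (carrier R) [\<one>, \<ominus> z]" "polynomial (carrier R) q"
    using lin q(1) by (simp_all add: univ_poly_carrier)
  have "degree p = Suc (degree q)"
    using poly_mult_degree_eq[OF carrier_is_subring pol] pm \<open>q \<noteq> []\<close> by simp
  then have dq: "degree q = Suc n" using Suc.prems(4) by simp
  have lq: "lead_coeff q = \<one>"
    using poly_mult_lead_coeff[OF carrier_is_subring pol] pm \<open>q \<noteq> []\<close> Suc.prems(3)
      polynomial_in_carrier[OF carrier_is_subring pol(2)] by (cases q) auto
  have sq: "splitted q"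
    using pdivides_imp_splitted[OF q(1) Suc(2) _ Suc(3)] q lin zr
      univ_poly_is_cring[OF carrier_is_subring]
    unfolding pdivides_def is_root_def
    by (metis cring.cring_simprules(14) dividesI)
  have qset: "set q \<subseteq> carrier R"
    using polynomial_in_carrier[OF carrier_is_subring pol(2)] .
  have "coeff q n = \<ominus> ([Suc n] \<cdot> z)"
  proof (rule Suc.hyps[OF q(1) sq lq dq])
    fix y assume y: "y \<in> carrier R" "eval q y = \<zero>"
    have "eval p y = eval [\<one>, \<ominus> z] y \<otimes> eval q y"
      unfolding pm by (rule eval_poly_mult) (use z qset y in auto)
    then have "eval p y = \<zero>" using y z by simp
    then show "y = z" using Suc.prems(5) y by blast
  qed
  moreover have "coeff q (Suc n) = \<one>"
    using lead_coeff_simp[OF \<open>q \<noteq> []\<close>] lq dq by simp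
  ultimately have "coeff p (Suc n) = \<ominus> z \<oplus> \<ominus> ([Suc n] \<cdot> z)"
    using coeff_linear_mult[OF _ qset, of "\<ominus> z" n] z pm by simp
  also have "\<dots> = \<ominus> ([Suc (Suc n)] \<cdot> z)"
    using z by (simp add: minus_add a_comm)
  finally show ?case .
qed

text \<open>If \<open>z\<close> were the only root, the second coefficient of its minimal polynomial
  would put a positive multiple of \<open>z\<close> into \<open>F\<close>, and dividing by the
  integer would put \<open>z\<close> itself there.\<close>

lemma (in algebraically_closed) other_root_of_Irr:
  assumes char0: "\<And>n::nat. n > 0 \<Longrightarrow> [n] \<cdot> \<one> \<noteq> \<zero>" and F: "subfield F L"
    and z: "z \<in> carrier L" "(algebraic over F) z" "z \<notin> F"
  obtains y where "y \<in> carrier L" "eval (Irr F z) y = \<zero>" "y \<noteq> z"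
proof (rule ccontr)
  assume "\<not> thesis"
  then have uniq: "\<And>y. y \<in> carrier L \<Longrightarrow> eval (Irr F z) y = \<zero> \<Longrightarrow> y = z"
    using that by blast
  note SF = subfieldE(1)[OF F]
  have p: "Irr F z \<in> carrier (poly_ring L)"
    using carrier_polynomial_shell[OF SF IrrE(1)[OF F z(1,2)]] .
  obtain n where n: "degree (Irr F z) = Suc n"
    using pirreducible_degree[OF F IrrE(1,2)[OF F z(1,2)]] by (metis Suc_le_D One_nat_def)
  have c: "coeff (Irr F z) n = \<ominus> ([Suc n] \<cdot> z)"
    by (rule second_coeff_of_single_root[OF p roots_over_carrier[OF p] IrrE(3)[OF F z(1,2)] n z(1) uniq])
  have "set (Irr F z) \<subseteq> F"
    using IrrE(1)[OF F z(1,2)] polynomial_incl by (simp add: univ_poly_def)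
  then have "coeff (Irr F z) n \<in> F"
    using ring.coeff_in_carrier[OF subring_is_ring[OF SF], of "Irr F z" n] coeff_consistent[OF SF]
    by simp
  then have nz: "[Suc n] \<cdot> z \<in> F"
    using c z subringE(5)[OF SF] by (metis add.nat_pow_closed minus_minus)
  have n1: "[Suc n] \<cdot> \<one> \<in> F"
  proof -
    have "[m] \<cdot> \<one> \<in> F" for m :: nat
      using subringE(2,3,7)[OF SF] by (induct m) auto
    then show ?thesis .
  qed
  have "[Suc n] \<cdot> z = ([Suc n] \<cdot> \<one>) \<otimes> z"
    using z add_pow_ldistr[of \<one> z "Suc n"] by simp
  moreover have unit: "[Suc n] \<cdot> \<one> \<in> Units L" using char0[of "Suc n"] field_Units by simp
  ultimately have "z = inv ([Suc n] \<cdot> \<one>) \<otimes> ([Suc n] \<cdot> z)"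
    using z by (simp add: m_assoc[symmetric] del: add.nat_pow_Suc)
  moreover have "inv ([Suc n] \<cdot> \<one>) \<in> F"
    using subfield_m_inv(1)[OF F, of "[Suc n] \<cdot> \<one>"] n1 char0[of "Suc n"] by simp
  ultimately have "z \<in> F" using subringE(6)[OF SF _ nz] by metis
  then show False using z by simp
qed

section \<open>Fixed fields and Galois quotients\<close>

text \<open>Extensionality matches \<open>BijGroup\<close>, whose elements are
  \<open>undefined\<close> outside \<open>M\<close>; an automorphism is then determined by its
  values on \<open>M\<close>.\<close>

definition field_auts :: "('a, 'b) ring_scheme \<Rightarrow> 'a set \<Rightarrow> 'a set \<Rightarrow> ('a \<Rightarrow> 'a) set" where
  "field_auts L M F = {s \<in> ring_hom (L\<lparr>carrier := M\<rparr>) (L\<lparr>carrier := M\<rparr>).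
     s \<in> extensional M \<and> bij_betw s M M \<and> (\<forall>a\<in>F. s a = a)}"

lemma carrier_galois_group: "carrier (galois_group (L\<lparr>carrier := M\<rparr>) F) = field_auts L M F"
  unfolding galois_group_def field_auts_def Bij_def by auto

lemma (in domain) ring_hom_into_subring:
  assumes "\<tau> \<in> ring_hom (R\<lparr>carrier := M\<rparr>) R"
  shows "\<And>a. a \<in> M \<Longrightarrow> \<tau> a \<in> carrier R"
    and "\<And>a b. a \<in> M \<Longrightarrow> b \<in> M \<Longrightarrow> \<tau> (a \<otimes> b) = \<tau> a \<otimes> \<tau> b"
    and "\<And>a b. a \<in> M \<Longrightarrow> b \<in> M \<Longrightarrow> \<tau> (a \<oplus> b) = \<tau> a \<oplus> \<tau> b"
    and "\<tau> \<one> = \<one>"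
  using ring_hom_memE[OF assms] by auto

text \<open>The finitely many roots in \<open>M\<close> of the minimal polynomial of
  \<open>w\<close> are mapped injectively into themselves, hence permuted, so \<open>w\<close> is a
  value of \<open>\<tau>\<close>.\<close>

lemma (in domain) endo_algebraic_surj:
  assumes F: "subfield F R" and M: "subfield M R" and FM: "F \<subseteq> M"
    and alg: "\<And>x. x \<in> M \<Longrightarrow> (algebraic over F) x"
    and \<tau>: "\<tau> \<in> ring_hom (R\<lparr>carrier := M\<rparr>) R" "\<And>a. a \<in> F \<Longrightarrow> \<tau> a = a" "\<tau> ` M \<subseteq> M"
  shows "bij_betw \<tau> M M"
proof -
  note SF = subfieldE(1)[OF F] and SM = subfieldE(1)[OF M]
  have inj: "inj_on \<tau> M" by (rule subfield_hom_inj[OF M \<tau>(1)])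
  interpret Hom: ring_hom_ring "R\<lparr>carrier := M\<rparr>" R \<tau>
    using ring_hom_ringI2[OF subring_is_ring[OF SM] ring_axioms \<tau>(1)] .
  have "w \<in> \<tau> ` M" if w: "w \<in> M" for w
  proof -
    have wR: "w \<in> carrier R" using w subringE(1)[OF SM] by auto
    define p where "p = Irr F w"
    note I = IrrE[OF F wR alg[OF w], folded p_def]
    have pR: "p \<in> carrier (poly_ring R)" using carrier_polynomial_shell[OF SF I(1)] .
    have "p \<noteq> []" using pirreducible_degree[OF F I(1,2)] by auto
    define Z where "Z = {x \<in> M. eval p x = \<zero>}"
    have "Z \<subseteq> {x. is_root p x}"
      using \<open>p \<noteq> []\<close> subringE(1)[OF SM] unfolding Z_def is_root_def by auto
    then have fin: "finite Z" using finite_number_of_roots[OF pR] finite_subset by blast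
    have pF: "set p \<subseteq> F" using I(1) polynomial_incl by (simp add: univ_poly_def)
    then have mp: "map \<tau> p = p" using \<tau>(2) by (simp add: map_idI subset_iff)
    have "\<tau> ` Z \<subseteq> Z"
    proof
      fix v assume "v \<in> \<tau> ` Z"
      then obtain x where x: "x \<in> M" "eval p x = \<zero>" "v = \<tau> x" unfolding Z_def by auto
      have "eval p (\<tau> x) = \<tau> (eval p x)"
        using Hom.eval_hom'[of x p] x(1) pF FM mp eval_consistent[OF SM] by auto
      then have "eval p v = \<zero>" using x Hom.hom_zero by simp
      then show "v \<in> Z" using x \<tau>(3) unfolding Z_def by auto
    qed
    moreover have "inj_on \<tau> Z" using inj unfolding Z_def by (auto intro: inj_on_subset)
    ultimately have "\<tau> ` Z = Z" using fin by (simp add: endo_inj_surj)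
    moreover have "w \<in> Z" using w I(4) unfolding Z_def by simp
    ultimately show ?thesis unfolding Z_def by blast
  qed
  then show ?thesis using inj \<tau>(3) unfolding bij_betw_def by auto
qed

text \<open>Send \<open>z\<close> to another root of its minimal polynomial and extend this
  embedding to \<open>M\<close>. Normality is asked only of the generators, since that can be
  checked on explicit radicals.\<close>

lemma (in algebraically_closed) normal_extension_fixed_field:
  assumes char0: "\<And>n::nat. n > 0 \<Longrightarrow> [n] \<cdot> \<one> \<noteq> \<zero>" and F: "subfield F L"
    and xs: "set xs \<subseteq> carrier L" "\<And>x. x \<in> set xs \<Longrightarrow> (algebraic over F) x"
    and M: "M = finite_extension F xs"
    and normal: "\<And>\<tau> x. \<tau> \<in> ring_hom (L\<lparr>carrier := M\<rparr>) L \<Longrightarrow> (\<And>a. a \<in> F \<Longrightarrow> \<tau> a = a) \<Longrightarrow>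
                   x \<in> set xs \<Longrightarrow> \<tau> x \<in> M"
    and z: "z \<in> M" "z \<notin> F"
  obtains s where "s \<in> field_auts L M F" "s z \<noteq> z"
proof -
  note SF = subfieldE(1)[OF F]
  have SFM: "subfield M L" using finite_extension_is_subfield[OF F xs(1)] xs(2) unfolding M by blast
  note SM = subfieldE(1)[OF SFM]
  have FM: "F \<subseteq> M" using finite_extension_incl[OF subfieldE(3)[OF F] xs(1)] unfolding M .
  have algM: "(algebraic over F) y" if "y \<in> M" for y
    using finite_extesion_mem_imp_algebraic[OF F xs(1), of y] xs(2) that unfolding M by blast
  have zL: "z \<in> carrier L" using z subringE(1)[OF SM] by auto
  obtain y where y: "y \<in> carrier L" "eval (Irr F z) y = \<zero>" "y \<noteq> z"
    using other_root_of_Irr[OF char0 F zL algM[OF z(1)] z(2)] .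
  have idF: "id \<in> ring_hom (L\<lparr>carrier := F\<rparr>) L"
    using subringE(1)[OF SF] by (intro ring_hom_memI) auto
  obtain \<tau>0 where \<tau>0: "\<tau>0 \<in> ring_hom (L\<lparr>carrier := simple_extension F z\<rparr>) L"
    "\<And>a. a \<in> F \<Longrightarrow> \<tau>0 a = a" "\<tau>0 z = y"
    using hom_extends_to_simple_extension[OF F idF zL algM[OF z(1)] y(1)] y(2) by auto
  define F1 where "F1 = simple_extension F z"
  have F1: "subfield F1 L" using simple_extension_is_subfield[OF F zL] algM[OF z(1)] unfolding F1_def by simp
  have FF1: "F \<subseteq> F1" using simple_extension_incl[OF subfieldE(3)[OF F] zL] unfolding F1_def .
  have zF1: "z \<in> F1" using simple_extension_mem[OF SF zL] unfolding F1_def .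
  have F1M: "F1 \<subseteq> M" using simple_extension_subring_incl[OF SM FM z(1)] unfolding F1_def .
  \<comment> \<open>The same generators produce \<open>M\<close> over \<open>F(z)\<close>, so the
    embedding that moves \<open>z\<close> extends to all of \<open>M\<close>.\<close>
  have "finite_extension F1 xs \<subseteq> M"
    using finite_extension_subring_incl[OF SM F1M] finite_extension_mem[OF SF xs(1)] unfolding M by blast
  moreover have "M \<subseteq> finite_extension F1 xs" using mono_finite_extension[OF FF1] unfolding M .
  ultimately have MF1: "M = finite_extension F1 xs" by blast
  obtain \<tau> where \<tau>: "\<tau> \<in> ring_hom (L\<lparr>carrier := M\<rparr>) L" "\<And>a. a \<in> F1 \<Longrightarrow> \<tau> a = \<tau>0 a"
    using hom_extends_to_finite_extension[OF F1 \<tau>0(1)[folded F1_def] xs(1)]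
      algebraic_mono[OF FF1] xs(2) unfolding MF1 by blast
  have \<tau>F: "\<And>a. a \<in> F \<Longrightarrow> \<tau> a = a" using \<tau>(2) \<tau>0(2) FF1 by auto
  have \<tau>z: "\<tau> z = y" using \<tau>(2)[OF zF1] \<tau>0(3) by simp
  interpret Hom: ring_hom_ring "L\<lparr>carrier := M\<rparr>" L \<tau>
    using ring_hom_ringI2[OF subring_is_ring[OF SM] ring_axioms \<tau>(1)] .
  note h = ring_hom_into_subring[OF \<tau>(1)]
  \<comment> \<open>The elements that \<open>\<tau>\<close> keeps inside \<open>M\<close> form a
    ring containing \<open>F\<close> and the generators, hence they are all of
    \<open>M\<close>.\<close>
  have "subring {a \<in> M. \<tau> a \<in> M} L"
  proof (rule subringI)
    fix a assume a: "a \<in> {a \<in> M. \<tau> a \<in> M}"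
    have "\<tau> (\<ominus> a) = \<ominus> \<tau> a"
    proof -
      have "\<tau> (\<ominus> a) \<oplus> \<tau> a = \<zero>"
        using h(3)[of "\<ominus> a" a] a subringE(5)[OF SM] subringE(1)[OF SM] Hom.hom_zero
        by (auto simp: l_neg subset_iff)
      then show ?thesis
        using h(1) a subringE(5)[OF SM] by (metis (no_types, lifting) mem_Collect_eq minus_equality)
    qed
    then show "\<ominus> a \<in> {a \<in> M. \<tau> a \<in> M}" using a subringE(5)[OF SM] by auto
  qed (use subringE[OF SM] h in auto)
  moreover have "F \<subseteq> {a \<in> M. \<tau> a \<in> M}" using FM \<tau>F by auto
  moreover have "set xs \<subseteq> {a \<in> M. \<tau> a \<in> M}"
    using normal[OF \<tau>(1) \<tau>F] finite_extension_mem[OF SF xs(1)] unfolding M by blast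
  ultimately have "M \<subseteq> {a \<in> M. \<tau> a \<in> M}"
    using finite_extension_subring_incl unfolding M by blast
  then have into: "\<tau> ` M \<subseteq> M" by auto
  have bij: "bij_betw \<tau> M M" by (rule endo_algebraic_surj[OF F SFM FM algM \<tau>(1) \<tau>F into])
  have "restrict \<tau> M \<in> field_auts L M F"
    unfolding field_auts_def mem_Collect_eq
  proof (intro conjI ballI)
    show "restrict \<tau> M \<in> ring_hom (L\<lparr>carrier := M\<rparr>) (L\<lparr>carrier := M\<rparr>)"
      using into h(2-4) subringE[OF SM] by (intro ring_hom_memI) auto
    show "bij_betw (restrict \<tau> M) M M" using bij by simp
  qed (use \<tau>F FM in auto)
  moreover have "restrict \<tau> M z \<noteq> z" using \<tau>z y(3) z(1) by simp
  ultimately show ?thesis using that by blast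
qed

section \<open>Independence of characters and Artin's theorem\<close>

lemma (in domain) dedekind_independence:
  assumes M: "M \<subseteq> carrier R" "\<one> \<in> M" "\<And>x y. x \<in> M \<Longrightarrow> y \<in> M \<Longrightarrow> x \<otimes> y \<in> M"
    and S: "finite S" "\<And>f x. f \<in> S \<Longrightarrow> x \<in> M \<Longrightarrow> f x \<in> carrier R" "\<And>f. f \<in> S \<Longrightarrow> f \<one> = \<one>"
      "\<And>f x y. f \<in> S \<Longrightarrow> x \<in> M \<Longrightarrow> y \<in> M \<Longrightarrow> f (x \<otimes> y) = f x \<otimes> f y"
    and dist: "\<And>f g. f \<in> S \<Longrightarrow> g \<in> S \<Longrightarrow> f \<noteq> g \<Longrightarrow> \<exists>x\<in>M. f x \<noteq> g x"
    and c: "\<And>f. f \<in> S \<Longrightarrow> c f \<in> carrier R"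
    and rel: "\<And>x. x \<in> M \<Longrightarrow> (\<Oplus>f\<in>S. c f \<otimes> f x) = \<zero>"
    and f: "f \<in> S"
  shows "c f = \<zero>"
proof -
  \<comment> \<open>The coefficients are quantified inside, because the induction hypothesis is
    applied to the new coefficients \<open>c f \<otimes> (f y \<ominus> f0 y)\<close>.\<close>
  have "\<forall>c. (\<forall>f\<in>S. f \<in> M \<rightarrow> carrier R \<and> f \<one> = \<one> \<and> (\<forall>x\<in>M. \<forall>y\<in>M. f (x \<otimes> y) = f x \<otimes> f y)) \<longrightarrow>
      (\<forall>f\<in>S. \<forall>g\<in>S. f \<noteq> g \<longrightarrow> (\<exists>x\<in>M. f x \<noteq> g x)) \<longrightarrow> c \<in> S \<rightarrow> carrier R \<longrightarrow>
      (\<forall>x\<in>M. (\<Oplus>f\<in>S. c f \<otimes> f x) = \<zero>) \<longrightarrow> (\<forall>f\<in>S. c f = \<zero>)"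
    using S(1)
  proof (induct S rule: finite_induct)
    case empty
    then show ?case by simp
  next
    case (insert f0 S)
    show ?case
    proof (intro allI impI)
      fix c
      assume chars: "\<forall>f\<in>insert f0 S. f \<in> M \<rightarrow> carrier R \<and> f \<one> = \<one> \<and> (\<forall>x\<in>M. \<forall>y\<in>M. f (x \<otimes> y) = f x \<otimes> f y)"
        and dist: "\<forall>f\<in>insert f0 S. \<forall>g\<in>insert f0 S. f \<noteq> g \<longrightarrow> (\<exists>x\<in>M. f x \<noteq> g x)"
        and cc: "c \<in> insert f0 S \<rightarrow> carrier R"
        and rel: "\<forall>x\<in>M. (\<Oplus>f\<in>insert f0 S. c f \<otimes> f x) = \<zero>"
      have f0: "f0 x \<in> carrier R" if "x \<in> M" for x using chars that by auto
      have fS: "f x \<in> carrier R" if "f \<in> S" "x \<in> M" for f x using chars that by auto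
      have fmult: "f (x \<otimes> y) = f x \<otimes> f y" if "f \<in> insert f0 S" "x \<in> M" "y \<in> M" for f x y
        using chars that by blast
      have cS: "c f \<in> carrier R" if "f \<in> S" for f using cc that by auto
      have c0: "c f0 \<in> carrier R" using cc by auto
      have sum: "c f0 \<otimes> f0 x \<oplus> (\<Oplus>f\<in>S. c f \<otimes> f x) = \<zero>" if x: "x \<in> M" for x
        using rel[rule_format, OF x] insert.hyps fS[OF _ x] f0[OF x] cS c0
        by (subst (asm) finsum_insert) auto
      have zero: "c g = \<zero>" if g: "g \<in> S" for g
      proof -
        have "f0 \<noteq> g" using insert.hyps g by blast
        then obtain y where y: "y \<in> M" "f0 y \<noteq> g y" using dist g by blast
        \<comment> \<open>Subtracting \<open>f0 y\<close> times the relation at \<open>x\<close>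
          from the relation at \<open>y \<otimes> x\<close> removes \<open>f0\<close>, while
          \<open>g\<close> keeps the nonzero factor \<open>g y \<ominus> f0 y\<close>.\<close>
        have rel': "(\<Oplus>f\<in>S. (c f \<otimes> (f y \<ominus> f0 y)) \<otimes> f x) = \<zero>" if x: "x \<in> M" for x
        proof -
          have yx: "y \<otimes> x \<in> M" using M(3) x y by blast
          have 1: "c f0 \<otimes> (f0 y \<otimes> f0 x) \<oplus> (\<Oplus>f\<in>S. c f \<otimes> (f y \<otimes> f x)) = \<zero>"
          proof -
            have "(\<Oplus>f\<in>S. c f \<otimes> (f y \<otimes> f x)) = (\<Oplus>f\<in>S. c f \<otimes> f (y \<otimes> x))"
              by (rule finsum_cong') (use fmult x y fS cS M(3) in auto)
            then show ?thesis using sum[OF yx] fmult[of f0 y x] x y by simp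
          qed
          have 2: "f0 y \<otimes> (c f0 \<otimes> f0 x) \<oplus> (\<Oplus>f\<in>S. f0 y \<otimes> (c f \<otimes> f x)) = \<zero>"
          proof -
            have "f0 y \<otimes> (c f0 \<otimes> f0 x \<oplus> (\<Oplus>f\<in>S. c f \<otimes> f x)) = \<zero>"
              using sum[OF x] f0[OF y(1)] by simp
            then show ?thesis
              using f0[OF y(1)] f0[OF x] c0 cS fS[OF _ x] insert.hyps(1)
              by (subst (asm) r_distr) (auto simp: finsum_rdistr)
          qed
          have fin: "(\<Oplus>f\<in>S. c f \<otimes> (f y \<otimes> f x)) \<in> carrier R" "(\<Oplus>f\<in>S. f0 y \<otimes> (c f \<otimes> f x)) \<in> carrier R"
            using cS fS x y f0 by (auto intro!: finsum_closed)
          have "(\<Oplus>f\<in>S. c f \<otimes> (f y \<otimes> f x)) = (\<Oplus>f\<in>S. f0 y \<otimes> (c f \<otimes> f x))"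
          proof -
            have "c f0 \<otimes> (f0 y \<otimes> f0 x) = f0 y \<otimes> (c f0 \<otimes> f0 x)"
              using c0 f0[OF x] f0[OF y(1)] by (simp add: m_lcomm)
            then have "f0 y \<otimes> (c f0 \<otimes> f0 x) \<oplus> (\<Oplus>f\<in>S. c f \<otimes> (f y \<otimes> f x))
                = f0 y \<otimes> (c f0 \<otimes> f0 x) \<oplus> (\<Oplus>f\<in>S. f0 y \<otimes> (c f \<otimes> f x))"
              using 1 2 by simp
            moreover have "f0 y \<otimes> (c f0 \<otimes> f0 x) \<in> carrier R" using c0 f0[OF x] f0[OF y(1)] by simp
            ultimately show ?thesis using add.l_cancel[OF _ fin(1) fin(2)] by blast
          qed
          also have "(\<Oplus>f\<in>S. c f \<otimes> (f y \<otimes> f x)) = (\<Oplus>f\<in>S. (c f \<otimes> (f y \<ominus> f0 y)) \<otimes> f x \<oplus> f0 y \<otimes> (c f \<otimes> f x))"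
          proof (rule finsum_cong', simp)
            fix f assume f: "f \<in> S"
            have "c f \<in> carrier R" "f x \<in> carrier R" "f y \<in> carrier R" "f0 y \<in> carrier R"
              using f cS fS f0 x y by auto
            then show "c f \<otimes> (f y \<otimes> f x) = c f \<otimes> (f y \<ominus> f0 y) \<otimes> f x \<oplus> f0 y \<otimes> (c f \<otimes> f x)"
              by (simp add: a_minus_def r_distr l_distr r_minus l_minus m_assoc m_lcomm a_assoc l_neg)
          qed (use cS fS f0 x y in auto)
          also have "\<dots> = (\<Oplus>f\<in>S. (c f \<otimes> (f y \<ominus> f0 y)) \<otimes> f x) \<oplus> (\<Oplus>f\<in>S. f0 y \<otimes> (c f \<otimes> f x))"
            by (rule finsum_addf) (use cS fS f0 x y in auto)
          finally have 3: "(\<Oplus>f\<in>S. (c f \<otimes> (f y \<ominus> f0 y)) \<otimes> f x) \<oplus> (\<Oplus>f\<in>S. f0 y \<otimes> (c f \<otimes> f x))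
              = (\<Oplus>f\<in>S. f0 y \<otimes> (c f \<otimes> f x))" by simp
          have 4: "(\<Oplus>f\<in>S. (c f \<otimes> (f y \<ominus> f0 y)) \<otimes> f x) \<in> carrier R"
            by (rule finsum_closed) (use cS fS f0 x y in auto)
          show ?thesis
            using add.r_cancel[OF _ 4 zero_closed fin(2)] 3 fin(2) by simp
        qed
        have "c g \<otimes> (g y \<ominus> f0 y) = \<zero>"
          using insert.hyps(3)[rule_format, of "\<lambda>f. c f \<otimes> (f y \<ominus> f0 y)" g] chars dist cS fS f0 y(1) rel' g
          by auto
        moreover have "g y \<ominus> f0 y \<noteq> \<zero>" using y fS[OF g y(1)] f0[OF y(1)] by simp
        ultimately show ?thesis using integral cS[OF g] fS[OF g y(1)] f0[OF y(1)] by blast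
      qed
      have "(\<Oplus>f\<in>S. c f \<otimes> f \<one>) = \<zero>"
        by (rule add.finprod_one_eqI) (use zero fS M(2) in auto)
      then have "c f0 = \<zero>" using sum[OF M(2)] c0 chars by simp
      then show "\<forall>f\<in>insert f0 S. c f = \<zero>" using zero by (simp only: ball_simps) blast
    qed
  qed
  then show ?thesis using S(2-4) dist c rel f by (simp add: Pi_iff)
qed

text \<open>If \<open>s\<close> lay outside \<open>H\<close>, the cosets \<open>H\<close> and
  \<open>s H\<close> would be disjoint. The trace over \<open>H\<close> is fixed by
  \<open>H\<close>, hence by \<open>s\<close>, so the sum over \<open>H\<close> equals the sum over
  \<open>s H\<close> on all of \<open>M\<close>. This contradicts the independence of distinct
  automorphisms.\<close>

lemma (in domain) artin_lemma:
  assumes M: "subring M R"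
    and H: "subgroup H (BijGroup M)" "finite H" "H \<subseteq> ring_hom (R\<lparr>carrier := M\<rparr>) (R\<lparr>carrier := M\<rparr>)"
    and s: "s \<in> Bij M" "s \<in> ring_hom (R\<lparr>carrier := M\<rparr>) (R\<lparr>carrier := M\<rparr>)"
      "\<And>z. z \<in> M \<Longrightarrow> (\<And>h. h \<in> H \<Longrightarrow> h z = z) \<Longrightarrow> s z = z"
  shows "s \<in> H"
proof (rule ccontr)
  assume sH: "s \<notin> H"
  interpret G: group "BijGroup M" by (rule group_BijGroup)
  interpret H: subgroup H "BijGroup M" by (rule H(1))
  have mult: "g \<otimes>\<^bsub>BijGroup M\<^esub> h = compose M g h" if "g \<in> Bij M" "h \<in> Bij M" for g h
    using that by (simp add: BijGroup_def)
  have Hbij: "h \<in> Bij M" if "h \<in> H" for h using that H.subset by (auto simp: BijGroup_def)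
  note MR = subringE(1)[OF M]
  have ring_hom: "h \<in> ring_hom (R\<lparr>carrier := M\<rparr>) (R\<lparr>carrier := M\<rparr>)" if "h \<in> insert s H" for h
    using that H(3) s(2) by auto
  have hom: "\<And>h x. h \<in> insert s H \<Longrightarrow> x \<in> M \<Longrightarrow> h x \<in> M"
    "\<And>h. h \<in> insert s H \<Longrightarrow> h \<one> = \<one>"
    "\<And>h x y. h \<in> insert s H \<Longrightarrow> x \<in> M \<Longrightarrow> y \<in> M \<Longrightarrow> h (x \<otimes> y) = h x \<otimes> h y"
    "\<And>h x y. h \<in> insert s H \<Longrightarrow> x \<in> M \<Longrightarrow> y \<in> M \<Longrightarrow> h (x \<oplus> y) = h x \<oplus> h y"
    using ring_hom_memE[OF ring_hom] by auto
  have homR: "h x \<in> carrier R" if "h \<in> insert s H" "x \<in> M" for h x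
    using hom(1)[OF that] MR by auto
  have hom0: "h \<zero> = \<zero>" if "h \<in> insert s H" for h
    using hom(4)[OF that, of \<zero> \<zero>] homR[OF that, of \<zero>] subringE(2)[OF M] by simp
  have homsum: "g (\<Oplus>h\<in>I. u h) = (\<Oplus>h\<in>I. g (u h)) \<and> (\<Oplus>h\<in>I. u h) \<in> M"
    if g: "g \<in> insert s H" and I: "finite I" and u: "u ` I \<subseteq> M" for g I and u :: "('a \<Rightarrow> 'a) \<Rightarrow> 'a"
    using I u
  proof (induct I rule: finite_induct)
    case empty
    then show ?case using hom0[OF g] subringE(2)[OF M] by simp
  next
    case (insert i I)
    have uM: "u i \<in> M" "u ` I \<subseteq> M" using insert(4) by auto
    then have pi: "u \<in> I \<rightarrow> carrier R" "u i \<in> carrier R" "(\<lambda>h. g (u h)) \<in> I \<rightarrow> carrier R" "g (u i) \<in> carrier R"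
      using MR homR[OF g] by (auto simp: image_subset_iff subset_iff Pi_iff)
    note IH = insert(3)[OF uM(2)]
    have "(\<Oplus>h\<in>insert i I. u h) = u i \<oplus> (\<Oplus>h\<in>I. u h)"
      "(\<Oplus>h\<in>insert i I. g (u h)) = g (u i) \<oplus> (\<Oplus>h\<in>I. g (u h))"
      using finsum_insert[OF insert(1,2)] pi by auto
    then show ?case
      using hom(4)[OF g uM(1) conjunct2[OF IH]] IH subringE(7)[OF M uM(1) conjunct2[OF IH]] by simp
  qed
  define tr where "tr x = (\<Oplus>h\<in>H. h x)" for x
  have trM: "tr x \<in> M" if "x \<in> M" for x
    unfolding tr_def using homsum[OF insertI1 H(2), of "\<lambda>h. h x"] hom(1) that by auto
  have stable: "g (tr x) = tr x" if g: "g \<in> H" and x: "x \<in> M" for g x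
  proof -
    have inj: "inj_on (\<lambda>h. compose M g h) H"
    proof (rule inj_onI)
      fix h h' assume h: "h \<in> H" "h' \<in> H" "compose M g h = compose M g h'"
      then have "g \<otimes>\<^bsub>BijGroup M\<^esub> h = g \<otimes>\<^bsub>BijGroup M\<^esub> h'" using mult Hbij g by simp
      then show "h = h'" using G.l_cancel[of g h h'] H.subset g h(1,2) by blast
    qed
    have "(\<lambda>h. compose M g h) ` H \<subseteq> H" using H.m_closed[OF g] mult[OF Hbij[OF g] Hbij] by auto
    then have img: "(\<lambda>h. compose M g h) ` H = H" using inj H(2) by (simp add: endo_inj_surj)
    have "g (tr x) = (\<Oplus>h\<in>H. g (h x))"
      unfolding tr_def using homsum[of g H "\<lambda>h. h x"] g H(2) hom(1) x by auto
    also have "\<dots> = (\<Oplus>h\<in>H. (compose M g h) x)"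
      by (rule finsum_cong') (use hom(1) g x MR in \<open>auto simp: compose_def\<close>)
    also have "\<dots> = (\<Oplus>h\<in>(\<lambda>h. compose M g h) ` H. h x)"
      by (rule finsum_reindex[symmetric]) (use inj img hom(1) x MR in auto)
    finally show ?thesis unfolding tr_def img .
  qed
  have strace: "s (tr x) = tr x" if "x \<in> M" for x
    using s(3)[OF trM[OF that]] stable[OF _ that] by blast
  define S2 where "S2 = (\<lambda>h. compose M s h) ` H"
  have inj2: "inj_on (\<lambda>h. compose M s h) H"
  proof (rule inj_onI)
    fix g h assume gh: "g \<in> H" "h \<in> H" "compose M s g = compose M s h"
    have "s \<in> carrier (BijGroup M)" using s(1) by (simp add: BijGroup_def)
    moreover have "s \<otimes>\<^bsub>BijGroup M\<^esub> g = s \<otimes>\<^bsub>BijGroup M\<^esub> h" using gh mult s(1) Hbij by simp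
    ultimately show "g = h" using G.l_cancel[of s g h] H.subset gh(1,2) by blast
  qed
  have disj: "H \<inter> S2 = {}"
  proof (rule ccontr)
    assume "H \<inter> S2 \<noteq> {}"
    then obtain g h where gh: "g \<in> H" "h \<in> H" "compose M s h = g" unfolding S2_def by auto
    have sc: "s \<in> carrier (BijGroup M)" using s(1) by (simp add: BijGroup_def)
    have hc: "h \<in> carrier (BijGroup M)" using gh(2) H.subset by blast
    have "s \<otimes>\<^bsub>BijGroup M\<^esub> h = g" using gh mult s(1) Hbij by simp
    then have "s = g \<otimes>\<^bsub>BijGroup M\<^esub> inv\<^bsub>BijGroup M\<^esub> h"
      using sc hc by (simp add: G.m_assoc flip: \<open>s \<otimes>\<^bsub>BijGroup M\<^esub> h = g\<close>)
    then show False using sH gh H.m_closed H.m_inv_closed by metis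
  qed
  define S where "S = H \<union> S2"
  \<comment> \<open>With these signs the relation states that the traces over \<open>H\<close> and
    over the coset agree, which holds because \<open>s\<close> fixes traces.\<close>
  define c where "c f = (if f \<in> H then \<one> else \<ominus> \<one>)" for f :: "'a \<Rightarrow> 'a"
  have SM: "f x \<in> M" if "f \<in> S" "x \<in> M" for f x
    using that hom(1) unfolding S_def S2_def compose_def by auto
  have SR: "f x \<in> carrier R" if "f \<in> S" "x \<in> M" for f x using SM[OF that] MR by auto
  have Sext: "f \<in> extensional M" if "f \<in> S" for f
    using that Hbij unfolding S_def S2_def Bij_def by auto
  have one: "\<one>\<^bsub>BijGroup M\<^esub> \<in> H" by (rule H.one_closed)
  have "c \<one>\<^bsub>BijGroup M\<^esub> = \<zero>"
  proof (rule dedekind_independence[of M S c])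
    show "finite S" using H(2) unfolding S_def S2_def by simp
    fix f assume "f \<in> S"
    then consider "f \<in> H" | h where "h \<in> H" "f = compose M s h" unfolding S_def S2_def by blast
    then have "f \<one> = \<one> \<and> (\<forall>x\<in>M. \<forall>y\<in>M. f (x \<otimes> y) = f x \<otimes> f y)"
    proof cases
      case 1
      then show ?thesis using hom(2,3)[of f] by simp
    next
      case 2
      then show ?thesis
        using hom(1,2,3)[of h] hom(2,3)[of s] subringE(3,6)[OF M] by (simp add: compose_def)
    qed
    then show "f \<one> = \<one>" "\<And>x y. x \<in> M \<Longrightarrow> y \<in> M \<Longrightarrow> f (x \<otimes> y) = f x \<otimes> f y" by blast+
  next
    show "\<exists>x\<in>M. f x \<noteq> g x" if "f \<in> S" "g \<in> S" "f \<noteq> g" for f g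
      using Sext[OF that(1)] Sext[OF that(2)] that(3) by (meson extensionalityI)
    show "(\<Oplus>f\<in>S. c f \<otimes> f x) = \<zero>" if x: "x \<in> M" for x
    proof -
      have fin2: "finite S2" using H(2) unfolding S2_def by simp
      have "(\<Oplus>f\<in>S. c f \<otimes> f x) = (\<Oplus>f\<in>H. c f \<otimes> f x) \<oplus> (\<Oplus>f\<in>S2. c f \<otimes> f x)"
        unfolding S_def
        by (rule finsum_Un_disjoint) (use H(2) fin2 disj SR x in \<open>auto simp: c_def S_def\<close>)
      also have "(\<Oplus>f\<in>H. c f \<otimes> f x) = tr x"
        unfolding tr_def by (rule finsum_cong') (use homR x in \<open>auto simp: c_def\<close>)
      also have "(\<Oplus>f\<in>S2. c f \<otimes> f x) = (\<Oplus>f\<in>S2. \<ominus> \<one> \<otimes> f x)"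
        by (rule finsum_cong') (use SR x disj in \<open>auto simp: c_def S_def\<close>)
      also have "\<dots> = \<ominus> \<one> \<otimes> (\<Oplus>f\<in>S2. f x)"
        by (rule finsum_rdistr[symmetric]) (use fin2 SR x in \<open>auto simp: S_def\<close>)
      also have "(\<Oplus>f\<in>S2. f x) = (\<Oplus>h\<in>H. compose M s h x)"
        unfolding S2_def by (rule finsum_reindex) (use inj2 SR x in \<open>auto simp: S_def S2_def\<close>)
      also have "\<dots> = (\<Oplus>h\<in>H. s (h x))"
        by (rule finsum_cong') (use homR[OF insertI1 hom(1)] x in \<open>auto simp: compose_def\<close>)
      also have "\<dots> = s (tr x)"
        unfolding tr_def using homsum[of s H "\<lambda>h. h x"] H(2) hom(1)[OF _ x] by (simp add: image_subset_iff)
      also have "\<dots> = tr x" by (rule strace[OF x])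
      finally show ?thesis using trM[OF x] MR by (simp add: l_minus r_neg subset_iff)
    qed
  qed (use MR subringE(3,6)[OF M] SM one in \<open>auto simp: c_def S_def\<close>)
  then show False using one unfolding c_def by simp
qed

text \<open>Dimensions are computed in the ambient field, whereas
  \<open>finite_galois_extension\<close> asks for them inside the structure with the smaller
  carrier.\<close>

lemma (in ring) dimension_consistent:
  assumes M: "subring M R" and K: "subfield K R" "dimension n K E" "E \<subseteq> M"
  shows "ring.dimension (R\<lparr>carrier := M\<rparr>) n K E"
proof -
  interpret M: ring "R\<lparr>carrier := M\<rparr>" by (rule subring_is_ring[OF M])
  show ?thesis
    using K(2,3,1)
  proof (induct rule: dimension.induct)
    case (zero_dim K)
    show ?case using M.zero_dim[of K] by simp
  next
    case (Suc_dim v E n K)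
    note E = space_subgroup_props[OF Suc_dim(6,3)]
    have "\<one> \<otimes> v \<oplus> e \<in> line_extension K v E" if "e \<in> E" for e
      using line_extension_mem_iff[of "\<one> \<otimes> v \<oplus> e" K v E] subringE(3)[OF subfieldE(1)[OF Suc_dim(6)]] that
      by blast
    then have "v \<in> M" using Suc_dim(5,1) E(2) by fastforce
    have "e \<in> line_extension K v E" if "e \<in> E" for e
    proof -
      have "e = \<zero> \<otimes> v \<oplus> e" using that E(1) Suc_dim(1) by auto
      then show ?thesis
        using line_extension_mem_iff[of e K v E] subringE(2)[OF subfieldE(1)[OF Suc_dim(6)]] that by blast
    qed
    then have "E \<subseteq> M" using Suc_dim(5) by blast
    then show ?case
      using M.Suc_dim[of v E n K] Suc_dim \<open>v \<in> M\<close> line_extension_consistent[OF M] by simp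
  qed
qed

lemma field_autsD:
  assumes "s \<in> field_auts R M F"
  shows "s \<in> Bij M" and "s \<in> extensional M" and "\<And>x. x \<in> M \<Longrightarrow> s x \<in> M" and "\<And>a. a \<in> F \<Longrightarrow> s a = a"
    and "\<And>x y. x \<in> M \<Longrightarrow> y \<in> M \<Longrightarrow> s (x \<otimes>\<^bsub>R\<^esub> y) = s x \<otimes>\<^bsub>R\<^esub> s y"
    and "\<And>x y. x \<in> M \<Longrightarrow> y \<in> M \<Longrightarrow> s (x \<oplus>\<^bsub>R\<^esub> y) = s x \<oplus>\<^bsub>R\<^esub> s y"
    and "s \<one>\<^bsub>R\<^esub> = \<one>\<^bsub>R\<^esub>"
    and "inj_on s M" and "s ` M = M"
  using assms ring_hom_memE[of s "R\<lparr>carrier := M\<rparr>" "R\<lparr>carrier := M\<rparr>"]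
  unfolding field_auts_def Bij_def bij_betw_def by auto

lemma field_autsI:
  assumes "s \<in> Bij M" "\<And>a. a \<in> F \<Longrightarrow> s a = a"
    and "\<And>x y. x \<in> M \<Longrightarrow> y \<in> M \<Longrightarrow> s (x \<otimes>\<^bsub>R\<^esub> y) = s x \<otimes>\<^bsub>R\<^esub> s y"
    and "\<And>x y. x \<in> M \<Longrightarrow> y \<in> M \<Longrightarrow> s (x \<oplus>\<^bsub>R\<^esub> y) = s x \<oplus>\<^bsub>R\<^esub> s y"
    and "s \<one>\<^bsub>R\<^esub> = \<one>\<^bsub>R\<^esub>"
  shows "s \<in> field_auts R M F"
  using assms Bij_imp_funcset[OF assms(1)] unfolding field_auts_def Bij_def
  by (auto intro!: ring_hom_memI)

lemma (in domain) subgroup_field_auts: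
  assumes M: "subring M R" and FM: "F \<subseteq> M"
  shows "subgroup (field_auts R M F) (BijGroup M)"
proof -
  interpret G: group "BijGroup M" by (rule group_BijGroup)
  note closed = subringE(3,6,7)[OF M]
  show ?thesis
  proof (rule G.subgroupI)
    show "field_auts R M F \<subseteq> carrier (BijGroup M)"
      using field_autsD(1) by (auto simp: BijGroup_def)
  next
    have "(\<lambda>x\<in>M. x) \<in> field_auts R M F"
      by (rule field_autsI) (use id_Bij FM closed in auto)
    then show "field_auts R M F \<noteq> {}" by blast
  next
    fix s assume s: "s \<in> field_auts R M F"
    note sD = field_autsD[OF s]
    have "(\<lambda>x\<in>M. inv_into M s x) \<in> field_auts R M F"
    proof (rule field_autsI)
      show "(\<lambda>x\<in>M. inv_into M s x) \<in> Bij M" by (rule restrict_inv_into_Bij[OF sD(1)])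
      show "(\<lambda>x\<in>M. inv_into M s x) a = a" if "a \<in> F" for a
        using that FM sD(4)[OF that] inv_into_f_f[OF sD(8), of a] by auto
      show "(\<lambda>x\<in>M. inv_into M s x) (x \<otimes> y) = (\<lambda>x\<in>M. inv_into M s x) x \<otimes> (\<lambda>x\<in>M. inv_into M s x) y"
        if "x \<in> M" "y \<in> M" for x y
        using Bij_inv_into_lemma[of M s "(\<otimes>)" x y] sD(1,5) closed that by simp
      show "(\<lambda>x\<in>M. inv_into M s x) (x \<oplus> y) = (\<lambda>x\<in>M. inv_into M s x) x \<oplus> (\<lambda>x\<in>M. inv_into M s x) y"
        if "x \<in> M" "y \<in> M" for x y
        using Bij_inv_into_lemma[of M s "(\<oplus>)" x y] sD(1,6) closed that by simp
      show "(\<lambda>x\<in>M. inv_into M s x) \<one> = \<one>"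
        using closed(1) inv_into_f_f[OF sD(8) closed(1)] sD(7) by simp
    qed
    then show "inv\<^bsub>BijGroup M\<^esub> s \<in> field_auts R M F" using inv_BijGroup[OF sD(1)] by simp
  next
    fix s t assume s: "s \<in> field_auts R M F" and t: "t \<in> field_auts R M F"
    note sD = field_autsD[OF s] and tD = field_autsD[OF t]
    have "compose M s t \<in> field_auts R M F"
    proof (rule field_autsI)
      show "compose M s t \<in> Bij M" by (rule compose_Bij[OF sD(1) tD(1)])
      show "compose M s t a = a" if "a \<in> F" for a
        using that FM sD(4) tD(4) by (auto simp: compose_def)
    qed (use closed sD tD in \<open>simp_all add: compose_def\<close>)
    then show "s \<otimes>\<^bsub>BijGroup M\<^esub> t \<in> field_auts R M F"
      using sD(1) tD(1) by (simp add: BijGroup_def)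
  qed
qed

lemma galois_group_eq:
  "galois_group (L\<lparr>carrier := M\<rparr>) F = BijGroup M\<lparr>carrier := field_auts L M F\<rparr>"
proof -
  have "{s \<in> ring_hom (L\<lparr>carrier := M\<rparr>) (L\<lparr>carrier := M\<rparr>) \<inter> Bij M. \<forall>x\<in>F. s x = x} = field_auts L M F"
    unfolding field_auts_def Bij_def by auto
  then show ?thesis unfolding galois_group_def by simp
qed

text \<open>\<open>M'\<close> is the fixed field of the kernel \<open>N\<close> of \<open>f\<close>.
  Restriction to \<open>M'\<close> has kernel \<open>N\<close> and reaches every automorphism of
  \<open>M'\<close> over \<open>F\<close>, both by \<open>artin_lemma\<close>; so the Galois group
  of \<open>M'\<close> and \<open>A\<close> are the same quotient by \<open>N\<close>.\<close>

theorem galois_quotient: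
  fixes L :: "'a ring" (structure) and A :: "'c monoid"
  assumes field: "field L" and F: "subfield F L" and M: "subfield M L" and FM: "F \<subseteq> M"
    and fd: "ring.finite_dimension L F M" and fin: "finite (field_auts L M F)"
    and fixed: "\<And>z. z \<in> M \<Longrightarrow> (\<And>s. s \<in> field_auts L M F \<Longrightarrow> s z = z) \<Longrightarrow> z \<in> F"
    and f: "f \<in> hom (galois_group (L\<lparr>carrier := M\<rparr>) F) A" "f ` field_auts L M F = carrier A" and A: "group A"
  obtains M' where "subfield M' L" "F \<subseteq> M'" "finite_galois_extension (L\<lparr>carrier := M'\<rparr>) F"
    "galois_group (L\<lparr>carrier := M'\<rparr>) F \<cong> A"
proof -
  interpret field L by (rule field)
  let ?E = "field_auts L M F"
  let ?G = "BijGroup M\<lparr>carrier := ?E\<rparr>"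
  interpret B: group "BijGroup M" by (rule group_BijGroup)
  interpret E: subgroup ?E "BijGroup M" by (rule subgroup_field_auts[OF subfieldE(1)[OF M] FM])
  interpret G: group ?G by (rule B.subgroup_imp_group[OF E.subgroup_axioms])
  interpret f: group_hom ?G A f
    using f(1) A unfolding galois_group_eq group_hom_def group_hom_axioms_def by (simp add: G.is_group)
  define N where "N = kernel ?G A f"
  interpret N: normal N ?G unfolding N_def by (rule f.normal_kernel)
  have NE: "N \<subseteq> ?E" unfolding N_def kernel_def by auto
  have Gmult: "s \<otimes>\<^bsub>?G\<^esub> t = compose M s t" if "s \<in> ?E" "t \<in> ?E" for s t
    using field_autsD(1)[OF that(1)] field_autsD(1)[OF that(2)] by (simp add: BijGroup_def)
  define M' where "M' = {z \<in> M. \<forall>s\<in>N. s z = z}"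
  note SM = subfieldE(1)[OF M]
  note MC = subringE(1)[OF SM]
  have EN: "s \<in> ?E" if "s \<in> N" for s using that NE by auto
  have zero: "s \<zero> = \<zero>" if "s \<in> ?E" for s
    using field_autsD(6)[OF that, of \<zero> \<zero>] field_autsD(3)[OF that, of \<zero>] subringE(2)[OF SM] MC
    by (auto dest!: subsetD)
  have M': "subfield M' L"
  proof (rule subfieldI'[OF subringI])
    show "M' \<subseteq> carrier L" using MC unfolding M'_def by auto
    show "\<one> \<in> M'" using subringE(3)[OF SM] field_autsD(7)[OF EN] unfolding M'_def by auto
    fix x assume x: "x \<in> M'"
    then have xM: "x \<in> M" "x \<in> carrier L" using MC unfolding M'_def by auto
    have "s (\<ominus> x) = \<ominus> x" if s: "s \<in> N" for s
    proof -
      have "s (\<ominus> x) \<oplus> s x = \<zero>"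
        using field_autsD(6)[OF EN[OF s], of "\<ominus> x" x] xM subringE(5)[OF SM xM(1)] zero[OF EN[OF s]]
        by (simp add: l_neg)
      moreover have "s x = x" using x s unfolding M'_def by auto
      moreover have "s (\<ominus> x) \<in> carrier L"
        using field_autsD(3)[OF EN[OF s], of "\<ominus> x"] subringE(5)[OF SM xM(1)] MC by auto
      ultimately show ?thesis using minus_equality[of "s (\<ominus> x)" x] xM by simp
    qed
    then show "\<ominus> x \<in> M'" using subringE(5)[OF SM xM(1)] unfolding M'_def by auto
    fix y assume y: "y \<in> M'"
    show "x \<otimes> y \<in> M'" "x \<oplus> y \<in> M'"
    proof -
      have xy: "x \<in> M" "y \<in> M" using x y unfolding M'_def by auto
      have "s (x \<otimes> y) = x \<otimes> y \<and> s (x \<oplus> y) = x \<oplus> y" if s: "s \<in> N" for s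
      proof -
        have "s x = x" "s y = y" using x y s unfolding M'_def by blast+
        then show ?thesis using field_autsD(5)[OF EN[OF s] xy] field_autsD(6)[OF EN[OF s] xy] by simp
      qed
      then show "x \<otimes> y \<in> M'" "x \<oplus> y \<in> M'"
        using subringE(6,7)[OF SM xy] unfolding M'_def by auto
    qed
  next
    fix x assume x: "x \<in> M' - {\<zero>}"
    then have xM: "x \<in> M" "x \<in> carrier L" "x \<noteq> \<zero>" using MC unfolding M'_def by auto
    have xi: "inv x \<in> M" using subfield_m_inv(1)[OF M, of x] xM by simp
    have "s (inv x) = inv x" if s: "s \<in> N" for s
    proof -
      have "s (x \<otimes> inv x) = \<one>"
        using field_autsD(7)[OF EN[OF s]] xM field_Units by simp
      then have "x \<otimes> s (inv x) = \<one>"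
        using field_autsD(5)[OF EN[OF s] xM(1) xi] x s unfolding M'_def by auto
      then show ?thesis
        using inv_char xM field_autsD(3)[OF EN[OF s] xi] MC by (metis comm_inv_char subsetD)
    qed
    then show "inv x \<in> M'" using xi unfolding M'_def by auto
  qed
  note SM' = subfieldE(1)[OF M']
  have M'M: "M' \<subseteq> M" unfolding M'_def by auto
  have FM': "F \<subseteq> M'" using FM field_autsD(4)[OF EN] unfolding M'_def by auto
  \<comment> \<open>Artin's lemma for \<open>N\<close> acting on \<open>M\<close>: whatever is
    trivial on the fixed field of \<open>N\<close> belongs to \<open>N\<close>.\<close>
  have ker: "s \<in> N" if s: "s \<in> ?E" and id: "\<And>z. z \<in> M' \<Longrightarrow> s z = z" for s
  proof (rule artin_lemma[OF SM])
    show "subgroup N (BijGroup M)"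
      using B.incl_subgroup[OF E.subgroup_axioms N.subgroup_axioms] .
    show "finite N" using NE fin finite_subset by blast
    show "N \<subseteq> ring_hom (L\<lparr>carrier := M\<rparr>) (L\<lparr>carrier := M\<rparr>)"
      using NE unfolding field_auts_def by auto
    show "s \<in> Bij M" "s \<in> ring_hom (L\<lparr>carrier := M\<rparr>) (L\<lparr>carrier := M\<rparr>)"
      using field_autsD(1)[OF s] s unfolding field_auts_def by auto
    show "s z = z" if "z \<in> M" "\<And>h. h \<in> N \<Longrightarrow> h z = z" for z
      using id[of z] that unfolding M'_def by auto
  qed
  have into: "s z \<in> M'" if s: "s \<in> ?E" and z: "z \<in> M'" for s z
  proof -
    have "h (s z) = s z" if h: "h \<in> N" for h
    proof -
      \<comment> \<open>Normality moves \<open>h\<close> past \<open>s\<close>: the product is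
        \<open>s h'\<close> with \<open>h'\<close> in \<open>N\<close>, and \<open>h'\<close> fixes
        \<open>z\<close>.\<close>
      have "h \<otimes>\<^bsub>?G\<^esub> s \<in> N #>\<^bsub>?G\<^esub> s" using h unfolding r_coset_def by auto
      then have "h \<otimes>\<^bsub>?G\<^esub> s \<in> s <#\<^bsub>?G\<^esub> N" using N.coset_eq s by simp
      then obtain h' where h': "h' \<in> N" "h \<otimes>\<^bsub>?G\<^esub> s = s \<otimes>\<^bsub>?G\<^esub> h'" unfolding l_coset_def by auto
      then have "compose M h s = compose M s h'" using Gmult s EN h by simp
      then have "h (s z) = s (h' z)" using z M'M by (metis compose_eq subsetD)
      then show ?thesis using h' z unfolding M'_def by auto
    qed
    then show ?thesis using field_autsD(3)[OF s] z unfolding M'_def by auto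
  qed
  let ?E' = "field_auts L M' F"
  let ?G' = "BijGroup M'\<lparr>carrier := ?E'\<rparr>"
  interpret B': group "BijGroup M'" by (rule group_BijGroup)
  interpret E': subgroup ?E' "BijGroup M'" by (rule subgroup_field_auts[OF SM' FM'])
  interpret G': group ?G' by (rule B'.subgroup_imp_group[OF E'.subgroup_axioms])
  have inv_in: "inv\<^bsub>?G\<^esub> s \<in> ?E" and inv_comp: "compose M s (inv\<^bsub>?G\<^esub> s) = (\<lambda>x\<in>M. x)" if s: "s \<in> ?E" for s
  proof -
    show i: "inv\<^bsub>?G\<^esub> s \<in> ?E" using G.inv_closed[of s] s by simp
    have "s \<otimes>\<^bsub>?G\<^esub> inv\<^bsub>?G\<^esub> s = \<one>\<^bsub>?G\<^esub>" using G.r_inv[of s] s by simp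
    then show "compose M s (inv\<^bsub>?G\<^esub> s) = (\<lambda>x\<in>M. x)" using Gmult[OF s i] by (simp add: BijGroup_def)
  qed
  have res: "restrict s M' \<in> ?E'" if s: "s \<in> ?E" for s
  proof (rule field_autsI)
    have "inj_on s M'" using field_autsD(8)[OF s] M'M inj_on_subset by blast
    moreover have "s ` M' = M'"
    proof
      show "s ` M' \<subseteq> M'" using into[OF s] by auto
      show "M' \<subseteq> s ` M'"
      proof
        fix z assume z: "z \<in> M'"
        have "s ((inv\<^bsub>?G\<^esub> s) z) = z"
          using inv_comp[OF s] z M'M by (metis compose_eq restrict_apply' subsetD)
        then show "z \<in> s ` M'" using into[OF inv_in[OF s] z] by (metis imageI)
      qed
    qed
    ultimately show "restrict s M' \<in> Bij M'" unfolding Bij_def bij_betw_def by auto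
    show "restrict s M' (x \<otimes> y) = restrict s M' x \<otimes> restrict s M' y"
      "restrict s M' (x \<oplus> y) = restrict s M' x \<oplus> restrict s M' y" if "x \<in> M'" "y \<in> M'" for x y
      using that field_autsD(5,6)[OF s, of x y] M'M subringE(6,7)[OF SM' that] by auto
  qed (use field_autsD(4,7)[OF s] FM' subringE(3)[OF SM'] in auto)
  have res_hom: "group_hom ?G ?G' (\<lambda>s. restrict s M')"
  proof (unfold_locales, rule homI)
    show "restrict s M' \<in> carrier ?G'" if "s \<in> carrier ?G" for s using res that by simp
    show "restrict (s \<otimes>\<^bsub>?G\<^esub> t) M' = restrict s M' \<otimes>\<^bsub>?G'\<^esub> restrict t M'"
      if "s \<in> carrier ?G" "t \<in> carrier ?G" for s t
    proof -
      have st: "s \<in> ?E" "t \<in> ?E" using that by auto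
      have "restrict s M' \<otimes>\<^bsub>?G'\<^esub> restrict t M' = compose M' (restrict s M') (restrict t M')"
        using field_autsD(1)[OF res[OF st(1)]] field_autsD(1)[OF res[OF st(2)]] by (simp add: BijGroup_def)
      also have "\<dots> = restrict (compose M s t) M'"
        using into[OF st(2)] M'M by (auto simp: compose_def fun_eq_iff)
      finally show ?thesis using Gmult st by simp
    qed
  qed
  interpret r: group_hom ?G ?G' "\<lambda>s. restrict s M'" by (rule res_hom)
  have rker: "kernel ?G ?G' (\<lambda>s. restrict s M') = N"
  proof -
    have "restrict s M' = (\<lambda>x\<in>M'. x) \<longleftrightarrow> s \<in> N" if s: "s \<in> ?E" for s
    proof
      assume "restrict s M' = (\<lambda>x\<in>M'. x)"
      then show "s \<in> N" using ker[OF s] by (metis restrict_apply')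
    next
      assume "s \<in> N"
      then show "restrict s M' = (\<lambda>x\<in>M'. x)" unfolding M'_def by (auto simp: fun_eq_iff)
    qed
    then show ?thesis using NE unfolding kernel_def by (auto simp: BijGroup_def)
  qed
  have fixed': "z \<in> F" if z: "z \<in> M'" and fz: "\<And>s. s \<in> ?E \<Longrightarrow> restrict s M' z = z" for z
    using fixed[of z] z fz M'M by (metis restrict_apply' subsetD)
  have surj: "(\<lambda>s. restrict s M') ` ?E = ?E'"
  proof
    show "(\<lambda>s. restrict s M') ` ?E \<subseteq> ?E'" using res by auto
    show "?E' \<subseteq> (\<lambda>s. restrict s M') ` ?E"
    proof
      fix s assume s: "s \<in> ?E'"
      \<comment> \<open>The restrictions form a finite group on \<open>M'\<close> whose fixed
        elements lie in \<open>F\<close>, which \<open>s\<close> fixes; so \<open>s\<close> is one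
        of them. This gives surjectivity without extending \<open>s\<close> to
        \<open>M\<close>.\<close>
      show "s \<in> (\<lambda>s. restrict s M') ` ?E"
      proof (rule artin_lemma[OF SM'])
        have "subgroup ((\<lambda>s. restrict s M') ` carrier ?G) ?G'" by (rule r.img_is_subgroup)
        then show "subgroup ((\<lambda>s. restrict s M') ` ?E) (BijGroup M')"
          using B'.incl_subgroup[OF E'.subgroup_axioms] by simp
        show "finite ((\<lambda>s. restrict s M') ` ?E)" using fin by simp
        show "(\<lambda>s. restrict s M') ` ?E \<subseteq> ring_hom (L\<lparr>carrier := M'\<rparr>) (L\<lparr>carrier := M'\<rparr>)"
          using res unfolding field_auts_def by auto
        show "s \<in> Bij M'" "s \<in> ring_hom (L\<lparr>carrier := M'\<rparr>) (L\<lparr>carrier := M'\<rparr>)"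
          using field_autsD(1)[OF s] s unfolding field_auts_def by auto
        show "s z = z" if "z \<in> M'" "\<And>h. h \<in> (\<lambda>s. restrict s M') ` ?E \<Longrightarrow> h z = z" for z
          using fixed'[OF that(1)] that(2) field_autsD(4)[OF s] by blast
      qed
    qed
  qed
  have iso: "?G' \<cong> A"
  proof -
    have "?G Mod N \<cong> A"
      using f.FactGroup_iso f(2) unfolding N_def by simp
    moreover have "?G Mod N \<cong> ?G'"
      using r.FactGroup_iso surj rker by simp
    ultimately show ?thesis
      using iso_trans group.iso_sym[OF N.factorgroup_is_group] by blast
  qed
  have fd': "ring.finite_dimension (L\<lparr>carrier := M'\<rparr>) F M'"
  proof -
    have "subalgebra F M' L"
      using subringE(6)[OF SM'] FM' subring.axioms(1)[OF SM']
      unfolding subalgebra_def subalgebra_axioms_def by blast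
    then have "finite_dimension F M'"
      using subalbegra_incl_imp_finite_dimension[OF F fd _ M'M] by blast
    then obtain n where "dimension n F M'" by auto
    then have "ring.dimension (L\<lparr>carrier := M'\<rparr>) n F M'"
      using dimension_consistent[OF SM' F] by simp
    then show ?thesis
      unfolding ring.finite_dimension_def[OF subring_is_ring[OF SM']] by blast
  qed
  have "finite_galois_extension (L\<lparr>carrier := M'\<rparr>) F"
    unfolding finite_galois_extension_def
  proof (intro conjI)
    show "field (L\<lparr>carrier := M'\<rparr>)" by (rule subfield_iff(2)[OF M'])
    show "subfield F (L\<lparr>carrier := M'\<rparr>)"
      using ring.subfield_iff(1)[OF subring_is_ring[OF SM'], of F] subfield_iff(2)[OF F] FM' by simp
    show "ring.finite_dimension (L\<lparr>carrier := M'\<rparr>) F (carrier (L\<lparr>carrier := M'\<rparr>))"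
      using fd' by simp
    show "{x \<in> carrier (L\<lparr>carrier := M'\<rparr>). \<forall>s\<in>carrier (galois_group (L\<lparr>carrier := M'\<rparr>) F). s x = x} = F"
    proof -
      have "x \<in> F" if "x \<in> M'" "\<forall>s\<in>?E'. s x = x" for x
        by (rule fixed'[OF that(1)]) (use res that(2) in blast)
      then show ?thesis unfolding carrier_galois_group using FM' field_autsD(4) by auto
    qed
  qed
  then show ?thesis using that M' FM' iso galois_group_eq by metis
qed

section \<open>Radicals in finitely generated extensions\<close>

lemma (in comm_monoid) finprod_nat_pow:
  assumes "f \<in> A \<rightarrow> carrier G"
  shows "(\<Otimes>i\<in>A. f i) [^] (n::nat) = (\<Otimes>i\<in>A. f i [^] n)"
  using assms
proof (induct A rule: infinite_finite_induct)
  case (insert a A)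
  then have f: "f \<in> A \<rightarrow> carrier G" "f a \<in> carrier G" by auto
  have "(\<Otimes>i\<in>insert a A. f i [^] n) = f a [^] n \<otimes> (\<Otimes>i\<in>A. f i [^] n)"
    by (rule finprod_insert) (use insert f in auto)
  then show ?case using insert f by (simp add: nat_pow_distrib)
qed simp_all

lemma (in domain) nat_pow_nonzero:
  assumes "a \<in> carrier R" "a \<noteq> \<zero>"
  shows "a [^] (n::nat) \<noteq> \<zero>"
  using assms by (induct n) (auto simp: integral_iff)

lemma (in field) inv_mult_nonzero:
  assumes "a \<in> carrier R" "a \<noteq> \<zero>" "b \<in> carrier R" "b \<noteq> \<zero>"
  shows "inv (a \<otimes> b) = inv a \<otimes> inv b"
proof (rule comm_inv_char)
  have "a \<otimes> inv a = \<one>" "b \<otimes> inv b = \<one>" "inv a \<in> carrier R" "inv b \<in> carrier R"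
    using assms field_Units by auto
  then show "a \<otimes> b \<otimes> (inv a \<otimes> inv b) = \<one>" "inv a \<otimes> inv b \<in> carrier R"
    using assms by (auto simp: m_ac)
qed (use assms in auto)

lemma (in domain) finprod_nonzero:
  assumes "f \<in> A \<rightarrow> carrier R - {\<zero>}"
  shows "(\<Otimes>i\<in>A. f i) \<noteq> \<zero>"
  using assms
proof (induct A rule: infinite_finite_induct)
  case (insert a A)
  then have "(\<Otimes>i\<in>insert a A. f i) = f a \<otimes> (\<Otimes>i\<in>A. f i)" by (intro finprod_insert) auto
  moreover have "(\<Otimes>i\<in>A. f i) \<in> carrier R" using insert by (intro finprod_closed) auto
  ultimately show ?case using insert integral_iff[of "f a" "\<Otimes>i\<in>A. f i"] by auto
qed simp_all

lemma (in cring) subring_nat_pow: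
  assumes "subring S R" "a \<in> S"
  shows "a [^] (n::nat) \<in> S"
  using assms(2) subringE(3,6)[OF assms(1)] by (induct n) auto

lemma (in cring) subring_finprod:
  assumes S: "subring S R" and "f \<in> A \<rightarrow> S"
  shows "(\<Otimes>i\<in>A. f i) \<in> S"
  using assms(2)
proof (induct A rule: infinite_finite_induct)
  case (insert a A)
  then have "(\<Otimes>i\<in>insert a A. f i) = f a \<otimes> (\<Otimes>i\<in>A. f i)"
    using subringE(1)[OF S] by (intro finprod_insert) auto
  then show ?case using insert subringE(6)[OF S] by auto
qed (use subringE(3)[OF S] in simp_all)

lemma ring_hom_subring_nat_pow:
  assumes "h \<in> ring_hom (R\<lparr>carrier := S\<rparr>) R'" "subring S R" "a \<in> S" "ring R" "ring R'"
  shows "h (a [^]\<^bsub>R\<^esub> (n::nat)) = h a [^]\<^bsub>R'\<^esub> n"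
proof -
  interpret R: ring R by fact
  interpret R': ring R' by fact
  have pw: "a [^]\<^bsub>R\<^esub> n \<in> S" for n :: nat
    using assms(3) subringE(3,6)[OF assms(2)] by (induct n) auto
  show ?thesis
    using ring_hom_memE(2)[OF assms(1)] ring_hom_memE(4)[OF assms(1)] pw assms(3)
    by (induct n) auto
qed

lemma ring_hom_subring_finprod:
  assumes h: "h \<in> ring_hom (R\<lparr>carrier := S\<rparr>) R'" and S: "subring S R" and f: "f \<in> A \<rightarrow> S"
    and R: "cring R" "cring R'"
  shows "h (finprod R f A) = finprod R' (\<lambda>i. h (f i)) A"
proof -
  interpret R: cring R by fact
  interpret R': cring R' by fact
  note hm = ring_hom_memE[OF h]
  show ?thesis
    using f
  proof (induct A rule: infinite_finite_induct)
    case (insert a A)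
    have fa: "f a \<in> S" "f \<in> A \<rightarrow> S" using insert by auto
    then have fR: "f a \<in> carrier R" "f \<in> A \<rightarrow> carrier R" using subringE(1)[OF S] by auto
    have hR: "(\<lambda>i. h (f i)) \<in> A \<rightarrow> carrier R'" "h (f a) \<in> carrier R'" using hm(1) fa by auto
    have "h (finprod R f (insert a A)) = h (f a \<otimes>\<^bsub>R\<^esub> finprod R f A)"
      using R.finprod_insert[OF insert(1,2) fR(2,1)] by simp
    also have "\<dots> = h (f a) \<otimes>\<^bsub>R'\<^esub> h (finprod R f A)"
      using hm(2) fa R.subring_finprod[OF S fa(2)] by simp
    also have "\<dots> = finprod R' (\<lambda>i. h (f i)) (insert a A)"
      using R'.finprod_insert[OF insert(1,2) hR] insert(3)[OF fa(2)] by simp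
    finally show ?case .
  qed (use hm(4) in simp_all)
qed

section \<open>Fraction fields of subrings\<close>

definition fractions :: "('a, 'b) ring_scheme \<Rightarrow> 'a set \<Rightarrow> 'a set" where
  "fractions R S = {a \<otimes>\<^bsub>R\<^esub> inv\<^bsub>R\<^esub> b | a b. a \<in> S \<and> b \<in> S \<and> b \<noteq> \<zero>\<^bsub>R\<^esub>}"

lemma (in field) fractions_incl:
  assumes S: "subring S R"
  shows "S \<subseteq> fractions R S"
proof
  fix a assume a: "a \<in> S"
  then have "a = a \<otimes> inv \<one>" using subringE(1)[OF S] by auto
  then show "a \<in> fractions R S"
    unfolding fractions_def using a subringE(3)[OF S] one_not_zero by blast
qed

lemma (in field) subfield_fractions:
  assumes S: "subring S R"
  shows "subfield (fractions R S) R"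
proof -
  note SR = subringE(1)[OF S]
  have U: "b \<in> Units R \<and> b \<in> carrier R \<and> inv b \<in> carrier R" if "b \<in> S" "b \<noteq> \<zero>" for b
    using that SR field_Units by auto
  have nz: "b \<otimes> d \<noteq> \<zero>" if "b \<in> S" "b \<noteq> \<zero>" "d \<in> S" "d \<noteq> \<zero>" for b d
    using that SR integral by blast
  show ?thesis
  proof (rule subfieldI'[OF subringI])
    show "fractions R S \<subseteq> carrier R" unfolding fractions_def using SR U by auto
    show "\<one> \<in> fractions R S" using fractions_incl[OF S] subringE(3)[OF S] by auto
    fix x assume "x \<in> fractions R S"
    then obtain a b where x: "x = a \<otimes> inv b" "a \<in> S" "b \<in> S" "b \<noteq> \<zero>" unfolding fractions_def by auto
    have aR: "a \<in> carrier R" using x SR by auto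
    note bU = U[OF x(3,4)]
    have "\<ominus> x = \<ominus> a \<otimes> inv b" using x aR bU by (simp add: l_minus)
    then show "\<ominus> x \<in> fractions R S" unfolding fractions_def using x subringE(5)[OF S] by blast
    fix y assume "y \<in> fractions R S"
    then obtain c d where y: "y = c \<otimes> inv d" "c \<in> S" "d \<in> S" "d \<noteq> \<zero>" unfolding fractions_def by auto
    have cR: "c \<in> carrier R" using y SR by auto
    note dU = U[OF y(3,4)]
    have i: "inv (b \<otimes> d) = inv b \<otimes> inv d"
      using bU dU by (simp add: inv_mult_nonzero x y)
    have "x \<otimes> y = (a \<otimes> c) \<otimes> inv (b \<otimes> d)"
      unfolding i using x y aR cR bU dU by (simp add: m_assoc m_lcomm)
    then show "x \<otimes> y \<in> fractions R S"
      unfolding fractions_def using x y subringE(6)[OF S] nz by blast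
    have "a \<otimes> d \<otimes> (inv b \<otimes> inv d) = x" "c \<otimes> b \<otimes> (inv b \<otimes> inv d) = y"
    proof -
      have "a \<otimes> d \<otimes> (inv b \<otimes> inv d) = a \<otimes> inv b \<otimes> (d \<otimes> inv d)"
        using aR bU dU by (simp del: Units_r_inv add: m_assoc m_lcomm)
      then show "a \<otimes> d \<otimes> (inv b \<otimes> inv d) = x" using x aR bU dU by simp
      have "c \<otimes> b \<otimes> (inv b \<otimes> inv d) = c \<otimes> inv d \<otimes> (b \<otimes> inv b)"
        using cR bU dU by (simp del: Units_r_inv add: m_assoc m_lcomm m_comm)
      then show "c \<otimes> b \<otimes> (inv b \<otimes> inv d) = y" using y cR bU dU by simp
    qed
    then have "x \<oplus> y = (a \<otimes> d \<oplus> c \<otimes> b) \<otimes> inv (b \<otimes> d)"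
      unfolding i using aR cR bU dU by (simp add: l_distr)
    moreover have "a \<otimes> d \<oplus> c \<otimes> b \<in> S" "b \<otimes> d \<in> S" "b \<otimes> d \<noteq> \<zero>"
      using x(2-4) y(2-4) subringE(6,7)[OF S] nz by auto
    ultimately show "x \<oplus> y \<in> fractions R S" unfolding fractions_def by blast
  next
    fix x assume "x \<in> fractions R S - {\<zero>}"
    then obtain a b where x: "x = a \<otimes> inv b" "a \<in> S" "b \<in> S" "b \<noteq> \<zero>" "x \<noteq> \<zero>" unfolding fractions_def by auto
    note bU = U[OF x(3,4)]
    have a0: "a \<noteq> \<zero>" using x bU by auto
    note aU = U[OF x(2) a0]
    have "inv x = b \<otimes> inv a"
    proof (rule comm_inv_char)
      show "x \<otimes> (b \<otimes> inv a) = \<one>"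
        using x(1) aU bU by (metis (no_types, lifting) Units_l_inv Units_r_inv m_assoc m_closed r_one)
    qed (use x(1) aU bU in auto)
    then show "inv x \<in> fractions R S" unfolding fractions_def using x a0 by blast
  qed
qed

section \<open>Specialization and order of vanishing\<close>

text \<open>Evaluation at \<open>\<alpha>\<close> on the polynomial ring generated by
  \<open>x\<close>; factors \<open>x - \<alpha>\<close> are split off until the value is nonzero.
  Existence of this splitting and its uniqueness in \<open>multiplicity_unique\<close> together
  stand in for a valuation.\<close>

lemma (in domain) specialization:
  assumes F: "subfield F R" and x: "x \<in> carrier R" "(transcendental over F) x" and \<alpha>: "\<alpha> \<in> F"
  obtains sp where "sp \<in> ring_hom (R\<lparr>carrier := simple_extension F x\<rparr>) R"
    "\<And>a. a \<in> F \<Longrightarrow> sp a = a" "sp x = \<alpha>" "\<And>a. a \<in> simple_extension F x \<Longrightarrow> sp a \<in> F"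
    "\<And>a. a \<in> simple_extension F x \<Longrightarrow> a \<noteq> \<zero> \<Longrightarrow>
       \<exists>(e::nat) a1. a1 \<in> simple_extension F x \<and> sp a1 \<noteq> \<zero> \<and> a = (x \<ominus> \<alpha>) [^] e \<otimes> a1"
proof -
  note SF = subfieldE(1)[OF F]
  have FR: "F \<subseteq> carrier R" using subringE(1)[OF SF] .
  have \<alpha>R: "\<alpha> \<in> carrier R" using \<alpha> FR by auto
  have idh: "id \<in> ring_hom (R\<lparr>carrier := F\<rparr>) R" using FR by (intro ring_hom_memI) auto
  have ker: "eval (map id p) \<alpha> = \<zero>" if "p \<in> carrier (F[X])" "eval p x = \<zero>" for p
    using eval_transcendental[OF x(2) that] by simp
  obtain sp where sp: "sp \<in> ring_hom (R\<lparr>carrier := simple_extension F x\<rparr>) R"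
    "\<And>a. a \<in> F \<Longrightarrow> sp a = id a" "sp x = \<alpha>" "\<And>p. p \<in> carrier (F[X]) \<Longrightarrow> sp (eval p x) = eval (map id p) \<alpha>"
    using simple_extension_hom[OF SF idh x(1) \<alpha>R ker] by metis
  have img: "simple_extension F x = (\<lambda>p. eval p x) ` carrier (F[X])"
    using simple_extension_as_eval_img[OF FR x(1)] .
  have inF: "sp a \<in> F" if a: "a \<in> simple_extension F x" for a
  proof -
    obtain p where p: "p \<in> carrier (F[X])" "a = eval p x" using a unfolding img by auto
    have "set p \<subseteq> F" using p polynomial_incl by (simp add: univ_poly_def)
    then have "eval p \<alpha> \<in> F"
      using ring.eval_in_carrier[OF subring_is_ring[OF SF], of p \<alpha>] \<alpha> eval_consistent[OF SF] by simp
    then show ?thesis using sp(4)[OF p(1)] p(2) by simp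
  qed
  have lin: "[\<one>, \<ominus> \<alpha>] \<in> carrier (F[X])"
    using \<alpha> subringE(3,5)[OF SF] by (simp add: univ_poly_def polynomial_def)
  have "\<exists>(e::nat) a1. a1 \<in> simple_extension F x \<and> sp a1 \<noteq> \<zero> \<and> eval p x = (x \<ominus> \<alpha>) [^] e \<otimes> a1"
    if "p \<in> carrier (F[X])" "p \<noteq> []" for p
    using that
  proof (induct "length p" arbitrary: p rule: less_induct)
    case less
    have pR: "p \<in> carrier (poly_ring R)" using carrier_polynomial_shell[OF SF less(2)] .
    show ?case
    proof (cases "eval p \<alpha> = \<zero>")
      case False
      have "eval p x \<in> carrier R" using eval_poly_in_carrier[of F p x] less(2) x(1) SF
        by (meson SF carrier_polynomial_shell eval_poly_in_carrier univ_poly_carrier)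
      then have "eval p x = (x \<ominus> \<alpha>) [^] (0::nat) \<otimes> eval p x" by simp
      then show ?thesis using False sp(4)[OF less(2)] less(2) unfolding img by (metis imageI list.map_id)
    next
      case True
      then have "[\<one>, \<ominus> \<alpha>] pdivides p"
        using is_root_imp_pdivides[OF pR, of \<alpha>] less(3) \<alpha>R unfolding is_root_def by simp
      then obtain q where q: "q \<in> carrier (F[X])" "p = [\<one>, \<ominus> \<alpha>] \<otimes>\<^bsub>F[X]\<^esub> q"
        using pdivides_iff_shell[OF F lin less(2)] unfolding factor_def by blast
      have pm: "p = poly_mult [\<one>, \<ominus> \<alpha>] q" using q(2) by (simp add: univ_poly_mult)
      have q0: "q \<noteq> []" using pm less(3) poly_mult_zero(2)[of "[\<one>, \<ominus> \<alpha>]"] \<alpha>R by auto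
      have "degree p = Suc (degree q)"
        using poly_mult_degree_eq[OF SF, of "[\<one>, \<ominus> \<alpha>]" q] pm q0 lin q(1) by (simp add: univ_poly_carrier)
      then have "length q < length p" by simp
      then obtain e :: nat and a1 where e: "a1 \<in> simple_extension F x" "sp a1 \<noteq> \<zero>" "eval q x = (x \<ominus> \<alpha>) [^] e \<otimes> a1"
        using less(1)[OF _ q(1) q0] by blast
      have "eval p x = eval [\<one>, \<ominus> \<alpha>] x \<otimes> eval q x"
        using ring_hom_memE(2)[OF eval_is_hom[OF SF x(1)] lin q(1)] q(2) by simp
      also have "eval [\<one>, \<ominus> \<alpha>] x = x \<ominus> \<alpha>" using x(1) \<alpha>R by (simp add: a_minus_def)
      also have "(x \<ominus> \<alpha>) \<otimes> eval q x = (x \<ominus> \<alpha>) [^] Suc e \<otimes> a1"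
        using e x(1) \<alpha>R simple_extension_in_carrier[OF FR x(1)]
        by (auto simp: m_assoc m_lcomm m_comm)
      finally show ?thesis using e by blast
    qed
  qed
  then have "\<exists>(e::nat) a1. a1 \<in> simple_extension F x \<and> sp a1 \<noteq> \<zero> \<and> a = (x \<ominus> \<alpha>) [^] e \<otimes> a1"
    if "a \<in> simple_extension F x" "a \<noteq> \<zero>" for a
    using that unfolding img by fastforce
  then show ?thesis using that[of sp] sp inF by simp
qed

text \<open>After cancelling the smaller power of \<open>z\<close>, one side is killed by
  \<open>sp\<close> and the other is not.\<close>

lemma (in domain) multiplicity_unique:
  assumes S: "subring S R" and sp: "sp \<in> ring_hom (R\<lparr>carrier := S\<rparr>) R" and z: "z \<in> S" "z \<noteq> \<zero>" "sp z = \<zero>"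
    and u: "u \<in> S" "sp u \<noteq> \<zero>" and w: "w \<in> S" "sp w \<noteq> \<zero>"
    and eq: "z [^] (i::nat) \<otimes> u = z [^] (j::nat) \<otimes> w"
  shows "i = j"
proof -
  have aux: False
    if u: "u \<in> S" "sp u \<noteq> \<zero>" and w: "w \<in> S" "sp w \<noteq> \<zero>"
      and eq: "z [^] (i::nat) \<otimes> u = z [^] (j::nat) \<otimes> w" and ij: "i < j" for i j u w
  proof -
    have R: "z \<in> carrier R" "u \<in> carrier R" "w \<in> carrier R" using z u w subringE(1)[OF S] by auto
    obtain k where k: "j = i + Suc k" using ij less_iff_Suc_add by auto
    have pw: "z [^] n \<in> S" for n :: nat
      using z subringE(3,6)[OF S] by (induct n) auto
    have "z [^] i \<otimes> u = z [^] i \<otimes> (z [^] Suc k \<otimes> w)"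
      using eq R unfolding k nat_pow_mult[OF R(1), symmetric] by (simp add: m_assoc)
    moreover have "z [^] i \<noteq> \<zero>" using z R nat_pow_nonzero by blast
    ultimately have "u = z [^] Suc k \<otimes> w" using m_lcancel[of "z [^] i" u "z [^] Suc k \<otimes> w"] R by simp
    also have "\<dots> = z \<otimes> (z [^] k \<otimes> w)" using R by (simp add: m_ac)
    finally have "sp u = sp z \<otimes> sp (z [^] k \<otimes> w)"
      using ring_hom_memE(2)[OF sp, of z "z [^] k \<otimes> w"] z pw w subringE(6)[OF S] by simp
    moreover have "sp (z [^] k \<otimes> w) \<in> carrier R"
      using ring_hom_memE(1)[OF sp, of "z [^] k \<otimes> w"] pw w subringE(6)[OF S] by simp
    ultimately show False using z u by simp
  qed
  show ?thesis
    using aux[OF u w eq] aux[OF w u eq[symmetric]] by (metis linorder_neqE_nat)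
qed

text \<open>The bound \<open>d\<close> has to serve all exponents \<open>N\<close> simultaneously: the degree of the extension
  generated by the roots of unity needed later grows with \<open>N\<close>.\<close>

definition (in ring) radical_bounded :: "'a \<Rightarrow> 'a set \<Rightarrow> 'a set \<Rightarrow> bool" where
  "radical_bounded t B F \<longleftrightarrow> (\<exists>d::nat. d > 0 \<and>
     (\<forall>(N::nat) u (m::'a \<Rightarrow> nat) S. N > 0 \<longrightarrow> u \<in> F \<longrightarrow> finite S \<longrightarrow> S \<subseteq> B \<longrightarrow>
        u [^] N = (\<Otimes>\<alpha>\<in>S. (t \<ominus> \<alpha>) [^] m \<alpha>) \<longrightarrow> (\<forall>\<alpha>\<in>S. N dvd d * m \<alpha>)))"

lemma (in domain) transcendental_notin:
  assumes F: "subring F R" and x: "(transcendental over F) x"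
  shows "x \<notin> F"
  using algebraic_self[OF F, of x] x by (auto simp: over_def)

text \<open>For rational functions \<open>d = 1\<close> works: write \<open>u = a / b\<close>,
  specialize \<open>t\<close> to \<open>\<alpha>\<close>, and compare the orders of vanishing of
  both sides. This gives \<open>m \<alpha> + f * N = e * N\<close>.\<close>

lemma (in field) radical_bounded_rational:
  assumes B: "subfield B R" and t: "t \<in> carrier R" "(transcendental over B) t"
  shows "radical_bounded t B (fractions R (simple_extension B t))"
  unfolding radical_bounded_def
proof (intro exI[of _ 1] conjI allI impI ballI)
  fix N :: nat and u S \<alpha> and m :: "'a \<Rightarrow> nat"
  assume N: "N > 0" and u: "u \<in> fractions R (simple_extension B t)" and S: "finite S" "S \<subseteq> B"
    and eq: "u [^] N = (\<Otimes>\<alpha>\<in>S. (t \<ominus> \<alpha>) [^] m \<alpha>)" and \<alpha>: "\<alpha> \<in> S"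
  note SB = subfieldE(1)[OF B]
  have BR: "B \<subseteq> carrier R" using subringE(1)[OF SB] .
  let ?T = "simple_extension B t"
  have T: "subring ?T R" using simple_extension_is_subring[OF SB t(1)] .
  have TR: "?T \<subseteq> carrier R" using subringE(1)[OF T] .
  have tT: "t \<in> ?T" using simple_extension_mem[OF SB t(1)] .
  have BT: "B \<subseteq> ?T" using simple_extension_incl[OF BR t(1)] .
  have tB: "t \<notin> B" by (rule transcendental_notin[OF SB t(2)])
  have \<alpha>B: "\<alpha> \<in> B" using \<alpha> S by auto
  obtain sp where sp: "sp \<in> ring_hom (R\<lparr>carrier := ?T\<rparr>) R"
    "\<And>a. a \<in> B \<Longrightarrow> sp a = a" "sp t = \<alpha>" "\<And>a. a \<in> ?T \<Longrightarrow> sp a \<in> B"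
    "\<And>a. a \<in> ?T \<Longrightarrow> a \<noteq> \<zero> \<Longrightarrow> \<exists>(e::nat) a1. a1 \<in> ?T \<and> sp a1 \<noteq> \<zero> \<and> a = (t \<ominus> \<alpha>) [^] e \<otimes> a1"
    using specialization[OF B t \<alpha>B] by blast
  have lin: "t \<ominus> \<beta> \<in> ?T \<and> t \<ominus> \<beta> \<noteq> \<zero> \<and> sp (t \<ominus> \<beta>) = \<alpha> \<ominus> \<beta>" if \<beta>: "\<beta> \<in> B" for \<beta>
  proof -
    have m\<beta>: "\<ominus> \<beta> \<in> B" using \<beta> subringE(5)[OF SB] by auto
    then have "t \<ominus> \<beta> \<in> ?T" using tT BT subringE(7)[OF T] unfolding a_minus_def by auto
    moreover have "t \<ominus> \<beta> \<noteq> \<zero>" using \<beta> BR t(1) tB by (metis r_right_minus_eq subsetD)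
    moreover have "sp (t \<ominus> \<beta>) = \<alpha> \<ominus> \<beta>"
      unfolding a_minus_def using ring_hom_memE(3)[OF sp(1), of t "\<ominus> \<beta>"] tT m\<beta> BT sp(2)[OF m\<beta>] sp(3) by auto
    ultimately show ?thesis by simp
  qed
  have \<alpha>R: "\<alpha> \<in> carrier R" using \<alpha>B BR by auto
  \<comment> \<open>\<open>P\<close> collects the remaining factors; its value at
    \<open>\<alpha>\<close> is a product of powers of the differences
    \<open>\<alpha> \<ominus> \<beta>\<close>, hence nonzero.\<close>
  define P where "P = (\<Otimes>\<beta>\<in>S - {\<alpha>}. (t \<ominus> \<beta>) [^] m \<beta>)"
  have PT: "P \<in> ?T"
    unfolding P_def by (rule subring_finprod[OF T]) (use lin S subring_nat_pow[OF T] in auto)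
  have "sp P = (\<Otimes>\<beta>\<in>S - {\<alpha>}. sp ((t \<ominus> \<beta>) [^] m \<beta>))"
    unfolding P_def by (rule ring_hom_subring_finprod[OF sp(1) T])
      (use lin S subring_nat_pow[OF T] in \<open>auto simp: is_cring\<close>)
  also have "\<dots> = (\<Otimes>\<beta>\<in>S - {\<alpha>}. (\<alpha> \<ominus> \<beta>) [^] m \<beta>)"
  proof (rule finprod_cong')
    fix \<beta> assume "\<beta> \<in> S - {\<alpha>}"
    then show "sp ((t \<ominus> \<beta>) [^] m \<beta>) = (\<alpha> \<ominus> \<beta>) [^] m \<beta>"
      using ring_hom_subring_nat_pow[OF sp(1) T, of "t \<ominus> \<beta>" "m \<beta>"] lin[of \<beta>] S ring_axioms by auto
  qed (use \<alpha>R BR S in auto)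
  also have "\<dots> \<noteq> \<zero>"
    by (rule finprod_nonzero) (use \<alpha>R BR S nat_pow_nonzero r_right_minus_eq in auto)
  finally have spP: "sp P \<noteq> \<zero>" .
  have zT: "t \<ominus> \<alpha> \<in> ?T" "t \<ominus> \<alpha> \<noteq> \<zero>" "sp (t \<ominus> \<alpha>) = \<zero>" using lin[OF \<alpha>B] \<alpha>R by auto
  have prod: "(\<Otimes>\<alpha>\<in>S. (t \<ominus> \<alpha>) [^] m \<alpha>) = (t \<ominus> \<alpha>) [^] m \<alpha> \<otimes> P"
  proof -
    have "(\<Otimes>\<alpha>\<in>insert \<alpha> (S - {\<alpha>}). (t \<ominus> \<alpha>) [^] m \<alpha>) = (t \<ominus> \<alpha>) [^] m \<alpha> \<otimes> P"
      unfolding P_def by (rule finprod_insert) (use S t BR \<alpha>R in auto)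
    then show ?thesis using \<alpha> by (simp add: insert_absorb)
  qed
  obtain a b where ab: "u = a \<otimes> inv b" "a \<in> ?T" "b \<in> ?T" "b \<noteq> \<zero>" using u unfolding fractions_def by auto
  have abR: "a \<in> carrier R" "b \<in> carrier R" "inv b \<in> carrier R" using ab TR field_Units by auto
  have "u [^] N \<otimes> b [^] N = a [^] N"
  proof -
    have "u \<otimes> b = a" using ab abR field_Units by (simp add: m_assoc)
    then show ?thesis using ab abR by (metis m_closed nat_pow_distrib)
  qed
  then have eq2: "(t \<ominus> \<alpha>) [^] m \<alpha> \<otimes> P \<otimes> b [^] N = a [^] N" using eq prod by simp
  have PR: "P \<in> carrier R" "P \<noteq> \<zero>" "t \<ominus> \<alpha> \<in> carrier R" using PT TR zT spP ring_hom_memE(1)[OF sp(1)]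
    sp(2)[of \<zero>] subringE(2)[OF SB] by auto
  have "a \<noteq> \<zero>"
  proof
    assume "a = \<zero>"
    then have "a [^] N = \<zero>" using N by (simp add: nat_pow_zero)
    moreover have "(t \<ominus> \<alpha>) [^] m \<alpha> \<otimes> P \<otimes> b [^] N \<noteq> \<zero>"
      using PR zT abR ab(4) by (simp add: integral_iff nat_pow_nonzero)
    ultimately show False using eq2 by simp
  qed
  obtain e :: nat and a1 where e: "a1 \<in> ?T" "sp a1 \<noteq> \<zero>" "a = (t \<ominus> \<alpha>) [^] e \<otimes> a1"
    using sp(5)[OF ab(2) \<open>a \<noteq> \<zero>\<close>] by blast
  obtain f :: nat and b1 where f: "b1 \<in> ?T" "sp b1 \<noteq> \<zero>" "b = (t \<ominus> \<alpha>) [^] f \<otimes> b1"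
    using sp(5)[OF ab(3,4)] by blast
  have R1: "a1 \<in> carrier R" "b1 \<in> carrier R" using e f TR by auto
  have spR: "sp v \<in> carrier R" if "v \<in> ?T" for v using sp(4)[OF that] BR by auto
  have spn: "sp (v [^] N) \<noteq> \<zero>" if "v \<in> ?T" "sp v \<noteq> \<zero>" for v
    using ring_hom_subring_nat_pow[OF sp(1) T that(1) ring_axioms ring_axioms] nat_pow_nonzero[OF spR[OF that(1)] that(2)]
    by simp
  have "(t \<ominus> \<alpha>) [^] (m \<alpha> + f * N) \<otimes> (P \<otimes> b1 [^] N) = (t \<ominus> \<alpha>) [^] (e * N) \<otimes> a1 [^] N"
  proof -
    have "(t \<ominus> \<alpha>) [^] (e * N) \<otimes> a1 [^] N = a [^] N"
      unfolding e(3) using R1 PR by (simp add: nat_pow_distrib nat_pow_pow)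
    moreover have "b [^] N = (t \<ominus> \<alpha>) [^] (f * N) \<otimes> b1 [^] N"
      unfolding f(3) using R1 PR by (simp add: nat_pow_distrib nat_pow_pow)
    ultimately show ?thesis
      using eq2 R1 PR by (simp add: nat_pow_mult[symmetric] m_assoc m_lcomm)
  qed
  then have eq3: "m \<alpha> + f * N = e * N"
  proof (rule multiplicity_unique[OF T sp(1) zT, rotated -1])
    show "P \<otimes> b1 [^] N \<in> ?T" "a1 [^] N \<in> ?T"
      using PT f(1) e(1) subring_nat_pow[OF T] subringE(6)[OF T] by auto
    show "sp (a1 [^] N) \<noteq> \<zero>" using spn e by blast
    have "sp (P \<otimes> b1 [^] N) = sp P \<otimes> sp (b1 [^] N)"
      using ring_hom_memE(2)[OF sp(1), of P "b1 [^] N"] PT subring_nat_pow[OF T f(1)] by simp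
    then show "sp (P \<otimes> b1 [^] N) \<noteq> \<zero>"
      using spn[OF f(1,2)] spP spR[OF PT] spR[OF subring_nat_pow[OF T f(1)]] integral_iff by simp
  qed
  from eq3 show "N dvd 1 * m \<alpha>" by (metis dvd_add_left_iff dvd_triv_right mult_1)
qed simp

text \<open>Specialize \<open>x\<close> to zero. Since \<open>y\<close> is a nonzero constant,
  numerator and denominator of \<open>u\<close> contain the same power of \<open>x\<close>; after
  cancelling it, the value of \<open>u\<close> at zero is an \<open>N\<close>-th root of
  \<open>y\<close> in \<open>F\<close>.\<close>

lemma (in field) radical_descends_transcendental:
  assumes F: "subfield F R" and x: "x \<in> carrier R" "(transcendental over F) x"
    and u: "u \<in> fractions R (simple_extension F x)" and y: "u [^] (N::nat) = y" "y \<in> F" "y \<noteq> \<zero>" "N > 0"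
  obtains v where "v \<in> F" "v [^] N = y"
proof -
  note SF = subfieldE(1)[OF F]
  have FR: "F \<subseteq> carrier R" using subringE(1)[OF SF] .
  let ?T = "simple_extension F x"
  have T: "subring ?T R" using simple_extension_is_subring[OF SF x(1)] .
  have TR: "?T \<subseteq> carrier R" using subringE(1)[OF T] .
  have FT: "F \<subseteq> ?T" using simple_extension_incl[OF FR x(1)] .
  have xT: "x \<in> ?T" using simple_extension_mem[OF SF x(1)] .
  have 0: "\<zero> \<in> F" using subringE(2)[OF SF] .
  obtain sp where sp: "sp \<in> ring_hom (R\<lparr>carrier := ?T\<rparr>) R"
    "\<And>a. a \<in> F \<Longrightarrow> sp a = a" "sp x = \<zero>" "\<And>a. a \<in> ?T \<Longrightarrow> sp a \<in> F"
    "\<And>a. a \<in> ?T \<Longrightarrow> a \<noteq> \<zero> \<Longrightarrow> \<exists>(e::nat) a1. a1 \<in> ?T \<and> sp a1 \<noteq> \<zero> \<and> a = (x \<ominus> \<zero>) [^] e \<otimes> a1"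
    using specialization[OF F x 0] by blast
  have x0: "x \<ominus> \<zero> = x" "x \<noteq> \<zero>"
    using x(1) transcendental_notin[OF SF x(2)] 0 by (auto simp: a_minus_def)
  obtain a b where ab: "u = a \<otimes> inv b" "a \<in> ?T" "b \<in> ?T" "b \<noteq> \<zero>" using u unfolding fractions_def by auto
  have abR: "a \<in> carrier R" "b \<in> carrier R" "inv b \<in> carrier R" using ab TR field_Units by auto
  have yR: "y \<in> carrier R" using y FR by auto
  have eq: "y \<otimes> b [^] N = a [^] N"
  proof -
    have "u \<otimes> b = a" using ab abR field_Units by (simp add: m_assoc)
    then show ?thesis using ab abR y(1) by (metis m_closed nat_pow_distrib)
  qed
  have "a \<noteq> \<zero>"
  proof
    assume "a = \<zero>"
    then have "a [^] N = \<zero>" using y(4) by (simp add: nat_pow_zero)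
    moreover have "y \<otimes> b [^] N \<noteq> \<zero>" using y yR abR ab(4) by (simp add: integral_iff nat_pow_nonzero)
    ultimately show False using eq by simp
  qed
  obtain e :: nat and a1 where e: "a1 \<in> ?T" "sp a1 \<noteq> \<zero>" "a = x [^] e \<otimes> a1"
    using sp(5)[OF ab(2) \<open>a \<noteq> \<zero>\<close>] unfolding x0 by blast
  obtain f :: nat and b1 where f: "b1 \<in> ?T" "sp b1 \<noteq> \<zero>" "b = x [^] f \<otimes> b1"
    using sp(5)[OF ab(3,4)] unfolding x0 by blast
  have R1: "a1 \<in> carrier R" "b1 \<in> carrier R" using e f TR by auto
  have spR: "sp v \<in> carrier R" if "v \<in> ?T" for v using sp(4)[OF that] FR by auto
  have spp: "sp (v [^] N) = sp v [^] N" if "v \<in> ?T" for v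
    using ring_hom_subring_nat_pow[OF sp(1) T that ring_axioms ring_axioms] .
  have spn: "sp (v [^] N) \<noteq> \<zero>" if "v \<in> ?T" "sp v \<noteq> \<zero>" for v
    using spp[OF that(1)] nat_pow_nonzero[OF spR[OF that(1)] that(2)] by simp
  have spy: "sp (y \<otimes> b1 [^] N) = y \<otimes> sp b1 [^] N"
    using ring_hom_memE(2)[OF sp(1), of y "b1 [^] N"] FT y(2) subring_nat_pow[OF T f(1)] sp(2)[OF y(2)] spp[OF f(1)]
    by auto
  have eq2: "x [^] (f * N) \<otimes> (y \<otimes> b1 [^] N) = x [^] (e * N) \<otimes> a1 [^] N"
  proof -
    have "x [^] (e * N) \<otimes> a1 [^] N = a [^] N"
      unfolding e(3) using R1 x by (simp add: nat_pow_distrib nat_pow_pow)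
    moreover have "b [^] N = x [^] (f * N) \<otimes> b1 [^] N"
      unfolding f(3) using R1 x by (simp add: nat_pow_distrib nat_pow_pow)
    ultimately show ?thesis using eq R1 x(1) yR by (simp add: m_lcomm)
  qed
  have fe: "f * N = e * N"
  proof (rule multiplicity_unique[OF T sp(1) xT x0(2) sp(3) _ _ _ _ eq2])
    show "y \<otimes> b1 [^] N \<in> ?T" "a1 [^] N \<in> ?T"
      using y(2) FT f(1) e(1) subring_nat_pow[OF T] subringE(6)[OF T] by auto
    show "sp (a1 [^] N) \<noteq> \<zero>" using spn e by blast
    show "sp (y \<otimes> b1 [^] N) \<noteq> \<zero>"
      using spy spn[OF f(1,2)] spp[OF f(1)] y yR spR[OF f(1)] integral_iff by simp
  qed
  have "y \<otimes> b1 [^] N = a1 [^] N"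
    using eq2[unfolded fe] m_lcancel[of "x [^] (e * N)" "y \<otimes> b1 [^] N" "a1 [^] N"] x(1) R1 yR nat_pow_nonzero[OF x(1) x0(2)]
    by (simp del: mult_cancel2)
  then have 1: "y \<otimes> sp b1 [^] N = sp a1 [^] N" using spy spp[OF e(1)] by simp
  have bu: "sp b1 \<in> carrier R" "sp b1 \<in> Units R" "inv (sp b1) \<in> carrier R"
    using spR[OF f(1)] f(2) field_Units by auto
  show ?thesis
  proof
    show "sp a1 \<otimes> inv (sp b1) \<in> F"
      using sp(4)[OF e(1)] sp(4)[OF f(1)] f(2) subfield_m_inv(1)[OF F] subringE(6)[OF SF] by auto
    have "(sp a1 \<otimes> inv (sp b1)) [^] N = y \<otimes> (sp b1 [^] N \<otimes> inv (sp b1) [^] N)"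
      using 1 spR[OF e(1)] bu yR by (simp add: nat_pow_distrib m_assoc[symmetric])
    also have "sp b1 [^] N \<otimes> inv (sp b1) [^] N = \<one>"
      using bu by (simp add: nat_pow_distrib[symmetric])
    finally show "(sp a1 \<otimes> inv (sp b1)) [^] N = y" using yR by simp
  qed
qed

text \<open>The products of factors \<open>t \<ominus> \<alpha>\<close> are nonzero elements of
  \<open>F\<close>, so their roots descend to \<open>F\<close> and the same \<open>d\<close>
  serves.\<close>

lemma (in field) radical_bounded_transcendental:
  assumes F: "subfield F R" and x: "x \<in> carrier R" "(transcendental over F) x"
    and B: "B \<subseteq> F" and t: "t \<in> F" "t \<notin> B" and bound: "radical_bounded t B F"
  shows "radical_bounded t B (fractions R (simple_extension F x))"
proof -
  note SF = subfieldE(1)[OF F]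
  have FR: "F \<subseteq> carrier R" using subringE(1)[OF SF] .
  obtain d :: nat where d: "d > 0" "\<And>(N::nat) u (m::'a \<Rightarrow> nat) S. N > 0 \<Longrightarrow> u \<in> F \<Longrightarrow> finite S \<Longrightarrow> S \<subseteq> B \<Longrightarrow>
        u [^] N = (\<Otimes>\<alpha>\<in>S. (t \<ominus> \<alpha>) [^] m \<alpha>) \<Longrightarrow> (\<forall>\<alpha>\<in>S. N dvd d * m \<alpha>)"
    using bound unfolding radical_bounded_def by blast
  have "\<forall>\<alpha>\<in>S. N dvd d * m \<alpha>"
    if N: "N > 0" and u: "u \<in> fractions R (simple_extension F x)" and S: "finite S" "S \<subseteq> B"
      and eq: "u [^] N = (\<Otimes>\<alpha>\<in>S. (t \<ominus> \<alpha>) [^] m \<alpha>)" for N :: nat and u and m :: "'a \<Rightarrow> nat" and S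
  proof -
    have lin: "t \<ominus> \<alpha> \<in> F" "t \<ominus> \<alpha> \<noteq> \<zero>" if "\<alpha> \<in> S" for \<alpha>
    proof -
      have "\<alpha> \<in> F" "\<alpha> \<in> carrier R" "t \<in> carrier R" "t \<noteq> \<alpha>" using that S B t FR by auto
      then show "t \<ominus> \<alpha> \<in> F" "t \<ominus> \<alpha> \<noteq> \<zero>"
        using t subringE(5,7)[OF SF] r_right_minus_eq unfolding a_minus_def by auto
    qed
    have "(\<Otimes>\<alpha>\<in>S. (t \<ominus> \<alpha>) [^] m \<alpha>) \<in> F"
      by (rule subring_finprod[OF SF]) (use lin subring_nat_pow[OF SF] in auto)
    moreover have "(\<Otimes>\<alpha>\<in>S. (t \<ominus> \<alpha>) [^] m \<alpha>) \<noteq> \<zero>"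
      by (rule finprod_nonzero) (use lin nat_pow_nonzero FR in blast)
    ultimately obtain v where "v \<in> F" "v [^] N = (\<Otimes>\<alpha>\<in>S. (t \<ominus> \<alpha>) [^] m \<alpha>)"
      using radical_descends_transcendental[OF F x u eq _ _ N] by blast
    then show ?thesis using d(2)[OF N _ S] by blast
  qed
  then show ?thesis unfolding radical_bounded_def using d(1) by blast
qed

text \<open>Up to sign the constant term is the product of the roots, each of which is an
  \<open>N\<close>-th root of \<open>y\<close>; the factor \<open>2\<close> in the exponents removes
  the sign. The constant term thus plays the role of a norm.\<close>

lemma (in algebraically_closed) const_term_pow_of_radical_roots:
  assumes y: "y \<in> carrier L"
    and "p \<in> carrier (poly_ring L)" "p \<noteq> []" "lead_coeff p = \<one>"
    and "\<And>x. x \<in> carrier L \<Longrightarrow> eval p x = \<zero> \<Longrightarrow> x [^] (N::nat) = y"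
  shows "(eval p \<zero>) [^] (2 * N) = y [^] (2 * degree p)"
  using assms(2-)
proof (induct "degree p" arbitrary: p)
  case 0
  then have "p = [\<one>]" by (cases p) auto
  then show ?case by simp
next
  case (Suc n p)
  obtain x where x: "x \<in> carrier L" "eval p x = \<zero>" using exists_root[OF Suc(3)] Suc(2) by (metis zero_less_Suc)
  then have "[\<one>, \<ominus> x] pdivides p"
    using is_root_imp_pdivides[OF Suc(3), of x] Suc(4) unfolding is_root_def by simp
  then obtain q where q: "q \<in> carrier (poly_ring L)" "p = [\<one>, \<ominus> x] \<otimes>\<^bsub>poly_ring L\<^esub> q"
    unfolding pdivides_def by blast
  have lin: "[\<one>, \<ominus> x] \<in> carrier (poly_ring L)" using x by (simp add: univ_poly_def polynomial_def)
  have pm: "p = poly_mult [\<one>, \<ominus> x] q" using q(2) by (simp add: univ_poly_mult)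
  have q0: "q \<noteq> []" using Suc(4) pm poly_mult_zero(2)[of "[\<one>, \<ominus> x]"] x by auto
  have pol: "polynomial (carrier L) [\<one>, \<ominus> x]" "polynomial (carrier L) q"
    using lin q(1) by (simp_all add: univ_poly_carrier)
  have dp: "degree p = Suc (degree q)"
    using poly_mult_degree_eq[OF carrier_is_subring pol] pm q0 by simp
  have qc: "set q \<subseteq> carrier L" using polynomial_in_carrier[OF carrier_is_subring pol(2)] .
  have lq: "lead_coeff q = \<one>"
    using poly_mult_lead_coeff[OF carrier_is_subring pol] pm q0 Suc(5) qc by (cases q) auto
  have ev: "eval p z = (z \<ominus> x) \<otimes> eval q z" if "z \<in> carrier L" for z
    using ring_hom_memE(2)[OF eval_is_hom[OF carrier_is_subring that] lin q(1)] q(2) x that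
    by (simp add: a_minus_def)
  have evq: "eval q z \<in> carrier L" if "z \<in> carrier L" for z using eval_in_carrier[OF qc that] .
  have IH: "(eval q \<zero>) [^] (2 * N) = y [^] (2 * degree q)"
  proof (rule Suc(1)[OF _ q(1) q0 lq])
    show "n = degree q" using dp Suc(2) by simp
    show "z [^] N = y" if "z \<in> carrier L" "eval q z = \<zero>" for z
      using Suc(6)[OF that(1)] ev[OF that(1)] that x by simp
  qed
  have "(\<ominus> x) [^] (2 * N) = y [^] (2::nat)"
  proof -
    have "(\<ominus> x) [^] (2 * N) = ((\<ominus> x) [^] (2::nat)) [^] N" using x by (simp add: nat_pow_pow)
    also have "(\<ominus> x) [^] (2::nat) = x [^] (2::nat)"
      using x by (simp add: numeral_2_eq_2 l_minus r_minus)
    also have "(x [^] (2::nat)) [^] N = (x [^] N) [^] (2::nat)" using x by (simp add: nat_pow_pow mult.commute)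
    finally show ?thesis using Suc(6) x by simp
  qed
  moreover have "eval p \<zero> = \<ominus> x \<otimes> eval q \<zero>" using ev[of \<zero>] x by (simp add: a_minus_def)
  ultimately show ?case
    using IH x evq[of \<zero>] y dp by (simp add: nat_pow_distrib nat_pow_mult)
qed

text \<open>Every conjugate of \<open>u\<close> over \<open>F\<close> is again an
  \<open>N\<close>-th root of \<open>y\<close>, so the constant term of the minimal polynomial of
  \<open>u\<close> is a radical in \<open>F\<close>. The bound over \<open>F\<close> yields
  \<open>N dvd d * m \<alpha> * s\<close>, where \<open>s\<close> is the degree of \<open>u\<close>.
  This degree varies with \<open>u\<close> but is at most \<open>D\<close>, and
  \<open>fact D\<close> is a multiple of all its values.\<close>

lemma (in algebraically_closed) radical_bounded_algebraic:
  assumes F: "subfield F L" and x: "x \<in> carrier L" "(algebraic over F) x"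
    and B: "B \<subseteq> F" and t: "t \<in> F" and bound: "radical_bounded t B F"
  shows "radical_bounded t B (simple_extension F x)"
proof -
  note SF = subfieldE(1)[OF F]
  have FR: "F \<subseteq> carrier L" using subringE(1)[OF SF] .
  obtain d :: nat where d: "d > 0" "\<And>(N::nat) u (m::'a \<Rightarrow> nat) S. N > 0 \<Longrightarrow> u \<in> F \<Longrightarrow> finite S \<Longrightarrow> S \<subseteq> B \<Longrightarrow>
        u [^] N = (\<Otimes>\<alpha>\<in>S. (t \<ominus> \<alpha>) [^] m \<alpha>) \<Longrightarrow> (\<forall>\<alpha>\<in>S. N dvd d * m \<alpha>)"
    using bound unfolding radical_bounded_def by blast
  define D where "D = degree (Irr F x)"
  have dimD: "dimension D F (simple_extension F x)"
    unfolding D_def by (rule dimension_simple_extension[OF F x])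
  have T: "subring (simple_extension F x) L" using simple_extension_is_subring[OF SF x(1)] .
  have "\<forall>\<alpha>\<in>S. N dvd d * fact D * m \<alpha>"
    if N: "N > 0" and u: "u \<in> simple_extension F x" and S: "finite S" "S \<subseteq> B"
      and eq: "u [^] N = (\<Otimes>\<alpha>\<in>S. (t \<ominus> \<alpha>) [^] m \<alpha>)" for N :: nat and u and m :: "'a \<Rightarrow> nat" and S
  proof
    fix \<alpha> assume \<alpha>: "\<alpha> \<in> S"
    define y where "y = (\<Otimes>\<alpha>\<in>S. (t \<ominus> \<alpha>) [^] m \<alpha>)"
    have lin: "t \<ominus> \<alpha> \<in> F" if "\<alpha> \<in> S" for \<alpha>
      using that S B t FR subringE(5,7)[OF SF] unfolding a_minus_def by auto
    have linR: "t \<ominus> \<alpha> \<in> carrier L" if "\<alpha> \<in> S" for \<alpha> using lin[OF that] FR by auto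
    have yF: "y \<in> F"
      unfolding y_def by (rule subring_finprod[OF SF]) (use lin subring_nat_pow[OF SF] in auto)
    have uR: "u \<in> carrier L" using u subringE(1)[OF T] by auto
    have ualg: "(algebraic over F) u" by (rule simple_extesion_mem_imp_algebraic[OF F x u])
    define p where "p = Irr F u"
    note I = IrrE[OF F uR ualg, folded p_def]
    have pR: "p \<in> carrier (poly_ring L)" using carrier_polynomial_shell[OF SF I(1)] .
    define s where "s = degree p"
    have s1: "s \<ge> 1" using pirreducible_degree[OF F I(1,2)] unfolding s_def .
    have p0: "p \<noteq> []" using s1 unfolding s_def by auto
    \<comment> \<open>The powers of \<open>u\<close> with exponent below \<open>s\<close> are
      independent inside an extension of dimension \<open>D\<close>.\<close>
    have sD: "s \<le> D"
    proof -
      have "set (exp_base u s) \<subseteq> simple_extension F x"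
        unfolding exp_base_def using subring_nat_pow[OF T u] by auto
      moreover have "independent F (exp_base u s)"
        using exp_base_independent[OF F uR ualg] unfolding s_def p_def .
      ultimately have "length (exp_base u s) \<le> D"
        using independent_length_le_dimension[OF F dimD] by blast
      then show ?thesis by (simp add: exp_base_def)
    qed
    have idh: "id \<in> ring_hom (L\<lparr>carrier := F\<rparr>) L" using FR by (intro ring_hom_memI) auto
    have roots: "z [^] N = y" if z: "z \<in> carrier L" "eval p z = \<zero>" for z
    proof -
      obtain \<tau> where \<tau>: "\<tau> \<in> ring_hom (L\<lparr>carrier := simple_extension F u\<rparr>) L"
        "\<And>a. a \<in> F \<Longrightarrow> \<tau> a = a" "\<tau> u = z"
        using hom_extends_to_simple_extension[OF F idh uR ualg z(1)] z(2) unfolding p_def by auto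
      have "\<tau> (u [^] N) = z [^] N"
        using ring_hom_subring_nat_pow[OF \<tau>(1) simple_extension_is_subring[OF SF uR]
            simple_extension_mem[OF SF uR] ring_axioms ring_axioms] \<tau>(3) by simp
      then show ?thesis using eq \<tau>(2)[OF yF] unfolding y_def by simp
    qed
    have cF: "eval p \<zero> \<in> F"
    proof -
      have "set p \<subseteq> F" using I(1) polynomial_incl by (simp add: univ_poly_def)
      then show ?thesis
        using ring.eval_in_carrier[OF subring_is_ring[OF SF], of p \<zero>] subringE(2)[OF SF] eval_consistent[OF SF]
        by simp
    qed
    have yR: "y \<in> carrier L" using yF FR by auto
    have "(eval p \<zero>) [^] (2 * N) = y [^] (2 * s)"
      unfolding s_def by (rule const_term_pow_of_radical_roots[OF yR pR p0 I(3) roots])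
    also have "\<dots> = (\<Otimes>\<alpha>\<in>S. ((t \<ominus> \<alpha>) [^] m \<alpha>) [^] (2 * s))"
      unfolding y_def by (rule finprod_nat_pow) (use lin FR in auto)
    also have "\<dots> = (\<Otimes>\<alpha>\<in>S. (t \<ominus> \<alpha>) [^] (m \<alpha> * (2 * s)))"
      by (rule finprod_cong') (use linR in \<open>auto simp: nat_pow_pow\<close>)
    finally have "2 * N dvd d * (m \<alpha> * (2 * s))"
      using d(2)[of "2 * N" "eval p \<zero>" S "\<lambda>\<alpha>. m \<alpha> * (2 * s)"] N cF S \<alpha> by auto
    then have "2 * N dvd 2 * (d * m \<alpha> * s)" by (simp add: ac_simps)
    then have "N dvd d * m \<alpha> * s" by simp
    obtain k where "fact D = s * k" using dvd_fact[OF s1 sD] by (auto simp: dvd_def)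
    then have "d * fact D * m \<alpha> = d * m \<alpha> * s * k" by simp
    then show "N dvd d * fact D * m \<alpha>" using \<open>N dvd d * m \<alpha> * s\<close> by (simp only: dvd_mult2)
  qed
  then show ?thesis unfolding radical_bounded_def using d(1)
    by (intro exI[of _ "d * fact D"]) auto
qed

text \<open>The generators are adjoined one by one to the rational functions in \<open>t\<close>. An
  algebraic step multiplies the bound by a factorial; a transcendental step keeps it, but passes to
  fractions because there the simple extension is not a field.\<close>

theorem (in algebraically_closed) exists_radical_bounded_field:
  assumes B: "subfield B L" and t: "t \<in> carrier L" "(transcendental over B) t" and xs: "set xs \<subseteq> carrier L"
  obtains F where "subfield F L" "B \<subseteq> F" "t \<in> F" "set xs \<subseteq> F" "radical_bounded t B F"
  using xs
proof (induct xs arbitrary: thesis)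
  case Nil
  note SB = subfieldE(1)[OF B]
  have T: "subring (simple_extension B t) L" using simple_extension_is_subring[OF SB t(1)] .
  have "simple_extension B t \<subseteq> fractions L (simple_extension B t)" by (rule fractions_incl[OF T])
  moreover have "t \<in> simple_extension B t" using simple_extension_mem[OF SB t(1)] .
  moreover have "B \<subseteq> simple_extension B t" using simple_extension_incl[OF subringE(1)[OF SB] t(1)] .
  ultimately show ?case
    using Nil(1)[OF subfield_fractions[OF T]] radical_bounded_rational[OF B t] by auto
next
  case (Cons x xs)
  obtain F where F: "subfield F L" "B \<subseteq> F" "t \<in> F" "set xs \<subseteq> F" "radical_bounded t B F"
    using Cons.hyps Cons.prems(2) by auto
  note SF = subfieldE(1)[OF F(1)]
  have x: "x \<in> carrier L" using Cons.prems(2) by auto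
  have T: "subring (simple_extension F x) L" using simple_extension_is_subring[OF SF x] .
  have xT: "x \<in> simple_extension F x" using simple_extension_mem[OF SF x] .
  have FT: "F \<subseteq> simple_extension F x" using simple_extension_incl[OF subringE(1)[OF SF] x] .
  show ?case
  proof (cases "(algebraic over F) x")
    case True
    show ?thesis
      using Cons.prems(1)[of "simple_extension F x"] simple_extension_is_subfield[OF F(1) x] True xT FT F
        radical_bounded_algebraic[OF F(1) x True F(2,3,5)] by auto
  next
    case False
    then have tr: "(transcendental over F) x" by (simp add: over_def)
    have "simple_extension F x \<subseteq> fractions L (simple_extension F x)" by (rule fractions_incl[OF T])
    moreover have "radical_bounded t B (fractions L (simple_extension F x))"
      by (rule radical_bounded_transcendental[OF F(1) x tr F(2,3) _ F(5)])
        (rule transcendental_notin[OF subfieldE(1)[OF B] t(2)])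
    ultimately show ?thesis
      using Cons.prems(1)[OF subfield_fractions[OF T]] xT FT F by auto
  qed
qed

section \<open>Kummer extensions\<close>

text \<open>Triangular elimination shows that \<open>D\<close> is free with \<open>r\<close> dual coordinates \<open>c 0, \<dots>, c (r - 1)\<close>.\<close>

lemma lattice_coordinates:
  fixes D :: "(nat \<Rightarrow> int) set" and N :: int
  assumes "N > 0" and "\<And>v i. v \<in> D \<Longrightarrow> i \<ge> r \<Longrightarrow> v i = 0"
    and "\<And>v w. v \<in> D \<Longrightarrow> w \<in> D \<Longrightarrow> (\<lambda>i. v i - w i) \<in> D"
    and "\<And>i. i < r \<Longrightarrow> (\<lambda>j. if j = i then N else 0) \<in> D" and "D \<noteq> {}"
  shows "\<exists>c. (\<forall>l<r. \<forall>v\<in>D. \<forall>w\<in>D. c l (\<lambda>i. v i + w i) = (c l v + c l w :: int)) \<and>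
     (\<forall>l<r. \<exists>v\<in>D. \<forall>l'<r. c l' v = (if l' = l then 1 else 0))"
  using assms
proof (induct r arbitrary: D)
  case 0
  then show ?case by simp
next
  case (Suc r)
  note diff = Suc.prems(3)
  have zero: "(\<lambda>i. 0) \<in> D" using Suc.prems(5) diff by fastforce
  have neg: "(\<lambda>i. - v i) \<in> D" if "v \<in> D" for v using diff[OF zero that] by simp
  have add: "(\<lambda>i. v i + w i) \<in> D" if "v \<in> D" "w \<in> D" for v w using diff[OF that(1) neg[OF that(2)]] by simp
  have nmult: "(\<lambda>i. int n * v i) \<in> D" if "v \<in> D" for n v
    using that by (induct n) (auto simp: zero algebra_simps intro: add)
  have mult: "(\<lambda>i. q * v i) \<in> D" if "v \<in> D" for q v
  proof (cases "q \<ge> 0")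
    case True
    then show ?thesis using nmult[OF that, of "nat q"] by simp
  next
    case False
    then show ?thesis using nmult[OF neg[OF that], of "nat (- q)"] by simp
  qed
  \<comment> \<open>The least positive last coordinate \<open>g\<close> generates the ideal of all
    last coordinates; a positive one exists because \<open>N\<close> is among them.\<close>
  define P where "P n \<longleftrightarrow> n > 0 \<and> (\<exists>v\<in>D. v r = int n)" for n :: nat
  have "P (nat N)"
    unfolding P_def using Suc.prems(1) Suc.prems(4)[of r] by (intro conjI bexI[of _ "\<lambda>j. if j = r then N else 0"]) auto
  then have PL: "P (Least P)" by (rule LeastI)
  define g where "g = int (Least P)"
  obtain v0 where v0: "v0 \<in> D" "v0 r = g" and g: "g > 0" using PL unfolding P_def g_def by auto
  have gdvd: "g dvd v r" if v: "v \<in> D" for v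
  proof (rule ccontr)
    assume "\<not> g dvd v r"
    then have m: "v r mod g > 0" using g by (metis dvd_eq_mod_eq_0 less_le pos_mod_sign)
    have "(\<lambda>i. v i - (v r div g) * v0 i) \<in> D" by (rule diff[OF v mult[OF v0(1)]])
    moreover have "v r - (v r div g) * v0 r = v r mod g" using v0(2) by (simp add: minus_div_mult_eq_mod)
    ultimately have "P (nat (v r mod g))" unfolding P_def using m
      by (intro conjI bexI[of _ "\<lambda>i. v i - (v r div g) * v0 i"]) auto
    then have "Least P \<le> nat (v r mod g)" by (rule Least_le)
    then have "g \<le> v r mod g" using m unfolding g_def by linarith
    then show False using pos_mod_bound[OF g, of "v r"] by linarith
  qed
  define D' where "D' = {v \<in> D. v r = 0}"
  have "\<exists>c. (\<forall>l<r. \<forall>v\<in>D'. \<forall>w\<in>D'. c l (\<lambda>i. v i + w i) = (c l v + c l w :: int)) \<and>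
     (\<forall>l<r. \<exists>v\<in>D'. \<forall>l'<r. c l' v = (if l' = l then 1 else 0))"
  proof (rule Suc.hyps)
    show "v i = 0" if "v \<in> D'" "r \<le> i" for v i
      using that Suc.prems(2)[of v i] unfolding D'_def by (cases "i = r") auto
    show "(\<lambda>i. v i - w i) \<in> D'" if "v \<in> D'" "w \<in> D'" for v w using that diff unfolding D'_def by auto
    show "(\<lambda>j. if j = i then N else 0) \<in> D'" if "i < r" for i using that Suc.prems(4)[of i] unfolding D'_def by auto
    show "D' \<noteq> {}" using zero unfolding D'_def by auto
  qed (rule Suc.prems(1))
  then obtain c where c': "\<forall>l<r. \<forall>v\<in>D'. \<forall>w\<in>D'. c l (\<lambda>i. v i + w i) = (c l v + c l w :: int)"
    "\<forall>l<r. \<exists>v\<in>D'. \<forall>l'<r. c l' v = (if l' = l then 1 else 0)" by (elim exE conjE)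
  have c: "c l (\<lambda>i. v i + w i) = c l v + c l w" if "l < r" "v \<in> D'" "w \<in> D'" for l v w
    using c'(1) that by simp
  \<comment> \<open>Subtracting the right multiple of \<open>v0\<close> clears the last coordinate;
    so \<open>D\<close> splits into \<open>D'\<close> and the multiples of
    \<open>v0\<close>.\<close>
  define red where "red v = (\<lambda>i. v i - (v r div g) * v0 i)" for v :: "nat \<Rightarrow> int"
  have red: "red v \<in> D'" if "v \<in> D" for v
    using diff[OF that mult[OF v0(1)]] gdvd[OF that] v0(2) unfolding D'_def red_def by simp
  have red_add: "red (\<lambda>i. v i + w i) = (\<lambda>i. red v i + red w i)" if "v \<in> D" "w \<in> D" for v w
  proof -
    have "(v r + w r) div g = v r div g + w r div g" using gdvd[OF that(1)] by (rule div_plus_div_distrib_dvd_left)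
    then show ?thesis unfolding red_def by (auto simp: algebra_simps)
  qed
  define c' where "c' l v = (if l = r then v r div g else c l (red v))" for l v
  have zero': "(\<lambda>i. 0) \<in> D'" using zero unfolding D'_def by simp
  show ?case
  proof (intro exI[of _ c'] conjI allI impI ballI)
    fix l v w assume "l < Suc r" "v \<in> D" "w \<in> D"
    then show "c' l (\<lambda>i. v i + w i) = c' l v + c' l w"
      using red_add[of v w] c[of l "red v" "red w"] red div_plus_div_distrib_dvd_left[OF gdvd, of v "w r"]
      unfolding c'_def by auto
  next
    fix l assume l: "l < Suc r"
    show "\<exists>v\<in>D. \<forall>l'<Suc r. c' l' v = (if l' = l then 1 else 0)"
    proof (cases "l = r")
      case True
      have "red v0 = (\<lambda>i. 0)" unfolding red_def using v0 g by simp
      moreover have "c l' (\<lambda>i. 0) = 0" if "l' < r" for l' using c[OF that zero' zero'] by simp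
      ultimately show ?thesis using True v0 g unfolding c'_def by (intro bexI[of _ v0]) auto
    next
      case False
      then have "l < r" using l by simp
      then obtain v where v: "v \<in> D'" "\<forall>l'<r. c l' v = (if l' = l then 1 else 0)" using c'(2) by blast
      then have "red v = v" unfolding red_def D'_def by simp
      then show ?thesis using v False unfolding c'_def D'_def by (intro bexI[of _ v]) auto
    qed
  qed
qed

section \<open>Roots of unity\<close>

lemma (in algebraically_closed) exists_nth_root:
  assumes a: "a \<in> carrier L" and n: "n > 0"
  obtains y where "y \<in> carrier L" "y [^] (n::nat) = a"
proof -
  \<comment> \<open>Lists start with the leading coefficient, and appending an entry multiplies by
    \<open>X\<close> and adds a constant; so this is \<open>X ^ n - a\<close>.\<close>
  define p where "p = monom \<one> (n - 1) @ [\<ominus> a]"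
  have p: "p \<in> carrier (poly_ring L)"
    using a unfolding p_def monom_def by (auto simp: univ_poly_def polynomial_def)
  have "degree p > 0" using n unfolding p_def monom_def by simp
  then obtain y where y: "y \<in> carrier L" "eval p y = \<zero>" using exists_root[OF p] by blast
  have "eval p y = y [^] (n - 1) \<otimes> y \<ominus> a"
    unfolding p_def using eval_append_aux[of "monom \<one> (n - 1)" "\<ominus> a" y] eval_monom[of \<one> y "n - 1"] a y
    by (simp add: monom_in_carrier a_minus_def)
  also have "y [^] (n - 1) \<otimes> y = y [^] n" using n nat_pow_Suc[of y "n - 1"] by simp
  finally have "y [^] n \<ominus> a = \<zero>" using y by simp
  then have "y [^] n = a" using y a by (simp only: r_right_minus_eq nat_pow_closed)
  then show ?thesis using that y by blast
qed

lemma (in field) card_nth_roots_of_unity: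
  assumes n: "n > 0"
  shows "finite {z \<in> carrier R. z [^] (n::nat) = \<one>}" and "card {z \<in> carrier R. z [^] (n::nat) = \<one>} \<le> n"
proof -
  define p where "p = monom \<one> (n - 1) @ [\<ominus> \<one>]"
  have p: "p \<in> carrier (poly_ring R)"
    unfolding p_def monom_def by (auto simp: univ_poly_def polynomial_def)
  have "degree p = n" using n unfolding p_def monom_def by simp
  have "eval p y = y [^] n \<ominus> \<one>" if y: "y \<in> carrier R" for y
  proof -
    have "eval p y = y [^] (n - 1) \<otimes> y \<ominus> \<one>"
      unfolding p_def using eval_append_aux[of "monom \<one> (n - 1)" "\<ominus> \<one>" y] eval_monom[of \<one> y "n - 1"] y
      by (simp add: monom_in_carrier a_minus_def)
    also have "y [^] (n - 1) \<otimes> y = y [^] n" using n nat_pow_Suc[of y "n - 1"] by simp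
    finally show ?thesis .
  qed
  then have sub: "{z \<in> carrier R. z [^] n = \<one>} \<subseteq> set_mset (roots p)"
    using roots_mem_iff_is_root[OF p] unfolding is_root_def p_def by auto
  then show "finite {z \<in> carrier R. z [^] n = \<one>}" by (rule finite_subset) simp
  have "card {z \<in> carrier R. z [^] n = \<one>} \<le> card (set_mset (roots p))" by (rule card_mono[OF _ sub]) simp
  also have "\<dots> \<le> size (roots p)"
    using size_mset_mono[OF mset_set_set_mset_msubset[of "roots p"]] by simp
  also have "\<dots> \<le> n" using size_roots_le_degree[OF p] \<open>degree p = n\<close> by simp
  finally show "card {z \<in> carrier R. z [^] n = \<one>} \<le> n" .
qed

text \<open>\<open>replicate n \<one>\<close> encodes \<open>1 + X + ... + X ^ (n - 1)\<close>. Its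
  roots are roots of unity, and in characteristic zero with \<open>n > 0\<close> they differ from
  \<open>\<one>\<close>.\<close>

lemma (in cring) geometric_eval:
  assumes x: "x \<in> carrier R"
  shows "(x \<ominus> \<one>) \<otimes> eval (replicate n \<one>) x = x [^] n \<ominus> \<one>"
proof (induct n)
  case 0
  show ?case using x by (simp add: r_neg a_minus_def)
next
  case (Suc n)
  have e: "eval (replicate n \<one>) x \<in> carrier R" using x by (intro eval_in_carrier) auto
  have "(x \<ominus> \<one>) \<otimes> eval (replicate (Suc n) \<one>) x = (x \<ominus> \<one>) \<otimes> x [^] n \<oplus> (x \<ominus> \<one>) \<otimes> eval (replicate n \<one>) x"
    using x e by (simp add: r_distr)
  also have "\<dots> = (x [^] Suc n \<ominus> x [^] n) \<oplus> (x [^] n \<ominus> \<one>)"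
  proof -
    have "(x \<ominus> \<one>) \<otimes> x [^] n = x [^] Suc n \<ominus> x [^] n"
      using x by (simp add: a_minus_def l_distr l_minus m_comm[of x "x [^] n"])
    then show ?thesis by (simp only: Suc)
  qed
  also have "\<dots> = x [^] Suc n \<ominus> \<one>" using x by (simp add: a_minus_def a_assoc r_neg1)
  finally show ?case .
qed

definition (in monoid) primitive_root_of_unity :: "nat \<Rightarrow> 'a \<Rightarrow> bool" where
  "primitive_root_of_unity n z \<longleftrightarrow> z \<in> carrier G \<and> (\<forall>k::nat. z [^] k = \<one> \<longleftrightarrow> n dvd k)"

lemma (in monoid) pow_coprime_eq_one:
  assumes z: "z \<in> carrier G" "z [^] (a::nat) = \<one>" "z [^] (b::nat) = \<one>" and c: "coprime a b" "a \<noteq> 0"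
  shows "z = \<one>"
proof -
  obtain u v where uv: "a * u = b * v + gcd a b" using bezout_nat[OF c(2), of b] by blast
  have "z [^] (a * u) = \<one>" "z [^] (b * v) = \<one>"
    using z by (simp_all add: nat_pow_pow[symmetric])
  moreover have "z [^] (a * u) = z [^] (b * v) \<otimes> z" using uv c z by (simp add: nat_pow_mult[symmetric])
  ultimately show ?thesis using z by simp
qed

text \<open>Induction along \<open>n = q * m\<close> with \<open>q\<close> prime. If
  \<open>q\<close> divides \<open>m\<close>, any \<open>q\<close>-th root of a primitive
  \<open>m\<close>-th root of unity will do. Otherwise the latter is multiplied by an element of
  order \<open>q\<close>, found as a root of \<open>1 + X + ... + X ^ (q - 1)\<close>; the value of
  this polynomial at \<open>\<one>\<close> is \<open>q\<close>, which is nonzero in characteristic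
  zero.\<close>

lemma (in algebraically_closed) exists_primitive_root_of_unity:
  assumes char0: "\<And>n::nat. n > 0 \<Longrightarrow> [n] \<cdot> \<one> \<noteq> \<zero>" and "n > 0"
  shows "\<exists>z. primitive_root_of_unity n z"
  using assms(2)
proof (induct n rule: less_induct)
  case (less n)
  show ?case
  proof (cases "n = 1")
    case True
    then show ?thesis unfolding primitive_root_of_unity_def by (intro exI[of _ \<one>]) auto
  next
    case False
    then obtain q :: nat where q: "Factorial_Ring.prime q" "q dvd n" using prime_factor_nat by blast
    then obtain m where m: "n = q * m" by (auto simp: dvd_def)
    have q1: "q > 1" using prime_gt_1_nat[OF q(1)] .
    have "m < n" "m > 0" using m less(2) q1 by auto
    then obtain z where z: "z \<in> carrier L" "\<And>k::nat. z [^] k = \<one> \<longleftrightarrow> m dvd k"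
      using less(1) unfolding primitive_root_of_unity_def by blast
    show ?thesis
    proof (cases "q dvd m")
      case True
      obtain y where y: "y \<in> carrier L" "y [^] q = z" using exists_nth_root[OF z(1), of q] q1 by auto
      \<comment> \<open>The order of \<open>z\<close> is used twice: first for
        \<open>m dvd k\<close>, hence \<open>q dvd k\<close>, and then for the quotient of
        \<open>k\<close> by \<open>q\<close>.\<close>
      have "y [^] k = \<one> \<longleftrightarrow> n dvd k" for k :: nat
      proof
        assume k: "y [^] k = \<one>"
        have zk: "z [^] j = y [^] (q * j)" for j :: nat using y nat_pow_pow[of y q j] by simp
        have "y [^] (k * q) = \<one>" using y k by (simp add: nat_pow_pow[symmetric])
        then have "m dvd k" using z(2)[of k] zk[of k] by (simp add: mult.commute)
        then obtain j where j: "k = q * j" using True by (meson dvd_def dvd_trans)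
        then have "m dvd j" using z(2)[of j] zk[of j] k by simp
        then show "n dvd k" unfolding m j by simp
      next
        assume "n dvd k"
        then obtain j where "k = n * j" by (auto simp: dvd_def)
        then have "k = q * (m * j)" unfolding m by simp
        then have "y [^] k = z [^] (m * j)" using y by (simp add: nat_pow_pow[symmetric])
        then show "y [^] k = \<one>" using z(2)[of "m * j"] by simp
      qed
      then show ?thesis using y unfolding primitive_root_of_unity_def by blast
    next
      case False
      have cop: "coprime q m" using q(1) False by (simp add: prime_imp_coprime_nat)
      have p: "replicate q \<one> \<in> carrier (poly_ring L)"
        using q1 by (cases q) (auto simp: univ_poly_def polynomial_def)
      have "degree (replicate q \<one>) > 0" using q1 by simp
      then obtain w where w: "w \<in> carrier L" "eval (replicate q \<one>) w = \<zero>" using exists_root[OF p] by blast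
      have "w [^] q \<ominus> \<one> = \<zero>" using geometric_eval[OF w(1), of q] w by simp
      then have wq: "w [^] q = \<one>" using w by (simp only: r_right_minus_eq nat_pow_closed one_closed)
      have "eval (replicate i \<one>) \<one> = [i] \<cdot> \<one>" for i
        by (induct i) (auto simp: a_comm)
      then have w1: "w \<noteq> \<one>" using w(2) char0[of q] q1 by auto
      have "(z \<otimes> w) [^] k = \<one> \<longleftrightarrow> n dvd k" for k :: nat
      proof
        assume k: "(z \<otimes> w) [^] k = \<one>"
        then have zw: "z [^] k \<otimes> w [^] k = \<one>" using z w by (simp add: nat_pow_distrib)
        \<comment> \<open>The \<open>q\<close>-th power removes \<open>w\<close> and shows
          \<open>m dvd k\<close>; what remains is \<open>w ^ k = 1\<close>, and the prime order of
          \<open>w\<close> gives \<open>q dvd k\<close>.\<close>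
        have "(w [^] k) [^] q = (w [^] q) [^] k" using w by (simp add: nat_pow_pow mult.commute)
        then have "(w [^] k) [^] q = \<one>" using wq by simp
        moreover have "(z [^] k \<otimes> w [^] k) [^] q = \<one>" using zw by simp
        ultimately have "z [^] (k * q) = \<one>"
          using z w by (simp add: nat_pow_distrib nat_pow_pow)
        then have "m dvd k" using z(2)[of "k * q"] cop by (simp add: coprime_commute coprime_dvd_mult_left_iff)
        then have "z [^] k = \<one>" using z(2) by simp
        then have wk: "w [^] k = \<one>" using zw w by simp
        have "q dvd k"
        proof (rule ccontr)
          assume "\<not> q dvd k"
          then have "coprime q k" using q(1) by (simp add: prime_imp_coprime_nat)
          then show False using pow_coprime_eq_one[OF w(1) wq wk] q1 w1 by simp
        qed
        then show "n dvd k"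
          using semiring_gcd_class.divides_mult[OF _ \<open>m dvd k\<close> cop] unfolding m by blast
      next
        assume "n dvd k"
        then obtain j where "k = n * j" by (auto simp: dvd_def)
        then have j: "k = q * (m * j)" unfolding m by simp
        then have "z [^] k = \<one>" using z(2)[of k] by (simp add: mult.left_commute)
        moreover have "w [^] k = \<one>" using w wq unfolding j by (simp add: nat_pow_pow[symmetric])
        ultimately show "(z \<otimes> w) [^] k = \<one>" using z w by (simp add: nat_pow_distrib)
      qed
      then show ?thesis using z w unfolding primitive_root_of_unity_def by (intro exI[of _ "z \<otimes> w"]) auto
    qed
  qed
qed

lemma (in field) primitive_root_pow_eq:
  assumes z: "primitive_root_of_unity n z" and n: "n > 0"
  shows "z [^] (a::nat) = z [^] (b::nat) \<longleftrightarrow> [a = b] (mod n)"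
proof -
  have zR: "z \<in> carrier R" using z unfolding primitive_root_of_unity_def by blast
  have "z [^] n = \<one>" using z unfolding primitive_root_of_unity_def by simp
  then have z0: "z \<noteq> \<zero>" using n by (metis nat_pow_zero not_gr_zero zero_not_one)
  have aux: "z [^] a = z [^] b \<longleftrightarrow> [a = b] (mod n)" if ab: "a \<le> b" for a b :: nat
  proof -
    obtain k where k: "b = a + k" using le_Suc_ex[OF ab] by blast
    have "z [^] a = z [^] b \<longleftrightarrow> z [^] a \<otimes> z [^] k = z [^] a \<otimes> \<one>"
      using zR unfolding k by (auto simp: nat_pow_mult)
    also have "\<dots> \<longleftrightarrow> z [^] k = \<one>" using zR nat_pow_nonzero[OF zR z0, of a] by (intro m_lcancel) auto
    also have "\<dots> \<longleftrightarrow> n dvd k" using z unfolding primitive_root_of_unity_def by blast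
    also have "\<dots> \<longleftrightarrow> [a = b] (mod n)" unfolding k by (simp add: cong_altdef_nat' cong_sym_eq)
    finally show ?thesis .
  qed
  show ?thesis using aux[of a b] aux[of b a] by (metis cong_sym_eq nat_le_linear)
qed

text \<open>The \<open>n\<close> powers of \<open>z\<close> are distinct, and there are at most
  \<open>n\<close> roots of \<open>X ^ n - 1\<close>.\<close>

lemma (in field) root_of_unity_is_power:
  assumes z: "primitive_root_of_unity n z" and n: "n > 0" and w: "w \<in> carrier R" "w [^] n = \<one>"
  obtains u where "u < n" "w = z [^] (u::nat)"
proof -
  have zR: "z \<in> carrier R" "z [^] n = \<one>" using z unfolding primitive_root_of_unity_def by auto
  have inj: "inj_on (\<lambda>u::nat. z [^] u) {..<n}"
    using primitive_root_pow_eq[OF z n] by (intro inj_onI) (auto simp: cong_def)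
  have "(\<lambda>u::nat. z [^] u) ` {..<n} \<subseteq> {w \<in> carrier R. w [^] n = \<one>}"
  proof (rule image_subsetI)
    fix u :: nat
    have "(z [^] u) [^] n = (z [^] n) [^] u" using zR(1) by (simp add: nat_pow_pow mult.commute)
    then show "z [^] u \<in> {w \<in> carrier R. w [^] n = \<one>}" using zR by simp
  qed
  moreover have "card ((\<lambda>u::nat. z [^] u) ` {..<n}) = n" using card_image[OF inj] by simp
  ultimately have "(\<lambda>u::nat. z [^] u) ` {..<n} = {w \<in> carrier R. w [^] n = \<one>}"
    using card_nth_roots_of_unity[OF n] by (metis card_seteq)
  then show ?thesis using that w by (metis (mono_tags, lifting) imageE lessThan_iff mem_Collect_eq)
qed

text \<open>The last claims express \<open>c\<close> on multiples of \<open>N\<close> through its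
  values at \<open>N\<close> times the unit vectors. Divisibility of those few values thereby
  controls how \<open>c\<close> changes between vectors congruent modulo \<open>N\<close>.\<close>

lemma lattice_additive:
  fixes D :: "(nat \<Rightarrow> int) set" and N :: int and c :: "(nat \<Rightarrow> int) \<Rightarrow> int"
  assumes supp: "\<And>v i. v \<in> D \<Longrightarrow> i \<ge> r \<Longrightarrow> v i = 0"
    and diff: "\<And>v w. v \<in> D \<Longrightarrow> w \<in> D \<Longrightarrow> (\<lambda>i. v i - w i) \<in> D"
    and unit: "\<And>i. i < r \<Longrightarrow> (\<lambda>j. if j = i then N else 0) \<in> D" and ne: "D \<noteq> {}"
    and c: "\<And>v w. v \<in> D \<Longrightarrow> w \<in> D \<Longrightarrow> c (\<lambda>i. v i + w i) = c v + c w"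
  shows "\<And>v q. v \<in> D \<Longrightarrow> c (\<lambda>i. q * v i) = q * c v"
    and "\<And>q. (\<lambda>i. if i < r then N * q i else 0) \<in> D"
    and "\<And>q. c (\<lambda>i. if i < r then N * q i else 0) = (\<Sum>i<r. q i * c (\<lambda>j. if j = i then N else 0))"
proof -
  have zero: "(\<lambda>i. 0) \<in> D" using ne diff by fastforce
  have neg: "(\<lambda>i. - v i) \<in> D" if "v \<in> D" for v using diff[OF zero that] by simp
  have add: "(\<lambda>i. v i + w i) \<in> D" if "v \<in> D" "w \<in> D" for v w using diff[OF that(1) neg[OF that(2)]] by simp
  have c0: "c (\<lambda>i. 0) = 0" using c[OF zero zero] by simp
  have cneg: "c (\<lambda>i. - v i) = - c v" if "v \<in> D" for v using c[OF that neg[OF that]] c0 by simp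
  have nmult: "(\<lambda>i. int n * v i) \<in> D \<and> c (\<lambda>i. int n * v i) = int n * c v" if v: "v \<in> D" for n v
  proof (induct n)
    case (Suc n)
    have "(\<lambda>i. int (Suc n) * v i) = (\<lambda>i. v i + int n * v i)" by (auto simp: algebra_simps)
    then show ?case using add[OF v conjunct1[OF Suc]] c[OF v conjunct1[OF Suc]] Suc
      by (simp add: algebra_simps)
  qed (use zero c0 in simp)
  have mult: "(\<lambda>i. q * v i) \<in> D \<and> c (\<lambda>i. q * v i) = q * c v" if v: "v \<in> D" for q v
  proof (cases "q \<ge> 0")
    case True
    then show ?thesis using nmult[OF v, of "nat q"] by simp
  next
    case False
    then show ?thesis using nmult[OF neg[OF v], of "nat (- q)"] cneg[OF v] by simp
  qed
  show "c (\<lambda>i. q * v i) = q * c v" if "v \<in> D" for v q using mult[OF that] by blast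
  have "(\<lambda>i. if i < s then N * q i else 0) \<in> D \<and>
      c (\<lambda>i. if i < s then N * q i else 0) = (\<Sum>i<s. q i * c (\<lambda>j. if j = i then N else 0))"
    if "s \<le> r" for q s
    using that
  proof (induct s)
    case (Suc s)
    have "(\<lambda>i. if i < Suc s then N * q i else 0)
        = (\<lambda>i. (if i < s then N * q i else 0) + q s * (if i = s then N else 0))"
      by (auto simp: less_Suc_eq)
    moreover have ls: "s < r" "s \<le> r" using Suc.prems by auto
    moreover note m = mult[OF unit[OF ls(1)], of "q s"]
    moreover note IH = Suc.hyps[OF ls(2)]
    ultimately show ?case
      using add[OF conjunct1[OF IH] conjunct1[OF m]] c[OF conjunct1[OF IH] conjunct1[OF m]] by simp
  qed (use zero c0 in simp)
  then show "(\<lambda>i. if i < r then N * q i else 0) \<in> D"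
    "c (\<lambda>i. if i < r then N * q i else 0) = (\<Sum>i<r. q i * c (\<lambda>j. if j = i then N else 0))" for q
    by blast+
qed

lemma (in domain) algebraic_of_pow_mem:
  assumes K: "subring K R" and z: "z \<in> carrier R" "z [^] (n::nat) \<in> K" "n > 0"
  shows "(algebraic over K) z"
proof (rule algebraicI)
  let ?p = "monom \<one> (n - 1) @ [\<ominus> (z [^] n)]"
  show "?p \<in> carrier (K[X])"
  proof -
    have "\<zero> \<in> K" "\<one> \<in> K" "\<ominus> (z [^] n) \<in> K" using subringE(2,3,5)[OF K] z(2) by blast+
    then show ?thesis unfolding monom_def by (auto simp: univ_poly_def polynomial_def)
  qed
  show "?p \<noteq> []" by simp
  have "eval ?p z = z [^] (n - 1) \<otimes> z \<ominus> z [^] n"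
    using eval_append_aux[of "monom \<one> (n - 1)" "\<ominus> (z [^] n)" z] eval_monom[of \<one> z "n - 1"] z
    by (simp add: monom_in_carrier a_minus_def)
  also have "z [^] (n - 1) \<otimes> z = z [^] n" using z nat_pow_Suc[of z "n - 1"] by simp
  finally show "eval ?p z = \<zero>" using z by simp
qed

section \<open>The extension by radicals\<close>

text \<open>\<open>K(\<zeta>)\<close> lies in \<open>F\<close> because \<open>\<zeta>\<close> is in
  \<open>B\<close>, so \<open>bound\<close> applies to every radical found there. The factor
  \<open>d\<close> in \<open>N = n * d\<close> makes up for the loss that \<open>bound\<close>
  permits.\<close>

locale kummer = algebraically_closed L for L :: "('a, 'b) ring_scheme" (structure) +
  fixes K B F :: "'a set" and t \<zeta> :: 'a and N n d r :: nat
  assumes char0: "\<And>n::nat. n > 0 \<Longrightarrow> [n] \<cdot> \<one> \<noteq> \<zero>"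
    and K: "subfield K L" and t: "t \<in> K"
    and B: "subfield B L" "t \<notin> B" "\<zeta> \<in> B"
    and F: "subfield F L" "K \<subseteq> F" "B \<subseteq> F"
    and \<zeta>: "primitive_root_of_unity N \<zeta>"
    and N: "N = n * d" "N > 1"
    and bound: "\<And>(m::nat) u (e::'a \<Rightarrow> nat) S. m > 0 \<Longrightarrow> u \<in> F \<Longrightarrow> finite S \<Longrightarrow> S \<subseteq> B \<Longrightarrow>
        u [^] m = (\<Otimes>\<alpha>\<in>S. (t \<ominus> \<alpha>) [^] e \<alpha>) \<Longrightarrow> (\<forall>\<alpha>\<in>S. m dvd d * e \<alpha>)"
begin

text \<open>For fixed \<open>i\<close> the radicands \<open>t - pt i (\<zeta> ^ a)\<close> with \<open>a \<in> T\<close> are permuted by the Galois group of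
  \<open>K(\<zeta>)/K\<close>; different \<open>i\<close> give disjoint families because the \<open>N\<close>-th power of \<open>pt i (\<zeta> ^ a)\<close> is
  \<open>(i + 1) ^ N\<close>.\<close>

definition pt :: "nat \<Rightarrow> 'a \<Rightarrow> 'a" where "pt i z = ([Suc i] \<cdot> \<one>) \<otimes> z"
definition rt :: "nat \<Rightarrow> 'a \<Rightarrow> 'a" where "rt i z = (SOME y. y \<in> carrier L \<and> y [^] N = t \<ominus> pt i z)"
definition T :: "nat set" where "T = {a. a < N \<and> coprime a N}"
definition ys :: "'a list" where "ys = (SOME ys. set ys = (\<lambda>(i, a). rt i (\<zeta> [^] (a::nat))) ` ({..<r} \<times> T))"
definition K' :: "'a set" where "K' = simple_extension K \<zeta>"
definition M :: "'a set" where "M = finite_extension K' ys"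
definition E :: "('a \<Rightarrow> 'a) set" where "E = field_auts L M K"

lemma
  shows tR: "t \<in> carrier L" and \<zeta>R: "\<zeta> \<in> carrier L" and \<zeta>N: "\<zeta> [^] N = \<one>"
    and \<zeta>pow: "\<zeta> [^] (a::nat) = \<zeta> [^] (b::nat) \<longleftrightarrow> [a = b] (mod N)"
    and \<zeta>p0: "\<zeta> [^] (a::nat) \<noteq> \<zero>" and finT: "finite T" and oneT: "1 \<in> T"
proof -
  show "t \<in> carrier L" using t subringE(1)[OF subfieldE(1)[OF K]] by auto
  show zR: "\<zeta> \<in> carrier L" using \<zeta> unfolding primitive_root_of_unity_def by blast
  show zN: "\<zeta> [^] N = \<one>" using \<zeta> unfolding primitive_root_of_unity_def by simp
  show "\<zeta> [^] (a::nat) = \<zeta> [^] (b::nat) \<longleftrightarrow> [a = b] (mod N)"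
    using primitive_root_pow_eq[OF \<zeta>] N(2) by simp
  have "\<zeta> \<noteq> \<zero>" using zN N(2) by (metis nat_pow_zero not_one_less_zero zero_not_one)
  then show "\<zeta> [^] (a::nat) \<noteq> \<zero>" using nat_pow_nonzero zR by blast
  show "finite T" "1 \<in> T" unfolding T_def using N(2) by auto
qed

lemma int_in_subring:
  assumes "subring S L"
  shows "[(m::nat)] \<cdot> \<one> \<in> S"
  using subringE(2,3,7)[OF assms] by (induct m) auto

lemma pt_B: "pt i (\<zeta> [^] (a::nat)) \<in> B"
  unfolding pt_def
  using int_in_subring[OF subfieldE(1)[OF B(1)]] subring_nat_pow[OF subfieldE(1)[OF B(1)] B(3)]
    subringE(6)[OF subfieldE(1)[OF B(1)]] by blast

lemma pt_R: "z \<in> carrier L \<Longrightarrow> pt i z \<in> carrier L"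
  unfolding pt_def by simp

lemma root_R: "z \<in> carrier L \<Longrightarrow> rt i z \<in> carrier L \<and> rt i z [^] N = t \<ominus> pt i z"
proof -
  assume z: "z \<in> carrier L"
  have "\<exists>y. y \<in> carrier L \<and> y [^] N = t \<ominus> pt i z"
    using exists_nth_root[of "t \<ominus> pt i z" N] N(2) tR pt_R[OF z] by (metis gr0I minus_closed not_one_less_zero)
  then show ?thesis unfolding rt_def by (rule someI_ex)
qed

lemma rt_nonzero: "rt i (\<zeta> [^] (a::nat)) \<noteq> \<zero>"
proof
  assume "rt i (\<zeta> [^] a) = \<zero>"
  then have "t \<ominus> pt i (\<zeta> [^] a) = \<zero>"
    using root_R[of "\<zeta> [^] a" i] \<zeta>R N(2) by (simp add: nat_pow_zero)
  then have "t = pt i (\<zeta> [^] a)" using tR pt_R \<zeta>R by simp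
  then show False using pt_B[of i a] B(2) by simp
qed

lemma set_ys: "set ys = (\<lambda>(i, a). rt i (\<zeta> [^] (a::nat))) ` ({..<r} \<times> T)"
proof -
  have "finite ((\<lambda>(i, a). rt i (\<zeta> [^] (a::nat))) ` ({..<r} \<times> T))" using finT by simp
  then show ?thesis unfolding ys_def using someI_ex[OF finite_list] by blast
qed

lemma mod_T: "coprime a N \<Longrightarrow> a mod N \<in> T"
  unfolding T_def using N(2) by simp

lemma \<zeta>_mod: "\<zeta> [^] (a mod N) = \<zeta> [^] (a::nat)"
  using \<zeta>pow[of "a mod N" a] by (simp add: cong_def)

lemma rt_ys: "i < r \<Longrightarrow> coprime a N \<Longrightarrow> rt i (\<zeta> [^] a) \<in> set ys"
  unfolding set_ys using mod_T[of a] \<zeta>_mod[of a] by (metis (no_types, lifting) case_prod_conv image_eqI lessThan_iff mem_Sigma_iff)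

lemma ys_R: "set ys \<subseteq> carrier L"
  unfolding set_ys using root_R \<zeta>R by auto

lemma K'_props: "subfield K' L" "K \<subseteq> K'" "\<zeta> \<in> K'" "K' \<subseteq> F"
proof -
  note SK = subfieldE(1)[OF K]
  have alg: "(algebraic over K) \<zeta>"
    by (rule algebraic_of_pow_mem[OF SK \<zeta>R, of N]) (use \<zeta>N subringE(3)[OF SK] N(2) in auto)
  show "subfield K' L" unfolding K'_def using simple_extension_is_subfield[OF K \<zeta>R] alg by simp
  show "K \<subseteq> K'" unfolding K'_def using simple_extension_incl[OF subringE(1)[OF SK] \<zeta>R] .
  show "\<zeta> \<in> K'" unfolding K'_def using simple_extension_mem[OF SK \<zeta>R] .
  show "K' \<subseteq> F" unfolding K'_def
    using simple_extension_subring_incl[OF subfieldE(1)[OF F(1)] F(2)] B(3) F(3) by blast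
qed

lemma pt_K': "t \<ominus> pt i (\<zeta> [^] (a::nat)) \<in> K'"
proof -
  note S = subfieldE(1)[OF K'_props(1)]
  have "pt i (\<zeta> [^] a) \<in> K'"
    unfolding pt_def using int_in_subring[OF S] subring_nat_pow[OF S K'_props(3)] subringE(6)[OF S] by blast
  then show ?thesis using t K'_props(2) subringE(5,7)[OF S] unfolding a_minus_def by auto
qed

lemma ys_alg: "x \<in> set ys \<Longrightarrow> (algebraic over K') x"
proof -
  assume "x \<in> set ys"
  then obtain i a where "x = rt i (\<zeta> [^] (a::nat))" unfolding set_ys by auto
  then show ?thesis
    using algebraic_of_pow_mem[OF subfieldE(1)[OF K'_props(1)], of x N] root_R[of "\<zeta> [^] a" i] \<zeta>R pt_K'[of i a] N(2)
    by simp
qed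

lemma M_props: "subfield M L" "K' \<subseteq> M" "set ys \<subseteq> M" "M = finite_extension K (ys @ [\<zeta>])"
proof -
  show "subfield M L" unfolding M_def by (rule finite_extension_is_subfield[OF K'_props(1) ys_R ys_alg])
  show "K' \<subseteq> M" unfolding M_def
    by (rule finite_extension_incl[OF subringE(1)[OF subfieldE(1)[OF K'_props(1)]] ys_R])
  show "set ys \<subseteq> M" unfolding M_def by (rule finite_extension_mem[OF subfieldE(1)[OF K'_props(1)] ys_R])
  show "M = finite_extension K (ys @ [\<zeta>])" unfolding M_def K'_def by simp
qed

lemma KM: "K \<subseteq> M" and \<zeta>M: "\<zeta> \<in> M"
  using K'_props M_props by auto

text \<open>Radicals are algebraic over \<open>K'\<close> by construction; finiteness of
  \<open>K'\<close> over \<open>K\<close> brings this down to \<open>K\<close>, so that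
  \<open>M\<close> can be treated as a single extension of \<open>K\<close>.\<close>

lemma gens_alg: "x \<in> set (ys @ [\<zeta>]) \<Longrightarrow> (algebraic over K) x"
proof -
  assume x: "x \<in> set (ys @ [\<zeta>])"
  note SK = subfieldE(1)[OF K]
  have z: "(algebraic over K) \<zeta>"
    by (rule algebraic_of_pow_mem[OF SK \<zeta>R, of N]) (use \<zeta>N subringE(3)[OF SK] N(2) in auto)
  show ?thesis
  proof (cases "x = \<zeta>")
    case False
    then have xy: "x \<in> set ys" using x by auto
    have fd: "finite_dimension K K'"
      using finite_dimension_simple_extension[OF K \<zeta>R] z unfolding K'_def by simp
    have xR: "x \<in> carrier L" using xy ys_R by auto
    have "finite_dimension K' (simple_extension K' x)"
      using finite_dimension_simple_extension[OF K'_props(1) xR] ys_alg[OF xy] by simp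
    then have "finite_dimension K (simple_extension K' x)"
      using telescopic_base_dim(1)[OF K K'_props(1) fd] by blast
    then show ?thesis
      using finite_dimension_imp_algebraic[OF K simple_extension_is_subring[OF subfieldE(1)[OF K'_props(1)] xR]]
        simple_extension_mem[OF subfieldE(1)[OF K'_props(1)] xR] by blast
  qed (use z in simp)
qed

lemma gens_R: "set (ys @ [\<zeta>]) \<subseteq> carrier L"
  using ys_R \<zeta>R by auto

lemma fd_M: "finite_dimension K M"
  unfolding M_props(4) by (rule finite_extension_finite_dimension(1)[OF K gens_R gens_alg])

text \<open>Embeddings preserve the order of \<open>\<zeta>\<close>: if \<open>j\<close> had a
  common factor with \<open>N\<close>, some power of \<open>\<zeta>\<close> other than
  \<open>\<one>\<close> would be sent to \<open>\<one>\<close>.\<close>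

lemma hom_\<zeta>:
  assumes s: "s \<in> ring_hom (L\<lparr>carrier := M\<rparr>) L"
  obtains j where "coprime j N" "s \<zeta> = \<zeta> [^] (j::nat)"
proof -
  note SM = subfieldE(1)[OF M_props(1)]
  note h = ring_hom_into_subring[OF s]
  have pow: "s (x [^] (k::nat)) = s x [^] k" if "x \<in> M" for x k
    by (rule ring_hom_subring_nat_pow[OF s SM that ring_axioms ring_axioms])
  have "s \<zeta> [^] N = \<one>" using pow[OF \<zeta>M, of N] \<zeta>N h(4) by simp
  then obtain j where j: "j < N" "s \<zeta> = \<zeta> [^] j"
    using root_of_unity_is_power[OF \<zeta>, of "s \<zeta>"] N(2) h(1)[OF \<zeta>M] by auto
  have key: "N dvd k" if k: "N dvd j * k" for k
  proof -
    have "\<zeta> [^] (j * k) = \<one>" using \<zeta> k unfolding primitive_root_of_unity_def by blast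
    then have "s (\<zeta> [^] k) = s \<one>" using pow[OF \<zeta>M, of k] j h(4) \<zeta>R by (simp add: nat_pow_pow)
    then have "\<zeta> [^] k = \<one>"
      using subfield_hom_inj[OF M_props(1) s] subring_nat_pow[OF SM \<zeta>M, of k] subringE(3)[OF SM]
      by (meson inj_onD)
    then show ?thesis using \<zeta> unfolding primitive_root_of_unity_def by blast
  qed
  have "coprime j N"
  proof -
    define g where "g = gcd j N"
    obtain j' N' where d: "j = g * j'" "N = g * N'" unfolding g_def by (meson dvdE gcd_dvd1 gcd_dvd2)
    have "N dvd j * N'" unfolding d by simp
    then have "N dvd N'" by (rule key)
    moreover have "N' > 0" using d N(2) by (metis gr0I mult_0_right not_one_less_zero)
    ultimately have "g * N' \<le> N'" using d by (metis dvd_imp_le)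
    then have "g \<le> 1" using \<open>N' > 0\<close> by simp
    moreover have "g > 0" using N(2) unfolding g_def by simp
    ultimately have "g = 1" by simp
    then show ?thesis unfolding g_def by (rule gcd_eq_1_imp_coprime)
  qed
  then show ?thesis using that j by blast
qed

text \<open>\<open>s\<close> moves the radicands by \<open>a \<mapsto> j * a\<close>. So the image
  of a radical and the chosen radical of the new radicand have the same \<open>N\<close>-th power,
  and their quotient is a root of unity.\<close>

lemma hom_rt:
  assumes s: "s \<in> ring_hom (L\<lparr>carrier := M\<rparr>) L" and sK: "\<And>a. a \<in> K \<Longrightarrow> s a = a"
    and j: "s \<zeta> = \<zeta> [^] (j::nat)" and i: "i < r" and a: "coprime a N"
  obtains u :: nat where "s (rt i (\<zeta> [^] a)) = \<zeta> [^] u \<otimes> rt i (\<zeta> [^] (j * a))"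
proof -
  note SM = subfieldE(1)[OF M_props(1)]
  note h = ring_hom_into_subring[OF s]
  have pow: "s (x [^] (k::nat)) = s x [^] k" if "x \<in> M" for x k
    by (rule ring_hom_subring_nat_pow[OF s SM that ring_axioms ring_axioms])
  have rM: "rt i (\<zeta> [^] a) \<in> M" using rt_ys[OF i a] M_props(3) by auto
  have zaM: "\<zeta> [^] a \<in> M" by (rule subring_nat_pow[OF SM \<zeta>M])
  have cK: "[Suc i] \<cdot> \<one> \<in> K" by (rule int_in_subring[OF subfieldE(1)[OF K]])
  have ptM: "pt i (\<zeta> [^] a) \<in> M" unfolding pt_def using cK KM zaM subringE(6)[OF SM] by auto
  have s_pt: "s (pt i (\<zeta> [^] a)) = pt i (\<zeta> [^] (j * a))"
    unfolding pt_def using h(2)[of "[Suc i] \<cdot> \<one>" "\<zeta> [^] a"] cK KM zaM sK[OF cK] pow[OF \<zeta>M, of a] j \<zeta>R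
    by (auto simp: nat_pow_pow simp del: add.nat_pow_Suc)
  have s_neg: "s (\<ominus> x) = \<ominus> s x" if x: "x \<in> M" for x
  proof -
    have xR: "x \<in> carrier L" "s x \<in> carrier L" "s (\<ominus> x) \<in> carrier L"
      using x h(1) subringE(1,5)[OF SM] by auto
    have "s \<zero> = \<zero>" using sK subringE(2)[OF subfieldE(1)[OF K]] by blast
    then have "s (\<ominus> x) \<oplus> s x = \<zero>"
      using h(3)[of "\<ominus> x" x] x subringE(5)[OF SM] xR by (simp add: l_neg)
    then show ?thesis using minus_equality xR by metis
  qed
  have "s (t \<ominus> pt i (\<zeta> [^] a)) = t \<ominus> pt i (\<zeta> [^] (j * a))"
    unfolding a_minus_def
    using h(3)[of t "\<ominus> pt i (\<zeta> [^] a)"] t KM ptM subringE(5)[OF SM] s_neg[OF ptM] s_pt sK[OF t] by auto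
  then have "s (rt i (\<zeta> [^] a)) [^] N = rt i (\<zeta> [^] (j * a)) [^] N"
    using pow[OF rM, of N] root_R[of "\<zeta> [^] a" i] root_R[of "\<zeta> [^] (j * a)" i] \<zeta>R by simp
  define w where "w = s (rt i (\<zeta> [^] a)) \<otimes> inv (rt i (\<zeta> [^] (j * a)))"
  let ?y = "rt i (\<zeta> [^] (j * a))"
  have yR: "?y \<in> carrier L" "?y \<in> Units L" "inv ?y \<in> carrier L"
    using root_R[of "\<zeta> [^] (j * a)" i] \<zeta>R rt_nonzero[of i "j * a"] field_Units by auto
  have "w [^] N = \<one>"
  proof -
    have "w [^] N = ?y [^] N \<otimes> (inv ?y) [^] N"
      unfolding w_def using yR h(1)[OF rM] \<open>s (rt i (\<zeta> [^] a)) [^] N = _\<close> by (simp add: nat_pow_distrib)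
    also have "\<dots> = \<one>" using yR by (simp add: nat_pow_distrib[symmetric])
    finally show ?thesis .
  qed
  moreover have "w \<in> carrier L" unfolding w_def using yR h(1)[OF rM] by simp
  ultimately obtain u where "w = \<zeta> [^] (u::nat)"
    using root_of_unity_is_power[OF \<zeta>, of w] N(2) by auto
  moreover have "w \<otimes> ?y = s (rt i (\<zeta> [^] a))"
    unfolding w_def using yR h(1)[OF rM] by (simp add: m_assoc)
  ultimately show ?thesis using that by metis
qed

lemma normal:
  assumes s: "s \<in> ring_hom (L\<lparr>carrier := M\<rparr>) L" and sK: "\<And>a. a \<in> K \<Longrightarrow> s a = a"
    and x: "x \<in> set (ys @ [\<zeta>])"
  shows "s x \<in> M"
proof -
  note SM = subfieldE(1)[OF M_props(1)]
  obtain j where j: "coprime j N" "s \<zeta> = \<zeta> [^] (j::nat)" using hom_\<zeta>[OF s] .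
  have zM: "\<zeta> [^] (k::nat) \<in> M" for k by (rule subring_nat_pow[OF SM \<zeta>M])
  show ?thesis
  proof (cases "x = \<zeta>")
    case True
    then show ?thesis using j zM by simp
  next
    case False
    then obtain i a where ia: "x = rt i (\<zeta> [^] a)" "i < r" "a \<in> T" using x unfolding set_append set_ys by auto
    then have ca: "coprime a N" unfolding T_def by simp
    obtain u :: nat where "s x = \<zeta> [^] u \<otimes> rt i (\<zeta> [^] (j * a))"
      using hom_rt[OF s sK j(2) ia(2) ca] ia(1) by auto
    moreover have "rt i (\<zeta> [^] (j * a)) \<in> M" using rt_ys[OF ia(2), of "j * a"] j(1) ca M_props(3) by auto
    ultimately show ?thesis using zM subringE(6)[OF SM] by simp
  qed
qed

lemma E_hom: "s \<in> E \<Longrightarrow> s \<in> ring_hom (L\<lparr>carrier := M\<rparr>) L"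
proof -
  assume "s \<in> E"
  then have "s \<in> ring_hom (L\<lparr>carrier := M\<rparr>) (L\<lparr>carrier := M\<rparr>)" unfolding E_def field_auts_def by simp
  then show ?thesis
    using subringE(1)[OF subfieldE(1)[OF M_props(1)]] ring_hom_memE[of s "L\<lparr>carrier := M\<rparr>" "L\<lparr>carrier := M\<rparr>"]
    by (intro ring_hom_memI) auto
qed

lemma E_fixed: "z \<in> M \<Longrightarrow> (\<And>s. s \<in> E \<Longrightarrow> s z = z) \<Longrightarrow> z \<in> K"
proof (rule ccontr)
  assume z: "z \<in> M" "\<And>s. s \<in> E \<Longrightarrow> s z = z" "z \<notin> K"
  obtain s where "s \<in> field_auts L M K" "s z \<noteq> z"
  proof (rule normal_extension_fixed_field[of K "ys @ [\<zeta>]" M z])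
    show "\<tau> x \<in> M" if "\<tau> \<in> ring_hom (L\<lparr>carrier := M\<rparr>) L" "\<And>a. a \<in> K \<Longrightarrow> \<tau> a = a" "x \<in> set (ys @ [\<zeta>])" for \<tau> x
      using normal that by blast
  qed (assumption | rule char0 K gens_R gens_alg M_props(4) z(1) z(3) | blast)+
  then show False using z(2) unfolding E_def by blast
qed

text \<open>Here \<open>M\<close> is regarded as an extension of \<open>K'\<close> generated by the
  radicals alone; its automorphisms over \<open>K'\<close> are elements of \<open>E\<close> that fix
  \<open>\<zeta>\<close>. This is the criterion for a product of radicals to lie in
  \<open>K(\<zeta>)\<close>.\<close>

lemma E1_fixed:
  assumes z: "z \<in> M" and fixed: "\<And>s. s \<in> E \<Longrightarrow> s \<zeta> = \<zeta> \<Longrightarrow> s z = z"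
  shows "z \<in> K'"
proof (rule ccontr)
  assume "z \<notin> K'"
  obtain s where s: "s \<in> field_auts L M K'" "s z \<noteq> z"
  proof (rule normal_extension_fixed_field[of K' ys M z])
    show "\<tau> x \<in> M" if "\<tau> \<in> ring_hom (L\<lparr>carrier := M\<rparr>) L" "\<And>a. a \<in> K' \<Longrightarrow> \<tau> a = a" "x \<in> set ys" for \<tau> x
      using normal[of \<tau> x] that K'_props(2) by auto
  qed (assumption | rule char0 K'_props(1) ys_R ys_alg M_def z \<open>z \<notin> K'\<close> | blast)+
  then have "s \<in> E" unfolding E_def field_auts_def using K'_props(2) by auto
  moreover have "s \<zeta> = \<zeta>" using field_autsD(4)[OF s(1) K'_props(3)] .
  ultimately show False using fixed s(2) by blast
qed

end

lemma mod_units_bij: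
  fixes N j :: nat
  assumes "coprime j N" "N > 1"
  shows "bij_betw (\<lambda>a. j * a mod N) {a. a < N \<and> coprime a N} {a. a < N \<and> coprime a N}"
proof -
  let ?T = "{a. a < N \<and> coprime a N}"
  have "inj_on (\<lambda>a. j * a mod N) ?T"
  proof (rule inj_onI)
    fix a b assume "a \<in> ?T" "b \<in> ?T" "j * a mod N = j * b mod N"
    then have "[j * a = j * b] (mod N)" "a < N" "b < N" by (auto simp: cong_def)
    then show "a = b" using assms(1) by (simp add: cong_mult_lcancel_nat cong_less_modulus_unique_nat)
  qed
  moreover have "(\<lambda>a. j * a mod N) ` ?T \<subseteq> ?T" using assms by auto
  ultimately show ?thesis unfolding bij_betw_def by (simp add: endo_inj_surj)
qed

section \<open>Cyclotomic character and Kummer cocycle\<close>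

context kummer
begin

lemma E_subgroup: "subgroup E (BijGroup M)"
  unfolding E_def by (rule subgroup_field_auts[OF subfieldE(1)[OF M_props(1)] KM])

lemma E_comp:
  assumes "s \<in> E" "s' \<in> E"
  shows "compose M s s' \<in> E"
proof -
  have "s \<in> Bij M" "s' \<in> Bij M" using assms field_autsD(1) unfolding E_def by blast+
  then have "s \<otimes>\<^bsub>BijGroup M\<^esub> s' = compose M s s'" by (simp add: BijGroup_def)
  then show ?thesis using subgroup.m_closed[OF E_subgroup assms] by simp
qed

lemma E_eqI:
  assumes s: "s \<in> E" "s' \<in> E" and eq: "\<And>x. x \<in> set (ys @ [\<zeta>]) \<Longrightarrow> s x = s' x"
  shows "s = s'"
proof -
  note D = field_autsD[OF s(1)[unfolded E_def]] and D' = field_autsD[OF s(2)[unfolded E_def]]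
  note SM = subfieldE(1)[OF M_props(1)]
  have MR: "M \<subseteq> carrier L" using subringE(1)[OF SM] .
  have neg: "u (\<ominus> x) = \<ominus> u x" if u: "u \<in> E" and x: "x \<in> M" for u x
  proof -
    note Du = field_autsD[OF u[unfolded E_def]]
    have xR: "x \<in> carrier L" "u x \<in> carrier L" "u (\<ominus> x) \<in> carrier L" "\<ominus> x \<in> M"
      using x Du(3) MR subringE(5)[OF SM] by auto
    have "u \<zero> = \<zero>" using Du(4) subringE(2)[OF subfieldE(1)[OF K]] by blast
    then have "u (\<ominus> x) \<oplus> u x = \<zero>"
      using Du(6)[OF xR(4) x] xR by (simp add: l_neg)
    then show ?thesis using minus_equality[OF _ xR(2,3)] by simp
  qed
  have "subring {x \<in> M. s x = s' x} L"
  proof (rule subringI)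
    show "{x \<in> M. s x = s' x} \<subseteq> carrier L" using MR by auto
    show "\<one> \<in> {x \<in> M. s x = s' x}" using D(7) D'(7) subringE(3)[OF SM] by simp
    show "\<ominus> x \<in> {x \<in> M. s x = s' x}" if "x \<in> {x \<in> M. s x = s' x}" for x
      using that neg[OF s(1), of x] neg[OF s(2), of x] subringE(5)[OF SM, of x] by simp
    show "x \<otimes> y \<in> {x \<in> M. s x = s' x}" "x \<oplus> y \<in> {x \<in> M. s x = s' x}"
      if "x \<in> {x \<in> M. s x = s' x}" "y \<in> {x \<in> M. s x = s' x}" for x y
      using that D(5,6)[of x y] D'(5,6)[of x y] subringE(6,7)[OF SM, of x y] by auto
  qed
  moreover have "K \<subseteq> {x \<in> M. s x = s' x}" using KM D(4) D'(4) by auto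
  moreover have "set (ys @ [\<zeta>]) \<subseteq> {x \<in> M. s x = s' x}" using eq M_props(3) \<zeta>M by auto
  ultimately have "M \<subseteq> {x \<in> M. s x = s' x}"
    unfolding M_props(4) by (rule finite_extension_subring_incl)
  then show ?thesis using D(2) D'(2) by (intro extensionalityI[of s M s']) auto
qed

text \<open>\<open>J\<close> is the cyclotomic character and \<open>U\<close> the Kummer cocycle. Weighting the cocycle by \<open>e a\<close>, the
  inverse of \<open>a\<close> modulo \<open>N\<close>, turns it into the homomorphism \<open>W\<close>.\<close>

definition J :: "('a \<Rightarrow> 'a) \<Rightarrow> nat" where "J s = (SOME j. coprime j N \<and> s \<zeta> = \<zeta> [^] j)"
definition U :: "('a \<Rightarrow> 'a) \<Rightarrow> nat \<Rightarrow> nat \<Rightarrow> nat" where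
  "U s i a = (SOME u. s (rt i (\<zeta> [^] a)) = \<zeta> [^] u \<otimes> rt i (\<zeta> [^] (J s * a)))"
definition e :: "nat \<Rightarrow> nat" where "e a = a ^ (totient N - 1)"
definition W :: "('a \<Rightarrow> 'a) \<Rightarrow> nat \<Rightarrow> nat" where "W s i = (\<Sum>a\<in>T. e (J s * a) * U s i a)"

lemma J: "s \<in> E \<Longrightarrow> coprime (J s) N" "s \<in> E \<Longrightarrow> s \<zeta> = \<zeta> [^] J s"
proof -
  assume "s \<in> E"
  then have "\<exists>j. coprime j N \<and> s \<zeta> = \<zeta> [^] (j::nat)" using hom_\<zeta>[OF E_hom] by metis
  from someI_ex[OF this] show "coprime (J s) N" "s \<zeta> = \<zeta> [^] J s" unfolding J_def by auto
qed

lemma U: "s (rt i (\<zeta> [^] a)) = \<zeta> [^] U s i a \<otimes> rt i (\<zeta> [^] (J s * a))"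
  if s: "s \<in> E" and i: "i < r" and a: "coprime a N" for a
proof -
  have "\<exists>u::nat. s (rt i (\<zeta> [^] a)) = \<zeta> [^] u \<otimes> rt i (\<zeta> [^] (J s * a))"
    using hom_rt[OF E_hom[OF s] _ J(2)[OF s] i a] field_autsD(4) s unfolding E_def by metis
  from someI_ex[OF this] show ?thesis unfolding U_def .
qed

lemma \<zeta>_rt_cancel:
  assumes "\<zeta> [^] (u::nat) \<otimes> rt i (\<zeta> [^] (a::nat)) = \<zeta> [^] (v::nat) \<otimes> rt i (\<zeta> [^] a)"
  shows "[u = v] (mod N)"
  using assms m_rcancel[OF rt_nonzero[of i a]] root_R[of "\<zeta> [^] a" i] \<zeta>R \<zeta>pow by simp

text \<open>An automorphism is determined by its values on the generators, and each generator has
  finitely many possible images.\<close>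

lemma E_finite: "finite E"
proof -
  define V where "V = (\<lambda>u::nat. \<zeta> [^] u) ` {..<N} \<union> (\<lambda>(u::nat, y). \<zeta> [^] u \<otimes> y) ` ({..<N} \<times> set ys)"
  let ?X = "set (ys @ [\<zeta>])"
  have N0: "N > 0" using N(2) by simp
  have val: "s x \<in> V" if s: "s \<in> E" and x: "x \<in> ?X" for s x
  proof (cases "x = \<zeta>")
    case True
    then have "s x = \<zeta> [^] (J s mod N)" using J(2)[OF s] \<zeta>_mod by simp
    then show ?thesis using N0 unfolding V_def by auto
  next
    case False
    then obtain i a where ia: "x = rt i (\<zeta> [^] a)" "i < r" "a \<in> T" using x unfolding set_append set_ys by auto
    then have ca: "coprime a N" unfolding T_def by simp
    have "s x = \<zeta> [^] (U s i a mod N) \<otimes> rt i (\<zeta> [^] (J s * a))"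
      using U[OF s ia(2) ca] ia(1) \<zeta>_mod by simp
    moreover have "rt i (\<zeta> [^] (J s * a)) \<in> set ys"
      using rt_ys[OF ia(2), of "J s * a"] J(1)[OF s] ca by simp
    ultimately show ?thesis using N0 unfolding V_def by auto
  qed
  have "inj_on (\<lambda>s. restrict s ?X) E"
  proof (rule inj_onI)
    fix s s' assume "s \<in> E" "s' \<in> E" "restrict s ?X = restrict s' ?X"
    then show "s = s'" using E_eqI by (metis restrict_apply')
  qed
  moreover have "(\<lambda>s. restrict s ?X) ` E \<subseteq> ?X \<rightarrow>\<^sub>E V"
    using val by (intro image_subsetI) (simp only: restrict_PiE_iff ball_simps, blast)
  moreover have "finite (?X \<rightarrow>\<^sub>E V)" by (rule finite_PiE) (auto simp: V_def)
  ultimately show ?thesis by (meson finite_imageD finite_subset)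
qed

text \<open>Taking the inverse of \<open>a\<close> in the form of a power of \<open>a\<close> makes
  \<open>e\<close> multiplicative as a function, not merely modulo \<open>N\<close>, and gives
  \<open>e 1 = 1\<close>.\<close>

lemma e_mult: "e (a * b) = e a * e b"
  unfolding e_def by (simp add: power_mult_distrib)

lemma e_cong: "[a = b] (mod N) \<Longrightarrow> [e a = e b] (mod N)"
  unfolding e_def by (rule cong_pow)

lemma e_inverse: "coprime a N \<Longrightarrow> [e a * a = 1] (mod N)"
proof -
  assume a: "coprime a N"
  have "totient N > 0" using N(2) by simp
  then have "e a * a = a ^ totient N" unfolding e_def by (metis Suc_diff_1 power_Suc2)
  then show ?thesis using euler_theorem[OF a] by simp
qed

text \<open>Multiplication by a unit permutes the units modulo \<open>N\<close>. The products
  \<open>j * a\<close> are not reduced, so the summand has to respect congruence.\<close>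

lemma sum_T_reindex:
  assumes j: "coprime j N" and f: "\<And>a b. coprime a N \<Longrightarrow> [a = b] (mod N) \<Longrightarrow> [f a = (f b :: nat)] (mod N)"
  shows "[(\<Sum>a\<in>T. f (j * a)) = (\<Sum>a\<in>T. f a)] (mod N)"
proof -
  have "[(\<Sum>a\<in>T. f (j * a)) = (\<Sum>a\<in>T. f (j * a mod N))] (mod N)"
  proof (rule cong_sum)
    fix a assume "a \<in> T"
    then have "coprime (j * a) N" using j unfolding T_def by simp
    then show "[f (j * a) = f (j * a mod N)] (mod N)" by (rule f) (simp add: cong_def)
  qed
  also have "(\<Sum>a\<in>T. f (j * a mod N)) = (\<Sum>a\<in>T. f a)"
    using sum.reindex_bij_betw[OF mod_units_bij[OF j N(2)], of f] unfolding T_def by simp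
  finally show ?thesis .
qed

text \<open>\<open>U\<close> is chosen for the exponent \<open>a\<close> rather than for the element
  \<open>\<zeta> ^ a\<close>, so congruent exponents give values that agree only modulo
  \<open>N\<close>.\<close>

lemma U_cong:
  assumes s: "s \<in> E" and i: "i < r" and a: "coprime a N" and ab: "[a = b] (mod N)"
  shows "[U s i a = U s i b] (mod N)"
proof -
  have b: "coprime b N" using a ab by (metis cong_imp_coprime)
  have "\<zeta> [^] a = \<zeta> [^] b" "\<zeta> [^] (J s * a) = \<zeta> [^] (J s * b)"
    using ab \<zeta>pow by (auto intro: cong_scalar_left)
  then show ?thesis
    using U[OF s i a] U[OF s i b] \<zeta>_rt_cancel[of "U s i a" i "J s * b" "U s i b"] by simp
qed

text \<open>\<open>U\<close> satisfies the cocycle rule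
  \<open>U (s s') a = J s * U s' a + U s (J s' * a)\<close>, and the weight of the composite splits
  as \<open>e (J s) * e (J s' * a)\<close>. In the first term \<open>e (J s)\<close> cancels
  \<open>J s\<close>, which leaves \<open>W s'\<close>; in the second the substitution
  \<open>a \<mapsto> J s' * a\<close> produces \<open>W s\<close>. All this holds modulo
  \<open>N\<close>, since \<open>J\<close> and \<open>U\<close> are merely chosen exponents of
  \<open>\<zeta>\<close>.\<close>

lemma comp:
  assumes s: "s \<in> E" and s': "s' \<in> E"
  shows J_comp: "[J (compose M s s') = J s * J s'] (mod N)"
    and W_comp: "i < r \<Longrightarrow> [W (compose M s s') i = W s i + W s' i] (mod N)"
proof -
  note D = field_autsD[OF s[unfolded E_def]] and D' = field_autsD[OF s'[unfolded E_def]]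
  note SM = subfieldE(1)[OF M_props(1)]
  note c = E_comp[OF s s']
  have pow: "s (\<zeta> [^] (k::nat)) = \<zeta> [^] (J s * k)" for k
    using ring_hom_subring_nat_pow[OF E_hom[OF s] SM \<zeta>M ring_axioms ring_axioms, of k] J(2)[OF s] \<zeta>R
    by (simp add: nat_pow_pow)
  have "compose M s s' \<zeta> = \<zeta> [^] (J s * J s')"
    using \<zeta>M J(2)[OF s'] pow by (simp add: compose_def)
  then show Jc: "[J (compose M s s') = J s * J s'] (mod N)" using J(2)[OF c] \<zeta>pow by simp
  assume i: "i < r"
  have Uc: "[U (compose M s s') i a = J s * U s' i a + U s i (J s' * a)] (mod N)" if a: "coprime a N" for a
  proof -
    have ca: "coprime (J s' * a) N" using a J(1)[OF s'] by simp
    have m: "rt i (\<zeta> [^] a) \<in> M" "rt i (\<zeta> [^] (J s' * a)) \<in> M"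
      using rt_ys[OF i a] rt_ys[OF i ca] M_props(3) by auto
    have zM: "\<zeta> [^] U s' i a \<in> M" by (rule subring_nat_pow[OF SM \<zeta>M])
    have "\<zeta> [^] (J (compose M s s') * a) = \<zeta> [^] (J s * (J s' * a))"
      using cong_scalar_right[OF Jc, of a] \<zeta>pow by (simp add: mult.assoc)
    then have "\<zeta> [^] U (compose M s s') i a \<otimes> rt i (\<zeta> [^] (J s * (J s' * a))) = compose M s s' (rt i (\<zeta> [^] a))"
      using U[OF c i a] by simp
    also have "\<dots> = s (\<zeta> [^] U s' i a \<otimes> rt i (\<zeta> [^] (J s' * a)))"
      using m U[OF s' i a] by (simp add: compose_def)
    also have "\<dots> = \<zeta> [^] (J s * U s' i a) \<otimes> (\<zeta> [^] U s i (J s' * a) \<otimes> rt i (\<zeta> [^] (J s * (J s' * a))))"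
      using D(5)[OF zM m(2)] pow U[OF s i ca] by simp
    also have "\<dots> = \<zeta> [^] (J s * U s' i a + U s i (J s' * a)) \<otimes> rt i (\<zeta> [^] (J s * (J s' * a)))"
      using \<zeta>R root_R[of "\<zeta> [^] (J s * (J s' * a))" i] by (simp add: nat_pow_mult[symmetric] m_assoc)
    finally show ?thesis by (rule \<zeta>_rt_cancel)
  qed
  have "[W (compose M s s') i = (\<Sum>a\<in>T. e (J s' * a) * U s' i a + e (J s * (J s' * a)) * U s i (J s' * a))] (mod N)"
    unfolding W_def
  proof (rule cong_sum)
    fix a assume "a \<in> T"
    then have a: "coprime a N" unfolding T_def by simp
    have "[e (J (compose M s s') * a) * U (compose M s s') i a
        = e (J s * J s' * a) * (J s * U s' i a + U s i (J s' * a))] (mod N)"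
      by (rule cong_mult[OF e_cong[OF cong_scalar_right[OF Jc]] Uc[OF a]])
    also have "e (J s * J s' * a) * (J s * U s' i a + U s i (J s' * a))
        = (e (J s) * J s) * (e (J s' * a) * U s' i a) + e (J s * (J s' * a)) * U s i (J s' * a)"
      by (simp add: e_mult algebra_simps)
    also have "[\<dots> = 1 * (e (J s' * a) * U s' i a) + e (J s * (J s' * a)) * U s i (J s' * a)] (mod N)"
      by (intro cong_add cong_mult e_inverse J(1) s cong_refl)
    finally show "[e (J (compose M s s') * a) * U (compose M s s') i a
        = e (J s' * a) * U s' i a + e (J s * (J s' * a)) * U s i (J s' * a)] (mod N)" by simp
  qed
  also have "(\<Sum>a\<in>T. e (J s' * a) * U s' i a + e (J s * (J s' * a)) * U s i (J s' * a))
      = W s' i + (\<Sum>a\<in>T. e (J s * (J s' * a)) * U s i (J s' * a))"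
    unfolding W_def by (simp add: sum.distrib)
  also have "[\<dots> = W s' i + W s i] (mod N)"
  proof (rule cong_add[OF cong_refl])
    show "[(\<Sum>a\<in>T. e (J s * (J s' * a)) * U s i (J s' * a)) = W s i] (mod N)"
      unfolding W_def
      by (rule sum_T_reindex[OF J(1)[OF s'], of "\<lambda>a. e (J s * a) * U s i a"])
        (intro cong_mult e_cong cong_scalar_left U_cong[OF s i])
  qed
  finally show "[W (compose M s s') i = W s i + W s' i] (mod N)" by (simp add: add.commute)
qed

section \<open>From characters to a quotient\<close>

text \<open>The preimage in \<open>\<int>\<^sup>r\<close> of the image of \<open>W\<close> in
  \<open>(\<int>/N)\<^sup>r\<close>. Unlike that image it is free, so it has coordinates.\<close>

definition lattice :: "(nat \<Rightarrow> int) set" where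
  "lattice = {v. (\<forall>i\<ge>r. v i = 0) \<and> (\<exists>s\<in>E. \<forall>i<r. [v i = int (W s i)] (mod int N))}"

text \<open>\<open>W_comp\<close> is applied to the factorization of \<open>s\<close> into
  \<open>s''\<close> and \<open>s'\<close>, which avoids computing \<open>W\<close> at an
  inverse.\<close>

lemma W_inverse_diff:
  assumes "s \<in> E" "s' \<in> E"
  shows "\<exists>s''\<in>E. \<forall>i<r. [int (W s'' i) = int (W s i) - int (W s' i)] (mod int N)"
proof -
  interpret G: group "BijGroup M" by (rule group_BijGroup)
  interpret EG: subgroup E "BijGroup M" by (rule E_subgroup)
  define s'' where "s'' = s \<otimes>\<^bsub>BijGroup M\<^esub> inv\<^bsub>BijGroup M\<^esub> s'"
  have s'': "s'' \<in> E" unfolding s''_def using assms EG.m_closed EG.m_inv_closed by blast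
  have "s'' \<otimes>\<^bsub>BijGroup M\<^esub> s' = s"
    unfolding s''_def using assms EG.subset G.m_assoc by (auto simp: subset_iff)
  moreover have "s'' \<otimes>\<^bsub>BijGroup M\<^esub> s' = compose M s'' s'"
    using s'' assms(2) field_autsD(1) unfolding E_def by (auto simp: BijGroup_def)
  ultimately have eq: "compose M s'' s' = s" by simp
  have "[int (W s'' i) = int (W s i) - int (W s' i)] (mod int N)" if "i < r" for i
  proof -
    have "[int (W s i) = int (W s'' i + W s' i)] (mod int N)"
      using W_comp[OF s'' assms(2) that] unfolding eq cong_int_iff .
    then have "[int (W s i) - int (W s' i) = int (W s'' i + W s' i) - int (W s' i)] (mod int N)"
      by (rule cong_diff[OF _ cong_refl])
    then show ?thesis by (simp add: cong_sym_eq)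
  qed
  then show ?thesis using s'' by blast
qed

lemma E_nonempty: "E \<noteq> {}"
  using subgroup.one_closed[OF E_subgroup] by blast

lemma lattice_props:
  shows "\<And>v i. v \<in> lattice \<Longrightarrow> i \<ge> r \<Longrightarrow> v i = 0"
    and "\<And>v w. v \<in> lattice \<Longrightarrow> w \<in> lattice \<Longrightarrow> (\<lambda>i. v i - w i) \<in> lattice"
    and "\<And>i. i < r \<Longrightarrow> (\<lambda>j. if j = i then int N else 0) \<in> lattice" and "lattice \<noteq> {}"
    and W_lattice: "\<And>s. s \<in> E \<Longrightarrow> (\<lambda>i. if i < r then int (W s i) else 0) \<in> lattice"
proof -
  show "v i = 0" if "v \<in> lattice" "i \<ge> r" for v i using that unfolding lattice_def by simp
  show W: "(\<lambda>i. if i < r then int (W s i) else 0) \<in> lattice" if "s \<in> E" for s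
    using that unfolding lattice_def by (auto intro!: bexI[of _ s])
  then show "lattice \<noteq> {}" using E_nonempty by blast
  show "(\<lambda>i. v i - w i) \<in> lattice" if v: "v \<in> lattice" and w: "w \<in> lattice" for v w
  proof -
    obtain s s' where s: "s \<in> E" "\<And>i. i < r \<Longrightarrow> [v i = int (W s i)] (mod int N)"
      "s' \<in> E" "\<And>i. i < r \<Longrightarrow> [w i = int (W s' i)] (mod int N)"
      using v w unfolding lattice_def by blast
    obtain s'' where s'': "s'' \<in> E" "\<And>i. i < r \<Longrightarrow> [int (W s'' i) = int (W s i) - int (W s' i)] (mod int N)"
      using W_inverse_diff[OF s(1,3)] by blast
    have "[v i - w i = int (W s'' i)] (mod int N)" if "i < r" for i
      using cong_trans[OF cong_diff[OF s(2)[OF that] s(4)[OF that]] cong_sym[OF s''(2)[OF that]]] .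
    then show ?thesis using v w s''(1) unfolding lattice_def by auto
  qed
  show "(\<lambda>j. if j = i then int N else 0) \<in> lattice" if "i < r" for i
  proof -
    obtain s where s: "s \<in> E" using E_nonempty by blast
    obtain s'' where s'': "s'' \<in> E" "\<And>i. i < r \<Longrightarrow> [int (W s'' i) = int (W s i) - int (W s i)] (mod int N)"
      using W_inverse_diff[OF s s] by blast
    have "[(if j = i then int N else 0) = int (W s'' j)] (mod int N)" if "j < r" for j
      using s''(2)[OF that] by (auto simp: cong_def)
    then have "\<forall>j<r. [(if j = i then int N else 0) = int (W s'' j)] (mod int N)" by blast
    moreover have "\<forall>j\<ge>r. (if j = i then int N else 0) = 0" using that by simp
    ultimately show ?thesis using s''(1) unfolding lattice_def by blast
  qed
qed

lemma pt_inj: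
  assumes "pt i (\<zeta> [^] (a::nat)) = pt i' (\<zeta> [^] (b::nat))"
  shows "i = i' \<and> [a = b] (mod N)"
proof -
  have int_inj: "m = k" if eq: "[m] \<cdot> \<one> = [k] \<cdot> \<one>" for m k :: nat
  proof -
    have aux: "m = k" if km: "k \<le> m" "[m] \<cdot> \<one> = [k] \<cdot> \<one>" for m k :: nat
    proof (rule ccontr)
      assume "m \<noteq> k"
      then obtain l where l: "m = k + l" "l > 0" using km(1) by (metis add_0_right gr0I le_Suc_ex)
      then have "[k] \<cdot> \<one> \<oplus> [l] \<cdot> \<one> = [k] \<cdot> \<one>" using km(2) by (simp add: add.nat_pow_mult)
      then show False using char0[OF l(2)] by simp
    qed
    show "m = k" using aux[of k m] aux[of m k] eq by (metis nat_le_linear)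
  qed
  have int_pow: "(add_pow L m \<one>) [^] k = add_pow L (m ^ k) \<one>" for m k :: nat
  proof (induct k)
    case (Suc k)
    have "(add_pow L m \<one>) [^] Suc k = add_pow L (m ^ k) \<one> \<otimes> add_pow L m \<one>" using Suc by simp
    also have "\<dots> = add_pow L m (add_pow L (m ^ k) \<one>)" using add_pow_rdistr[of "add_pow L (m ^ k) \<one>" \<one> m] by simp
    also have "\<dots> = add_pow L (m ^ Suc k) \<one>" by (simp add: add.nat_pow_pow mult.commute)
    finally show ?case .
  qed simp
  have zN: "(\<zeta> [^] (k::nat)) [^] N = \<one>" for k
  proof -
    have "(\<zeta> [^] k) [^] N = (\<zeta> [^] N) [^] k" using \<zeta>R by (simp add: nat_pow_pow mult.commute)
    then show ?thesis using \<zeta>N by simp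
  qed
  have ptN: "pt i (\<zeta> [^] (k::nat)) [^] N = add_pow L (Suc i ^ N) \<one>" for i k
    unfolding pt_def using zN[of k] \<zeta>R int_pow[of "Suc i" N] by (simp add: nat_pow_distrib del: add.nat_pow_Suc)
  have "Suc i ^ N = Suc i' ^ N" using ptN[of i a] ptN[of i' b] assms int_inj by metis
  then have "Suc i = Suc i'" using N(2) by (metis power_inject_base neq0_conv not_one_less_zero power_eq_iff_eq_base zero_le)
  then have ii: "i = i'" by simp
  have "[Suc i] \<cdot> \<one> \<noteq> \<zero>" using char0[of "Suc i"] by simp
  then have "\<zeta> [^] a = \<zeta> [^] b"
    using assms m_lcancel[of "[Suc i] \<cdot> \<one>" "\<zeta> [^] a" "\<zeta> [^] b"] \<zeta>R unfolding ii pt_def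
    by (simp del: add.nat_pow_Suc)
  then show ?thesis using ii \<zeta>pow by simp
qed

text \<open>A character \<open>m\<close> that vanishes on the image of \<open>W\<close> yields the radical \<open>\<Prod>\<^sub>i x\<^sub>i ^ m\<^sub>i\<close> in \<open>K(\<zeta>)\<close>,
  where \<open>x\<^sub>i = \<Prod>\<^sub>a (rt i \<zeta>\<^sup>a) ^ (e a)\<close> is twisted so that the Galois group of \<open>K(\<zeta>)/K\<close> acts on its class by the
  cyclotomic character; the bound on radicals then forces \<open>n\<close> to divide \<open>m\<close>.\<close>

lemma annihilator_divisible:
  fixes m :: "nat \<Rightarrow> nat"
  assumes m: "\<And>s. s \<in> E \<Longrightarrow> N dvd (\<Sum>i<r. m i * W s i)" and i0: "i0 < r"
  shows "n dvd m i0"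
proof -
  define I where "I = {..<r} \<times> T"
  define y where "y = (\<lambda>(i, a). rt i (\<zeta> [^] (a::nat)))"
  define h where "h = (\<lambda>(i, a). e a * m i)"
  define x where "x = (\<Otimes>p\<in>I. y p [^] (h p :: nat))"
  note SM = subfieldE(1)[OF M_props(1)]
  have finI: "finite I" unfolding I_def using finT by simp
  have I: "i < r" "coprime a N" if "(i, a) \<in> I" for i a using that unfolding I_def T_def by auto
  have yM: "y p \<in> M" if "p \<in> I" for p
    using that rt_ys[OF I] M_props(3) unfolding y_def by (cases p) auto
  have MR: "M \<subseteq> carrier L" using subringE(1)[OF SM] .
  have yhM: "y p [^] h p \<in> M" if "p \<in> I" for p by (rule subring_nat_pow[OF SM yM[OF that]])
  have xM: "x \<in> M" unfolding x_def by (rule subring_finprod[OF SM]) (use yhM in auto)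
  have "x \<in> K'"
  proof (rule E1_fixed[OF xM])
    fix s assume s: "s \<in> E" "s \<zeta> = \<zeta>"
    \<comment> \<open>An automorphism fixing \<open>\<zeta>\<close> has trivial cyclotomic
      character, so \<open>U s\<close> is an ordinary Kummer character and \<open>s\<close>
      multiplies \<open>x\<close> by \<open>\<zeta>\<close> to a power congruent to the sum of the
      \<open>m i * W s i\<close>.\<close>
    have Js: "[J s = 1] (mod N)" using J(2)[OF s(1)] s(2) \<zeta>pow[of "J s" 1] \<zeta>R by simp
    have sy: "s (y p) = \<zeta> [^] U s (fst p) (snd p) \<otimes> y p" if p: "p \<in> I" for p
    proof -
      obtain i a where ia: "p = (i, a)" by fastforce
      have "\<zeta> [^] (J s * a) = \<zeta> [^] a" using cong_scalar_right[OF Js, of a] \<zeta>pow by simp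
      then show ?thesis using U[OF s(1) I[OF p[unfolded ia]]] unfolding ia y_def by simp
    qed
    have "s x = (\<Otimes>p\<in>I. s (y p [^] h p))"
      unfolding x_def
      by (rule ring_hom_subring_finprod[OF E_hom[OF s(1)] SM]) (use yhM is_cring in auto)
    also have "\<dots> = (\<Otimes>p\<in>I. \<zeta> [^] (U s (fst p) (snd p) * h p) \<otimes> y p [^] h p)"
    proof (rule finprod_cong')
      show "(\<lambda>p. \<zeta> [^] (U s (fst p) (snd p) * h p) \<otimes> y p [^] h p) \<in> I \<rightarrow> carrier L"
        using yhM MR \<zeta>R by auto
      fix p assume p: "p \<in> I"
      have "s (y p [^] h p) = s (y p) [^] h p"
        by (rule ring_hom_subring_nat_pow[OF E_hom[OF s(1)] SM yM[OF p] ring_axioms ring_axioms])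
      then show "s (y p [^] h p) = \<zeta> [^] (U s (fst p) (snd p) * h p) \<otimes> y p [^] h p"
        using sy[OF p] yM[OF p] MR \<zeta>R by (auto simp: nat_pow_distrib nat_pow_pow)
    qed simp
    also have "\<dots> = (\<Otimes>p\<in>I. \<zeta> [^] (U s (fst p) (snd p) * h p)) \<otimes> x"
      unfolding x_def by (rule finprod_multf) (use yhM MR \<zeta>R in auto)
    also have "(\<Otimes>p\<in>I. \<zeta> [^] (U s (fst p) (snd p) * h p)) = \<zeta> [^] (\<Sum>p\<in>I. U s (fst p) (snd p) * h p)"
    proof -
      have pow_sum: "(\<Otimes>p\<in>A. \<zeta> [^] (g p :: nat)) = \<zeta> [^] (\<Sum>p\<in>A. g p)" if "finite A" for A and g :: "nat \<times> nat \<Rightarrow> nat"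
        using that
      proof (induct A rule: finite_induct)
        case (insert p A)
        have "(\<Otimes>p\<in>insert p A. \<zeta> [^] g p) = \<zeta> [^] g p \<otimes> (\<Otimes>p\<in>A. \<zeta> [^] g p)"
          by (rule finprod_insert) (use insert \<zeta>R in auto)
        then show ?case using insert \<zeta>R by (simp add: nat_pow_mult)
      qed simp
      show ?thesis by (rule pow_sum[OF finI])
    qed
    also have "\<dots> = \<one>"
    proof -
      have "(\<Sum>p\<in>I. U s (fst p) (snd p) * h p) = (\<Sum>i<r. \<Sum>a\<in>T. U s i a * (e a * m i))"
        unfolding I_def h_def by (simp add: sum.cartesian_product case_prod_beta)
      also have "\<dots> = (\<Sum>i<r. m i * (\<Sum>a\<in>T. e a * U s i a))"
        by (simp add: sum_distrib_left ac_simps)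
      also have "[\<dots> = (\<Sum>i<r. m i * W s i)] (mod N)"
        unfolding W_def
      proof (intro cong_sum cong_scalar_left cong_scalar_right)
        fix i a
        show "[e a = e (J s * a)] (mod N)"
          by (rule e_cong) (use cong_scalar_right[OF Js, of a] in \<open>simp add: cong_sym_eq\<close>)
      qed
      finally have "N dvd (\<Sum>p\<in>I. U s (fst p) (snd p) * h p)" using m[OF s(1)] by (simp add: cong_dvd_iff)
      then show ?thesis using \<zeta> unfolding primitive_root_of_unity_def by blast
    qed
    finally show "s x = x" using xM MR by auto
  qed
  then have xF: "x \<in> F" using K'_props(4) by auto
  let ?P = "\<lambda>(i, a). pt i (\<zeta> [^] (a::nat))"
  have injP: "inj_on ?P I"
  proof (rule inj_onI)
    fix p q assume pq: "p \<in> I" "q \<in> I" "?P p = ?P q"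
    obtain i a i' b where ia: "p = (i, a)" "q = (i', b)" by fastforce
    then have "i = i' \<and> [a = b] (mod N)" using pq(3) pt_inj by auto
    moreover have "a < N" "b < N" using pq ia unfolding I_def T_def by auto
    ultimately show "p = q" using ia by (simp add: cong_def)
  qed
  \<comment> \<open>\<open>bound\<close> attaches exponents to points of \<open>B\<close>, so the
    exponents are transported along the injection \<open>?P\<close>.\<close>
  define g where "g = (\<lambda>\<alpha>. h (inv_into I ?P \<alpha>))"
  have g: "g (?P p) = h p" if "p \<in> I" for p unfolding g_def using inv_into_f_f[OF injP that] by simp
  have PB: "?P p \<in> B" for p using pt_B by (cases p) auto
  have PR: "?P p \<in> carrier L" for p using PB[of p] subringE(1)[OF subfieldE(1)[OF B(1)]] by auto
  have "x [^] N = (\<Otimes>p\<in>I. (y p [^] h p) [^] N)"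
    unfolding x_def by (rule finprod_nat_pow) (use yhM MR in auto)
  also have "\<dots> = (\<Otimes>p\<in>I. (t \<ominus> ?P p) [^] g (?P p))"
  proof (rule finprod_cong')
    show "(\<lambda>p. (t \<ominus> ?P p) [^] g (?P p)) \<in> I \<rightarrow> carrier L" using PR tR by auto
    fix p assume p: "p \<in> I"
    obtain i a where ia: "p = (i, a)" by fastforce
    have "(y p [^] h p) [^] N = (y p [^] N) [^] h p"
      using yM[OF p] MR by (auto simp: nat_pow_pow mult.commute)
    also have "y p [^] N = t \<ominus> ?P p" using root_R[of "\<zeta> [^] a" i] \<zeta>R unfolding y_def ia by simp
    finally show "(y p [^] h p) [^] N = (t \<ominus> ?P p) [^] g (?P p)" using g[OF p] by simp
  qed simp
  also have "\<dots> = (\<Otimes>\<alpha>\<in>?P ` I. (t \<ominus> \<alpha>) [^] g \<alpha>)"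
    by (rule finprod_reindex[symmetric]) (use injP PR tR in auto)
  finally have xN: "x [^] N = (\<Otimes>\<alpha>\<in>?P ` I. (t \<ominus> \<alpha>) [^] g \<alpha>)" .
  have "?P ` I \<subseteq> B" using PB by blast
  then have "\<forall>\<alpha>\<in>?P ` I. N dvd d * g \<alpha>"
    using bound[OF _ xF finite_imageI[OF finI] _ xN] N(2) by simp
  \<comment> \<open>The index \<open>a = 1\<close> is chosen because \<open>e 1 = 1\<close>, so the
    exponent there is \<open>m i0\<close> itself. Cancelling \<open>d\<close> from
    \<open>n * d dvd m i0 * d\<close> is what the choice \<open>N = n * d\<close> is made
    for.\<close>
  moreover have "(i0, 1) \<in> I" unfolding I_def using i0 oneT by simp
  ultimately have "N dvd d * h (i0, 1)" using g[of "(i0, 1)"] by force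
  moreover have "h (i0, 1) = m i0" unfolding h_def e_def by simp
  ultimately have "n * d dvd m i0 * d" using N(1) by (simp add: mult.commute)
  moreover have "d \<noteq> 0" using N by (metis mult_0_right not_one_less_zero)
  ultimately show ?thesis by simp
qed

text \<open>The coordinates of the lattice, taken modulo \<open>n\<close>, give the map to
  \<open>(\<int>/n)\<^sup>r\<close>. They depend only on vectors modulo \<open>N\<close>: the values
  of \<open>c l\<close> at \<open>N\<close> times the unit vectors form a character that kills the
  image of \<open>W\<close>, so \<open>n\<close> divides them. The dual vectors lie in the lattice
  and hence come from automorphisms, which makes the map onto; coordinate \<open>l\<close> is
  finally sent to the element \<open>al l\<close> of \<open>A\<close>.\<close>

theorem exists_epimorphism:
  fixes A :: "'c monoid"
  assumes A: "comm_group A" and exp: "\<And>x. x \<in> carrier A \<Longrightarrow> x [^]\<^bsub>A\<^esub> n = \<one>\<^bsub>A\<^esub>"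
    and al: "al ` {..<r} = carrier A"
  obtains f where "f \<in> hom (BijGroup M\<lparr>carrier := E\<rparr>) A" "f ` E = carrier A"
proof -
  interpret A: comm_group A by (rule A)
  define u where "u i = (\<lambda>j. if j = i then int N else 0)" for i :: nat
  have N0: "int N > 0" using N(2) by simp
  obtain c where c: "\<forall>l<r. \<forall>v\<in>lattice. \<forall>w\<in>lattice. c l (\<lambda>i. v i + w i) = (c l v + c l w :: int)"
    "\<forall>l<r. \<exists>v\<in>lattice. \<forall>l'<r. c l' v = (if l' = l then 1 else 0)"
  proof -
    have "\<exists>c. (\<forall>l<r. \<forall>v\<in>lattice. \<forall>w\<in>lattice. c l (\<lambda>i. v i + w i) = (c l v + c l w :: int)) \<and>
        (\<forall>l<r. \<exists>v\<in>lattice. \<forall>l'<r. c l' v = (if l' = l then 1 else 0))"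
      by (rule lattice_coordinates[of "int N"])
        (fact N0 | erule (1) lattice_props(1) | erule (1) lattice_props(2) | erule lattice_props(3) | rule lattice_props(4))+
    then show thesis using that by (elim exE conjE)
  qed
  have c_add: "c l (\<lambda>i. v i + w i) = c l v + c l w" if "l < r" "v \<in> lattice" "w \<in> lattice" for l v w
    using c(1) that by simp
  have additive: "c l (\<lambda>i. q * v i) = q * c l v" "(\<lambda>i. if i < r then int N * q' i else 0) \<in> lattice"
    "c l (\<lambda>i. if i < r then int N * q' i else 0) = (\<Sum>i<r. q' i * c l (\<lambda>j. if j = i then int N else 0))"
    if "l < r" "v \<in> lattice" for l v q q'
    by (rule lattice_additive[of lattice r "int N" "c l"];
      (fact that | erule (1) lattice_props(1) | erule (1) lattice_props(2) | erule lattice_props(3)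
        | rule lattice_props(4) | erule (1) c_add[OF that(1)]))+
  define w where "w s = (\<lambda>i. if i < r then int (W s i) else 0)" for s
  have w: "w s \<in> lattice" if "s \<in> E" for s using W_lattice[OF that] unfolding w_def .
  have c_unit: "int n dvd c l (u i)" if l: "l < r" and i: "i < r" for l i
  proof -
    \<comment> \<open>Reduction modulo \<open>N\<close> turns the values into natural exponents, and
      divisibility by \<open>n\<close> survives it since \<open>n\<close> divides \<open>N\<close>.
      By linearity the sum of the \<open>W s i * c l (u i)\<close> is \<open>N * c l (w s)\<close>,
      so the character vanishes modulo \<open>N\<close>.\<close>
    have "n dvd nat (c l (u i) mod int N)"
    proof (rule annihilator_divisible[OF _ i])
      fix s assume s: "s \<in> E"
      have "int N * c l (w s) = c l (\<lambda>i. int N * w s i)" using additive(1)[OF l w[OF s]] by simp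
      also have "(\<lambda>i. int N * w s i) = (\<lambda>i. if i < r then int N * int (W s i) else 0)" unfolding w_def by auto
      also have "c l \<dots> = (\<Sum>i<r. int (W s i) * c l (u i))"
        unfolding u_def using additive(3)[OF l w[OF s], of "\<lambda>i. int (W s i)"] .
      finally have eq: "int N * c l (w s) = (\<Sum>i<r. int (W s i) * c l (u i))" .
      have "[int (\<Sum>i<r. nat (c l (u i) mod int N) * W s i) = (\<Sum>i<r. int (W s i) * c l (u i))] (mod int N)"
        unfolding of_nat_sum
      proof (rule cong_sum)
        fix i
        have "int (nat (c l (u i) mod int N)) = c l (u i) mod int N" using N0 by simp
        then show "[int (nat (c l (u i) mod int N) * W s i) = int (W s i) * c l (u i)] (mod int N)"
          by (simp add: cong_def mod_mult_left_eq mult.commute[of "int (W s i)"])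
      qed
      then have "int N dvd int (\<Sum>i<r. nat (c l (u i) mod int N) * W s i)"
        unfolding eq[symmetric] by (metis cong_dvd_iff dvd_triv_left)
      then show "N dvd (\<Sum>i<r. nat (c l (u i) mod int N) * W s i)" by (simp only: of_nat_dvd_iff)
    qed
    then have "int n dvd int (nat (c l (u i) mod int N))" by (simp only: of_nat_dvd_iff)
    then have "int n dvd c l (u i) mod int N" using N0 by simp
    moreover have "int n dvd int N" using N(1) by simp
    ultimately show ?thesis by (metis dvd_mod_iff)
  qed
  have c_cong: "[c l v = c l v'] (mod int n)"
    if l: "l < r" and v: "v \<in> lattice" "v' \<in> lattice" and vw: "\<And>i. i < r \<Longrightarrow> [v i = v' i] (mod int N)" for l v v'
  proof -
    define q where "q i = (v i - v' i) div int N" for i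
    have "v = (\<lambda>i. v' i + (if i < r then int N * q i else 0))"
    proof
      fix i
      show "v i = v' i + (if i < r then int N * q i else 0)"
        using vw[of i] lattice_props(1)[OF v(1), of i] lattice_props(1)[OF v(2), of i]
        unfolding q_def by (auto simp: cong_iff_dvd_diff)
    qed
    then have "c l v = c l v' + (\<Sum>i<r. q i * c l (u i))"
      using c_add[OF l v(2) additive(2)[OF l v(2)], of q] additive(3)[OF l v(2), of q] unfolding u_def by simp
    moreover have "int n dvd (\<Sum>i<r. q i * c l (u i))"
      using c_unit[OF l] by (intro dvd_sum dvd_mult) auto
    ultimately show ?thesis by (simp add: cong_iff_dvd_diff)
  qed
  have alA: "al l \<in> carrier A" if "l < r" for l using al that by auto
  have pow_cong: "x [^]\<^bsub>A\<^esub> z = x [^]\<^bsub>A\<^esub> z'" if x: "x \<in> carrier A" and z: "[z = z'] (mod int n)" for x and z z' :: int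
  proof -
    obtain k where "z = z' + int n * k" using z by (auto simp: cong_iff_dvd_diff dvd_def algebra_simps)
    then have "x [^]\<^bsub>A\<^esub> z = x [^]\<^bsub>A\<^esub> z' \<otimes>\<^bsub>A\<^esub> (x [^]\<^bsub>A\<^esub> int n) [^]\<^bsub>A\<^esub> k"
      using x by (simp add: A.int_pow_mult A.int_pow_pow)
    then show ?thesis using exp[OF x] x by (simp add: int_pow_int A.int_pow_one)
  qed
  define f where "f s = finprod A (\<lambda>l. al l [^]\<^bsub>A\<^esub> c l (w s)) {..<r}" for s
  have fA: "f s \<in> carrier A" for s unfolding f_def by (rule A.finprod_closed) (use alA in auto)
  have mult: "f (compose M s s') = f s \<otimes>\<^bsub>A\<^esub> f s'" if s: "s \<in> E" "s' \<in> E" for s s'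
  proof -
    have "al l [^]\<^bsub>A\<^esub> c l (w (compose M s s')) = al l [^]\<^bsub>A\<^esub> c l (w s) \<otimes>\<^bsub>A\<^esub> al l [^]\<^bsub>A\<^esub> c l (w s')"
      if l: "l < r" for l
    proof -
      have sum: "(\<lambda>i. w s i + w s' i) \<in> lattice"
      proof -
        have zero: "(\<lambda>i. w s' i - w s' i) \<in> lattice" using lattice_props(2)[OF w[OF s(2)] w[OF s(2)]] .
        show ?thesis using lattice_props(2)[OF w[OF s(1)] lattice_props(2)[OF zero w[OF s(2)]]] by simp
      qed
      have "[c l (w (compose M s s')) = c l (\<lambda>i. w s i + w s' i)] (mod int n)"
      proof (rule c_cong[OF l w[OF E_comp[OF s]] sum])
        fix i assume i: "i < r"
        show "[w (compose M s s') i = w s i + w s' i] (mod int N)"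
          using W_comp[OF s i] i unfolding w_def by (simp flip: of_nat_add add: cong_int_iff)
      qed
      then have "[c l (w (compose M s s')) = c l (w s) + c l (w s')] (mod int n)"
        using c_add[OF l w[OF s(1)] w[OF s(2)]] by simp
      then show ?thesis using pow_cong[OF alA[OF l]] alA[OF l] by (simp add: A.int_pow_mult)
    qed
    then have "f (compose M s s') = finprod A (\<lambda>l. al l [^]\<^bsub>A\<^esub> c l (w s) \<otimes>\<^bsub>A\<^esub> al l [^]\<^bsub>A\<^esub> c l (w s')) {..<r}"
      unfolding f_def by (intro A.finprod_cong') (use alA in auto)
    also have "\<dots> = f s \<otimes>\<^bsub>A\<^esub> f s'" unfolding f_def by (rule A.finprod_multf) (use alA in auto)
    finally show ?thesis .
  qed
  have EB: "s \<in> Bij M" if "s \<in> E" for s using that field_autsD(1) unfolding E_def by blast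
  have hom: "f \<in> hom (BijGroup M\<lparr>carrier := E\<rparr>) A"
    using mult fA EB by (intro homI) (auto simp: BijGroup_def)
  have "carrier A \<subseteq> f ` E"
  proof
    fix a assume "a \<in> carrier A"
    then obtain l where l: "l < r" "al l = a" using al by (metis imageE lessThan_iff)
    \<comment> \<open>The dual vector \<open>v\<close> is congruent modulo \<open>N\<close> to the
      vector of some \<open>s\<close>, and coordinates modulo \<open>n\<close> do not see the
      difference.\<close>
    obtain v where v: "v \<in> lattice" "\<forall>l'<r. c l' v = (if l' = l then 1 else 0)" using c(2) l(1) by blast
    obtain s where s: "s \<in> E" "\<forall>i<r. [v i = int (W s i)] (mod int N)" using v(1) unfolding lattice_def by blast
    have "[c l' v = c l' (w s)] (mod int n)" if "l' < r" for l'
      by (rule c_cong[OF that v(1) w[OF s(1)]]) (use s(2) in \<open>simp add: w_def\<close>)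
    then have "al l' [^]\<^bsub>A\<^esub> c l' (w s) = (if l' = l then a else \<one>\<^bsub>A\<^esub>)" if "l' < r" for l'
      using pow_cong[OF alA[OF that], of "c l' v" "c l' (w s)"] v(2) that l alA[OF that] by (auto simp: A.int_pow_1)
    then have "f s = finprod A (\<lambda>l'. if l' = l then a else \<one>\<^bsub>A\<^esub>) {..<r}"
      unfolding f_def by (intro A.finprod_cong') (use alA \<open>a \<in> carrier A\<close> in auto)
    also have "\<dots> = a"
      using A.finprod_singleton_swap[of l "{..<r}" "\<lambda>_. a"] l(1) \<open>a \<in> carrier A\<close> by simp
    finally show "a \<in> f ` E" using s(1) by blast
  qed
  then have "f ` E = carrier A" using fA by auto
  then show ?thesis using that hom by blast
qed

end

section \<open>Abelian extensions of finitely generated fields\<close>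

text \<open>The second condition on \<open>gs\<close> says that \<open>K\<close> lies in the field
  generated by \<open>gs\<close> over \<open>k\<close>; it is quantified over subfields so that it
  applies at once to the large field \<open>F\<close> that contains \<open>B\<close>.\<close>

theorem exists_abelian_extension:
  fixes L :: "'a ring" (structure) and A :: "'c monoid"
  assumes L: "algebraically_closed L" and char0: "\<And>m::nat. m > 0 \<Longrightarrow> [m] \<cdot> \<one> \<noteq> \<zero>"
    and k: "subfield k L" and K: "subfield K L" "k \<subseteq> K" and gs: "set gs \<subseteq> carrier L"
      "\<And>F. subfield F L \<Longrightarrow> k \<subseteq> F \<Longrightarrow> set gs \<subseteq> F \<Longrightarrow> K \<subseteq> F"
    and t: "t \<in> K" "(ring.transcendental L over k) t"
    and A: "comm_group A" "finite (carrier A)"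
  obtains M where "subfield M L" "K \<subseteq> M" "finite_galois_extension (L\<lparr>carrier := M\<rparr>) K"
    "galois_group (L\<lparr>carrier := M\<rparr>) K \<cong> A"
proof -
  interpret L: algebraically_closed L by (rule L)
  interpret A: comm_group A by (rule A(1))
  have tR: "t \<in> carrier L" using t subringE(1)[OF subfieldE(1)[OF K(1)]] by auto
  define B where "B = {x \<in> carrier L. (L.algebraic over k) x}"
  have B: "subfield B L" unfolding B_def by (rule L.subfield_of_algebraics[OF k])
  have kB: "k \<subseteq> B"
    unfolding B_def using L.algebraic_self[OF subfieldE(1)[OF k]] subringE(1)[OF subfieldE(1)[OF k]] by auto
  have tB: "(L.transcendental over B) t"
  proof (rule ccontr)
    assume "\<not> (L.transcendental over B) t"
    then have "(L.algebraic over B) t" by (simp add: over_def)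
    then obtain p where p: "p \<in> carrier (B[X])" "p \<noteq> []" "L.eval p t = \<zero>"
      using L.algebraicE[OF subfieldE(1)[OF B] tR] by blast
    have setp: "set p \<subseteq> B" using p(1) L.polynomial_incl by (simp add: univ_poly_def)
    then have palg: "set p \<subseteq> carrier L" "\<And>x. x \<in> set p \<Longrightarrow> (L.algebraic over k) x" unfolding B_def by auto
    \<comment> \<open>The finitely many coefficients of a relation over \<open>B\<close> generate a
      finite extension of \<open>k\<close>, over which \<open>t\<close> would be algebraic
      already.\<close>
    define k' where "k' = L.finite_extension k p"
    have k': "subfield k' L" unfolding k'_def by (rule L.finite_extension_is_subfield[OF k palg])
    have "set p \<subseteq> k'" unfolding k'_def by (rule L.finite_extension_mem[OF subfieldE(1)[OF k] palg(1)])
    then have "p \<in> carrier (k'[X])" using p(1) unfolding univ_poly_def polynomial_def by auto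
    then have talg: "(L.algebraic over k') t" using L.algebraicI p(2,3) by blast
    have "L.finite_dimension k k'" unfolding k'_def
      by (rule L.finite_extension_finite_dimension(1)[OF k palg])
    moreover have "L.finite_dimension k' (L.simple_extension k' t)"
      using L.finite_dimension_simple_extension[OF k' tR] talg by simp
    ultimately have "L.finite_dimension k (L.simple_extension k' t)"
      using L.telescopic_base_dim(1)[OF k k'] by blast
    then have "(L.algebraic over k) t"
      using L.finite_dimension_imp_algebraic[OF k L.simple_extension_is_subring[OF subfieldE(1)[OF k'] tR]]
        L.simple_extension_mem[OF subfieldE(1)[OF k'] tR] by blast
    then show False using t(2) by (simp add: over_def)
  qed
  obtain F where F: "subfield F L" "B \<subseteq> F" "t \<in> F" "set gs \<subseteq> F" "L.radical_bounded t B F"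
    using L.exists_radical_bounded_field[OF B tR tB gs(1)] .
  have KF: "K \<subseteq> F" using gs(2)[OF F(1)] kB F(2,4) by blast
  obtain d :: nat where d: "d > 0" "\<And>(m::nat) u (e::'a \<Rightarrow> nat) S. m > 0 \<Longrightarrow> u \<in> F \<Longrightarrow> finite S \<Longrightarrow> S \<subseteq> B \<Longrightarrow>
        u [^] m = (\<Otimes>\<alpha>\<in>S. (t \<ominus> \<alpha>) [^] e \<alpha>) \<Longrightarrow> (\<forall>\<alpha>\<in>S. m dvd d * e \<alpha>)"
    using F(5) unfolding L.radical_bounded_def by blast
  \<comment> \<open>The factor 2 ensures \<open>n > 1\<close> when \<open>A\<close> is trivial.\<close>
  define n where "n = 2 * order A"
  have n: "n > 1" using A.order_gt_0_iff_finite A(2) unfolding n_def by simp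
  define N where "N = n * d"
  have N: "N > 1" using n d(1) unfolding N_def by (metis less_1_mult less_one linorder_neqE_nat mult.right_neutral not_gr0)
  obtain \<zeta> where \<zeta>: "L.primitive_root_of_unity N \<zeta>"
    using L.exists_primitive_root_of_unity[OF char0, of N] N by auto
  have \<zeta>B: "\<zeta> \<in> B"
  proof -
    have "\<zeta> \<in> carrier L" "\<zeta> [^] N = \<one>" using \<zeta> unfolding L.primitive_root_of_unity_def by auto
    then show ?thesis
      unfolding B_def using L.algebraic_of_pow_mem[OF subfieldE(1)[OF k], of \<zeta> N] N
        subringE(3)[OF subfieldE(1)[OF k]] by simp
  qed
  \<comment> \<open>All elements of \<open>A\<close> serve as generators, with one coordinate for
    each.\<close>
  define r where "r = order A"
  obtain al where al: "bij_betw al {..<r} (carrier A)"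
    using ex_bij_betw_nat_finite[OF A(2)] unfolding r_def order_def lessThan_atLeast0 by blast
  interpret kummer L K B F t \<zeta> N n d r
    by (intro kummer.intro kummer_axioms.intro L char0 K(1) t(1) B L.transcendental_notin[OF subfieldE(1)[OF B] tB]
        \<zeta>B F(1,2) KF \<zeta> N_def N d(2))
  have "x [^]\<^bsub>A\<^esub> n = \<one>\<^bsub>A\<^esub>" if "x \<in> carrier A" for x
    using A.pow_order_eq_1[OF that] that unfolding n_def by (simp add: mult.commute[of 2] A.nat_pow_pow[symmetric])
  then obtain f where f: "f \<in> hom (BijGroup M\<lparr>carrier := E\<rparr>) A" "f ` E = carrier A"
    using exists_epimorphism[OF A(1) _ bij_betw_imp_surj_on[OF al]] by blast
  obtain M' where "subfield M' L" "K \<subseteq> M'" "finite_galois_extension (L\<lparr>carrier := M'\<rparr>) K"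
    "galois_group (L\<lparr>carrier := M'\<rparr>) K \<cong> A"
  proof (rule galois_quotient[OF L.field_axioms K(1) M_props(1) KM fd_M])
    show "finite (field_auts L M K)" using E_finite unfolding E_def .
    show "z \<in> K" if "z \<in> M" "\<And>s. s \<in> field_auts L M K \<Longrightarrow> s z = z" for z
      using E_fixed that unfolding E_def by blast
    show "f \<in> hom (galois_group (L\<lparr>carrier := M\<rparr>) K) A" using f(1) unfolding galois_group_eq E_def .
    show "f ` field_auts L M K = carrier A" using f(2) unfolding E_def .
  qed (rule A.is_group)
  then show ?thesis using that by blast
qed

section \<open>The p-adic numbers\<close>

text \<open>\<open>padic_abs\<close> is defined through the reduced fraction, whereas sums are
  computed over a common denominator and need not be reduced.\<close>

lemma padic_abs_of_quotient:
  fixes a b :: int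
  assumes p: "Factorial_Ring.prime p" and ab: "a \<noteq> 0" "b \<noteq> 0"
  shows "padic_abs p (of_int a / of_int b) =
    real p powi (int (multiplicity (int p) b) - int (multiplicity (int p) a))"
proof -
  obtain a' b' where q: "quotient_of (of_int a / of_int b) = (a', b')" by fastforce
  have b': "b' > 0" using quotient_of_denom_pos[OF q] .
  have eq: "(of_int a / of_int b :: rat) = of_int a' / of_int b'" using quotient_of_div[OF q] .
  have "(of_int a * of_int b' :: rat) = of_int a' * of_int b" using eq ab b' by (simp add: field_simps)
  then have e: "a * b' = a' * b" by (simp only: of_int_mult[symmetric] of_int_eq_iff)
  then have a': "a' \<noteq> 0" using ab b' by auto
  have pe: "prime_elem (int p)" using p by simp
  have "multiplicity (int p) a + multiplicity (int p) b' = multiplicity (int p) a' + multiplicity (int p) b"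
    using e prime_elem_multiplicity_mult_distrib[OF pe, of a b'] prime_elem_multiplicity_mult_distrib[OF pe, of a' b]
      ab a' b' by simp
  then have "int (multiplicity (int p) b') - int (multiplicity (int p) a')
      = int (multiplicity (int p) b) - int (multiplicity (int p) a)" by linarith
  moreover have "(of_int a / of_int b :: rat) \<noteq> 0" using ab by simp
  ultimately show ?thesis unfolding padic_abs_def q by simp
qed

lemma padic_abs_nonneg: "padic_abs p x \<ge> 0"
  unfolding padic_abs_def by simp

text \<open>Over a common denominator, the valuation of the numerator is at least the smaller of the
  two valuations. This bounds the left side by the maximum, and nonnegativity turns the maximum into
  the sum.\<close>

lemma padic_abs_add_le:
  assumes p: "Factorial_Ring.prime p"
  shows "padic_abs p (x + y) \<le> padic_abs p x + padic_abs p y"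
proof (cases "x = 0 \<or> y = 0 \<or> x + y = 0")
  case True
  then show ?thesis using padic_abs_nonneg[of p] by (auto simp: padic_abs_def[of p 0] add_nonneg_nonneg)
next
  case False
  obtain a b where x: "quotient_of x = (a, b)" by fastforce
  obtain c d where y: "quotient_of y = (c, d)" by fastforce
  have b: "b > 0" "d > 0" using quotient_of_denom_pos x y by auto
  have xe: "x = of_int a / of_int b" "y = of_int c / of_int d" using quotient_of_div x y by auto
  have ac: "a \<noteq> 0" "c \<noteq> 0" using False xe by auto
  have se: "x + y = of_int (a * d + c * b) / of_int (b * d)" using xe b by (simp add: field_simps)
  have s0: "a * d + c * b \<noteq> 0"
  proof
    assume "a * d + c * b = 0"
    then have "x + y = 0" unfolding se by simp
    then show False using False by simp
  qed
  let ?v = "multiplicity (int p)"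
  have pe: "prime_elem (int p)" using p by simp
  have nu: "\<not> is_unit (int p)" using prime_gt_1_nat[OF p] by simp
  have "int p ^ min (?v (a * d)) (?v (c * b)) dvd a * d + c * b"
    by (intro dvd_add) (meson dvd_trans le_imp_power_dvd min.cobounded1 min.cobounded2 multiplicity_dvd)+
  then have m: "min (?v (a * d)) (?v (c * b)) \<le> ?v (a * d + c * b)"
    using multiplicity_geI[OF s0 nu] by blast
  have vm: "?v (a * d) = ?v a + ?v d" "?v (c * b) = ?v c + ?v b" "?v (b * d) = ?v b + ?v d"
    using prime_elem_multiplicity_mult_distrib[OF pe] ac b by auto
  have p1: "real p \<ge> 1" using prime_ge_1_nat[OF p] by simp
  have "padic_abs p (x + y) = real p powi (int (?v (b * d)) - int (?v (a * d + c * b)))"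
    unfolding se using padic_abs_of_quotient[OF p s0, of "b * d"] b by simp
  also have "\<dots> \<le> real p powi (max (int (?v b) - int (?v a)) (int (?v d) - int (?v c)))"
    by (rule power_int_increasing[OF _ p1]) (use m vm in linarith)
  also have "\<dots> \<le> padic_abs p x + padic_abs p y"
    using padic_abs_of_quotient[OF p ac(1), of b] padic_abs_of_quotient[OF p ac(2), of d] b
      padic_abs_nonneg[of p x] padic_abs_nonneg[of p y] xe by (auto simp: max_def)
  finally show ?thesis .
qed

lemma padic_null_add:
  assumes p: "Factorial_Ring.prime p" and x: "x \<in> padic_null p" "y \<in> padic_null p"
  shows "(\<lambda>i. x i + y i) \<in> padic_null p"
proof -
  have "(\<lambda>i. padic_abs p (x i) + padic_abs p (y i)) \<longlonglongrightarrow> 0 + 0"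
    using x unfolding padic_null_def by (intro tendsto_add) auto
  then have "(\<lambda>i. padic_abs p (x i + y i)) \<longlonglongrightarrow> 0"
    by (intro tendsto_sandwich[of "\<lambda>_. 0" "\<lambda>i. padic_abs p (x i + y i)"])
      (use padic_abs_nonneg padic_abs_add_le[OF p] in \<open>auto intro!: always_eventually\<close>)
  then show ?thesis unfolding padic_null_def by simp
qed

lemma zero_padic_null: "(\<lambda>i. 0) \<in> padic_null p"
  unfolding padic_null_def padic_abs_def by simp

text \<open>The image of the rational number \<open>a\<close> in \<open>Qp p\<close>.\<close>

definition const_coset :: "nat \<Rightarrow> rat \<Rightarrow> (nat \<Rightarrow> rat) set" where
  "const_coset p a = padic_null p +>\<^bsub>padic_Cauchy_ring p\<^esub> (\<lambda>_. a)"

lemma const_coset_eq: "const_coset p a = {\<lambda>i. x i + a | x. x \<in> padic_null p}"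
  unfolding const_coset_def a_r_coset_def r_coset_def padic_Cauchy_ring_def by auto

lemma const_cosetI: "x \<in> padic_null p \<Longrightarrow> (\<lambda>i. x i + a) \<in> const_coset p a"
  unfolding const_coset_eq by (rule CollectI, rule exI[of _ x]) simp

lemma const_coset_carrier: "const_coset p a \<in> carrier (Qp p)"
proof -
  have "(\<lambda>_. a) \<in> carrier (padic_Cauchy_ring p)"
    unfolding padic_Cauchy_ring_def padic_Cauchy_def padic_abs_def by auto
  then show ?thesis
    unfolding Qp_def FactRing_def A_RCOSETS_def RCOSETS_def const_coset_def a_r_coset_def by auto
qed

lemma const_coset_add:
  assumes p: "Factorial_Ring.prime p"
  shows "const_coset p a \<oplus>\<^bsub>Qp p\<^esub> const_coset p b = const_coset p (a + b)"
proof -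
  have "const_coset p a \<oplus>\<^bsub>Qp p\<^esub> const_coset p b
      = {\<lambda>i. u i + v i | u v. u \<in> const_coset p a \<and> v \<in> const_coset p b}"
    unfolding Qp_def FactRing_def set_add_def set_mult_def padic_Cauchy_ring_def by auto
  also have "\<dots> = const_coset p (a + b)"
  proof
    show "{\<lambda>i. u i + v i | u v. u \<in> const_coset p a \<and> v \<in> const_coset p b} \<subseteq> const_coset p (a + b)"
    proof
      fix w assume "w \<in> {\<lambda>i. u i + v i | u v. u \<in> const_coset p a \<and> v \<in> const_coset p b}"
      then obtain x y where "x \<in> padic_null p" "y \<in> padic_null p" "w = (\<lambda>i. (x i + a) + (y i + b))"
        unfolding const_coset_eq by auto
      then have "w = (\<lambda>i. (x i + y i) + (a + b))" "(\<lambda>i. x i + y i) \<in> padic_null p"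
        using padic_null_add[OF p] by auto
      then show "w \<in> const_coset p (a + b)"
        unfolding const_coset_eq mem_Collect_eq by (intro exI[of _ "\<lambda>i. x i + y i"] conjI)
    qed
    show "const_coset p (a + b) \<subseteq> {\<lambda>i. u i + v i | u v. u \<in> const_coset p a \<and> v \<in> const_coset p b}"
    proof
      fix w assume "w \<in> const_coset p (a + b)"
      then obtain x where x: "x \<in> padic_null p" "w = (\<lambda>i. x i + (a + b))" unfolding const_coset_eq by auto
      have "(\<lambda>i. x i + a) \<in> const_coset p a" "(\<lambda>i. 0 + b) \<in> const_coset p b"
        using const_cosetI[OF x(1), of a] const_cosetI[OF zero_padic_null, of b] by simp_all
      moreover have "w = (\<lambda>i. (\<lambda>i. x i + a) i + (\<lambda>i. 0 + b) i)" using x(2) by (simp add: add.assoc)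
      ultimately show "w \<in> {\<lambda>i. u i + v i | u v. u \<in> const_coset p a \<and> v \<in> const_coset p b}"
        unfolding mem_Collect_eq by (intro exI[of _ "\<lambda>i. x i + a"] exI[of _ "\<lambda>i. 0 + b"] conjI)
    qed
  qed
  finally show ?thesis .
qed

text \<open>Adding the class of \<open>1 / m\<close> to itself \<open>m\<close> times gives the
  class of \<open>1\<close>. So its image \<open>y\<close> in \<open>k\<close> is inverse to
  \<open>m\<close> times the unit, which therefore cannot be zero.\<close>

lemma padic_field_char_zero:
  assumes p: "Factorial_Ring.prime p" and k: "padic_field p k" and m: "(m::nat) > 0"
  shows "add_pow k m \<one>\<^bsub>k\<^esub> \<noteq> \<zero>\<^bsub>k\<^esub>"
proof
  assume 0: "add_pow k m \<one>\<^bsub>k\<^esub> = \<zero>\<^bsub>k\<^esub>"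
  interpret k: field k using k unfolding padic_field_def by simp
  obtain h where h: "h \<in> ring_hom (Qp p) k" using k unfolding padic_field_def by blast
  define y where "y = h (const_coset p (1 / of_nat m))"
  have y: "y \<in> carrier k" unfolding y_def by (rule ring_hom_memE(1)[OF h const_coset_carrier])
  have "add_pow k (Suc j) y = h (const_coset p (of_nat (Suc j) / of_nat m))" for j
  proof (induct j)
    case 0
    then show ?case using y unfolding y_def by simp
  next
    case (Suc j)
    have "add_pow k (Suc (Suc j)) y = h (const_coset p (of_nat (Suc j) / of_nat m)) \<oplus>\<^bsub>k\<^esub> h (const_coset p (1 / of_nat m))"
      using Suc unfolding y_def by simp
    also have "\<dots> = h (const_coset p (of_nat (Suc j) / of_nat m) \<oplus>\<^bsub>Qp p\<^esub> const_coset p (1 / of_nat m))"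
      by (rule ring_hom_memE(3)[OF h const_coset_carrier const_coset_carrier, symmetric])
    also have "\<dots> = h (const_coset p (of_nat (Suc (Suc j)) / of_nat m))"
      unfolding const_coset_add[OF p] by (simp add: add_divide_distrib ac_simps)
    finally show ?case .
  qed
  from this[of "m - 1"] have "add_pow k m y = h (const_coset p 1)" using m by simp
  also have "const_coset p 1 = \<one>\<^bsub>Qp p\<^esub>"
    unfolding const_coset_def Qp_def FactRing_def padic_Cauchy_ring_def by simp
  also have "h \<one>\<^bsub>Qp p\<^esub> = \<one>\<^bsub>k\<^esub>" by (rule ring_hom_memE(4)[OF h])
  finally have "add_pow k m y = \<one>\<^bsub>k\<^esub>" .
  moreover have "add_pow k m y = add_pow k m \<one>\<^bsub>k\<^esub> \<otimes>\<^bsub>k\<^esub> y" using y k.add_pow_ldistr[of "\<one>\<^bsub>k\<^esub>" y m] by simp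
  ultimately show False using 0 y by simp
qed

section \<open>The function field of a projective variety\<close>

text \<open>The product of polynomials sums over the sub-multisets of a monomial; over an infinite
  set \<open>finsum\<close> would return its default value.\<close>

lemma finite_sub_multisets: "finite {a. a \<subseteq># m}"
proof (induct m)
  case (add x m)
  have "{a. a \<subseteq># add_mset x m} \<subseteq> {a. a \<subseteq># m} \<union> add_mset x ` {a. a \<subseteq># m}"
  proof
    fix a assume a: "a \<in> {a. a \<subseteq># add_mset x m}"
    show "a \<in> {a. a \<subseteq># m} \<union> add_mset x ` {a. a \<subseteq># m}"
    proof (cases "x \<in># a")
      case True
      then obtain b where "a = add_mset x b" by (meson multi_member_split)
      then show ?thesis using a by auto
    next
      case False
      then have "a \<subseteq># m" using a
        by (auto simp: subseteq_mset_def count_eq_zero_iff) (metis count_inI le_0_eq linorder_le_cases)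
      then show ?thesis by simp
    qed
  qed
  then show ?case using add finite_subset by fastforce
qed simp

text \<open>The ring laws of \<open>mpoly_ring k n\<close> come with the hypothesis that
  \<open>I\<close> is a prime ideal, since this includes that the surrounding structure is a
  commutative ring.\<close>

locale projective_domain =
  fixes k :: "'a ring" and n :: nat and I :: "'a mpol set"
  assumes k: "field k" and prime: "primeideal I (mpoly_ring k n)"
begin

abbreviation "S \<equiv> mpoly_ring k n"
abbreviation "cst \<equiv> ring.indexed_const k"
abbreviation "vr \<equiv> ring.indexed_var k :: nat \<Rightarrow> 'a mpol"

sublocale k: field k by (rule k)
sublocale S: cring S by (rule primeideal.axioms(2)[OF prime])
sublocale I: primeideal I S by (rule prime)

lemma S_simps:
  "carrier S = ring.indexed_pset k {..n} (carrier k)"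
  "f \<otimes>\<^bsub>S\<^esub> g = (\<lambda>m. finsum k (\<lambda>a. f a \<otimes>\<^bsub>k\<^esub> g (m - a)) {a. a \<subseteq># m})"
  "\<one>\<^bsub>S\<^esub> = cst \<one>\<^bsub>k\<^esub>" "\<zero>\<^bsub>S\<^esub> = cst \<zero>\<^bsub>k\<^esub>" "f \<oplus>\<^bsub>S\<^esub> g = ring.indexed_padd k f g"
  unfolding mpoly_ring_def by simp_all

lemma coeff_closed: "f \<in> carrier S \<Longrightarrow> f m \<in> carrier k"
  using k.indexed_pset_in_carrier[of "carrier k" f "{..n}"] unfolding S_simps k.carrier_coeff_def by simp

lemma cst_closed: "a \<in> carrier k \<Longrightarrow> cst a \<in> carrier S"
  unfolding S_simps by (rule k.indexed_pset.indexed_const)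

lemma vr_closed: "i \<le> n \<Longrightarrow> vr i \<in> carrier S"
  unfolding S_simps k.indexed_var_def
  by (rule k.indexed_pset.indexed_pmult) (auto intro: k.indexed_pset.indexed_const)

lemma add_coeff: "(f \<oplus>\<^bsub>S\<^esub> g) m = f m \<oplus>\<^bsub>k\<^esub> g m"
  unfolding S_simps k.indexed_padd_def ..

lemma zero_coeff: "\<zero>\<^bsub>S\<^esub> m = \<zero>\<^bsub>k\<^esub>"
  unfolding S_simps k.indexed_const_def by simp

lemma homogeneous_mult:
  assumes fg: "f \<in> carrier S" "g \<in> carrier S" and "homogeneous k d f" "homogeneous k d' g"
  shows "homogeneous k (d + d') (f \<otimes>\<^bsub>S\<^esub> g)"
  unfolding homogeneous_def
proof (intro allI impI)
  fix m assume "(f \<otimes>\<^bsub>S\<^esub> g) m \<noteq> \<zero>\<^bsub>k\<^esub>"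
  then have ne: "finsum k (\<lambda>a. f a \<otimes>\<^bsub>k\<^esub> g (m - a)) {a. a \<subseteq># m} \<noteq> \<zero>\<^bsub>k\<^esub>" unfolding S_simps .
  have "\<exists>a. a \<subseteq># m \<and> f a \<otimes>\<^bsub>k\<^esub> g (m - a) \<noteq> \<zero>\<^bsub>k\<^esub>"
  proof (rule ccontr)
    assume "\<not> ?thesis"
    then have "finsum k (\<lambda>a. f a \<otimes>\<^bsub>k\<^esub> g (m - a)) {a. a \<subseteq># m} = \<zero>\<^bsub>k\<^esub>"
      by (intro k.add.finprod_one_eqI) auto
    then show False using ne by simp
  qed
  then obtain a where a: "a \<subseteq># m" "f a \<otimes>\<^bsub>k\<^esub> g (m - a) \<noteq> \<zero>\<^bsub>k\<^esub>" by blast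
  then have "f a \<noteq> \<zero>\<^bsub>k\<^esub>" "g (m - a) \<noteq> \<zero>\<^bsub>k\<^esub>" using coeff_closed fg by auto
  then have "size a = d" "size (m - a) = d'" using assms(3,4) unfolding homogeneous_def by auto
  then show "size m = d + d'" using a(1) size_Diff_submset[OF a(1)] size_mset_mono[OF a(1)] by simp
qed

lemma homogeneous_add:
  assumes "homogeneous k d f" "homogeneous k d g"
  shows "homogeneous k d (f \<oplus>\<^bsub>S\<^esub> g)"
  using assms unfolding homogeneous_def add_coeff by (metis k.add.one_closed k.l_zero)

lemma homogeneous_zero: "homogeneous k d \<zero>\<^bsub>S\<^esub>"
  unfolding homogeneous_def zero_coeff by simp

lemma homogeneous_cst: "homogeneous k 0 (cst a)"
  unfolding homogeneous_def k.indexed_const_def by simp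

lemma homogeneous_one: "homogeneous k 0 \<one>\<^bsub>S\<^esub>"
  unfolding S_simps(3) by (rule homogeneous_cst)

lemma vr_coeff: "vr i m = (if m = {#i#} then \<one>\<^bsub>k\<^esub> else \<zero>\<^bsub>k\<^esub>)"
proof (cases "i \<in># m")
  case True
  then obtain m' where "m = add_mset i m'" by (meson multi_member_split)
  then show ?thesis unfolding k.indexed_var_def k.indexed_pmult_def k.indexed_const_def by simp
next
  case False
  then have "m \<noteq> {#i#}" by auto
  then show ?thesis using False unfolding k.indexed_var_def k.indexed_pmult_def by simp
qed

lemma homogeneous_vr: "homogeneous k 1 (vr i)"
  unfolding homogeneous_def vr_coeff by simp

lemma homogeneous_pow:
  assumes "f \<in> carrier S" "homogeneous k d f"
  shows "homogeneous k (d * j) (f [^]\<^bsub>S\<^esub> j)"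
proof (induct j)
  case (Suc j)
  then show ?case using homogeneous_mult[OF _ assms(1) Suc assms(2)] assms(1) by (simp add: add.commute)
qed (simp add: homogeneous_one)

text \<open>At most one summand of the convolution survives, so multiplication by a single term
  shifts monomials. Taking \<open>u\<close> to be one variable identifies the product with
  \<open>indexed_pmult\<close>; taking \<open>u\<close> empty handles constants.\<close>

lemma mult_single:
  assumes f: "f \<in> carrier S" and g: "g \<in> carrier S" and supp: "\<And>m. m \<noteq> u \<Longrightarrow> g m = \<zero>\<^bsub>k\<^esub>"
  shows "(f \<otimes>\<^bsub>S\<^esub> g) m = (if u \<subseteq># m then f (m - u) \<otimes>\<^bsub>k\<^esub> g u else \<zero>\<^bsub>k\<^esub>)"
proof (cases "u \<subseteq># m")
  case True
  have "finsum k (\<lambda>a. f a \<otimes>\<^bsub>k\<^esub> g (m - a)) {a. a \<subseteq># m} = finsum k (\<lambda>a. f a \<otimes>\<^bsub>k\<^esub> g (m - a)) {m - u}"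
  proof (rule k.add.finprod_mono_neutral_cong_right)
    show "f a \<otimes>\<^bsub>k\<^esub> g (m - a) = \<zero>\<^bsub>k\<^esub>" if "a \<in> {a. a \<subseteq># m} - {m - u}" for a
    proof -
      have "m - a \<noteq> u" using that by (auto simp: subset_mset.diff_diff_right)
      then show ?thesis using supp coeff_closed[OF f] by simp
    qed
  qed (use True finite_sub_multisets coeff_closed[OF f] coeff_closed[OF g] in auto)
  also have "\<dots> = f (m - u) \<otimes>\<^bsub>k\<^esub> g u"
    using True coeff_closed[OF f] coeff_closed[OF g] by (simp add: subset_mset.diff_diff_right)
  finally show ?thesis using True unfolding S_simps by simp
next
  case False
  have "finsum k (\<lambda>a. f a \<otimes>\<^bsub>k\<^esub> g (m - a)) {a. a \<subseteq># m} = \<zero>\<^bsub>k\<^esub>"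
  proof (rule k.add.finprod_one_eqI)
    fix a assume "a \<in> {a. a \<subseteq># m}"
    then have "m - a \<noteq> u" using False by auto
    then show "f a \<otimes>\<^bsub>k\<^esub> g (m - a) = \<zero>\<^bsub>k\<^esub>" using supp coeff_closed[OF f] by simp
  qed
  then show ?thesis using False unfolding S_simps by simp
qed

lemma mult_vr:
  assumes f: "f \<in> carrier S" and i: "i \<le> n"
  shows "f \<otimes>\<^bsub>S\<^esub> vr i = ring.indexed_pmult k f i"
proof
  fix m
  show "(f \<otimes>\<^bsub>S\<^esub> vr i) m = ring.indexed_pmult k f i m"
    using mult_single[OF f vr_closed[OF i], of "{#i#}" m] coeff_closed[OF f]
    unfolding vr_coeff k.indexed_pmult_def by simp
qed

lemma mult_cst:
  assumes "a \<in> carrier k" "b \<in> carrier k"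
  shows "cst a \<otimes>\<^bsub>S\<^esub> cst b = cst (a \<otimes>\<^bsub>k\<^esub> b)"
proof
  fix m :: "nat multiset"
  show "(cst a \<otimes>\<^bsub>S\<^esub> cst b) m = cst (a \<otimes>\<^bsub>k\<^esub> b) m"
    using mult_single[OF cst_closed[OF assms(1)] cst_closed[OF assms(2)], of "{#}" m] assms
    unfolding k.indexed_const_def by auto
qed

lemma add_cst: "a \<in> carrier k \<Longrightarrow> b \<in> carrier k \<Longrightarrow> cst a \<oplus>\<^bsub>S\<^esub> cst b = cst (a \<oplus>\<^bsub>k\<^esub> b)"
  unfolding S_simps by (rule k.indexed_padd_const)

section \<open>Homogeneous fractions\<close>

abbreviation "H \<equiv> hom_fractions k n I"
abbreviation "R \<equiv> fraction_rel k n I"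

lemma H_iff: "(f, g) \<in> H \<longleftrightarrow> f \<in> carrier S \<and> g \<in> carrier S \<and> g \<notin> I \<and> (\<exists>d. homogeneous k d f \<and> homogeneous k d g)"
  unfolding hom_fractions_def by simp

lemma R_iff: "((f, g), (f', g')) \<in> R \<longleftrightarrow> (f, g) \<in> H \<and> (f', g') \<in> H \<and>
    (f \<otimes>\<^bsub>S\<^esub> g') \<ominus>\<^bsub>S\<^esub> (f' \<otimes>\<^bsub>S\<^esub> g) \<in> I"
  unfolding fraction_rel_def by simp

lemma I_comb: "x \<in> I \<Longrightarrow> y \<in> I \<Longrightarrow> a \<in> carrier S \<Longrightarrow> b \<in> carrier S \<Longrightarrow> a \<otimes>\<^bsub>S\<^esub> x \<oplus>\<^bsub>S\<^esub> b \<otimes>\<^bsub>S\<^esub> y \<in> I"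
  by (intro I.a_closed I.I_l_closed)

lemma I_prime: "x \<in> carrier S \<Longrightarrow> y \<in> carrier S \<Longrightarrow> x \<otimes>\<^bsub>S\<^esub> y \<in> I \<Longrightarrow> x \<in> I \<or> y \<in> I"
  by (rule I.I_prime)

lemma equiv_R: "equiv H R"
proof (rule equivI)
  show "R \<subseteq> H \<times> H" unfolding fraction_rel_def by auto
  show "refl_on H R"
  proof (rule refl_onI)
    fix x assume x: "x \<in> H"
    obtain f g where fg: "x = (f, g)" by fastforce
    then have "f \<in> carrier S" "g \<in> carrier S" using x H_iff by auto
    then have "(f \<otimes>\<^bsub>S\<^esub> g) \<ominus>\<^bsub>S\<^esub> (f \<otimes>\<^bsub>S\<^esub> g) = \<zero>\<^bsub>S\<^esub>" by simp
    then show "(x, x) \<in> R" using x I.zero_closed unfolding fg R_iff by simp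
  qed
  show "sym R"
  proof (rule symI)
    fix x y assume xy: "(x, y) \<in> R"
    obtain f g f' g' where fg: "x = (f, g)" "y = (f', g')" by fastforce
    then have c: "f \<in> carrier S" "g \<in> carrier S" "f' \<in> carrier S" "g' \<in> carrier S"
      and i: "(f \<otimes>\<^bsub>S\<^esub> g') \<ominus>\<^bsub>S\<^esub> (f' \<otimes>\<^bsub>S\<^esub> g) \<in> I" using xy unfolding fg R_iff H_iff by auto
    have "(f' \<otimes>\<^bsub>S\<^esub> g) \<ominus>\<^bsub>S\<^esub> (f \<otimes>\<^bsub>S\<^esub> g') = \<ominus>\<^bsub>S\<^esub> ((f \<otimes>\<^bsub>S\<^esub> g') \<ominus>\<^bsub>S\<^esub> (f' \<otimes>\<^bsub>S\<^esub> g))"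
      using c by (simp add: a_minus_def S.minus_add S.a_comm)
    then show "(y, x) \<in> R" using xy I.a_inv_closed[OF i] unfolding fg R_iff by simp
  qed
  show "trans R"
  proof (rule transI)
    fix x y z assume xy: "(x, y) \<in> R" and yz: "(y, z) \<in> R"
    obtain f1 g1 f2 g2 f3 g3 where fg: "x = (f1, g1)" "y = (f2, g2)" "z = (f3, g3)" by (metis surj_pair)
    then have c: "f1 \<in> carrier S" "g1 \<in> carrier S" "f2 \<in> carrier S" "g2 \<in> carrier S" "f3 \<in> carrier S" "g3 \<in> carrier S"
      "g2 \<notin> I"
      and i: "(f1 \<otimes>\<^bsub>S\<^esub> g2) \<ominus>\<^bsub>S\<^esub> (f2 \<otimes>\<^bsub>S\<^esub> g1) \<in> I" "(f2 \<otimes>\<^bsub>S\<^esub> g3) \<ominus>\<^bsub>S\<^esub> (f3 \<otimes>\<^bsub>S\<^esub> g2) \<in> I"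
      using xy yz unfolding fg R_iff H_iff by auto
    \<comment> \<open>For transitivity the wanted element is multiplied by \<open>g2\<close>, which
      can be cancelled afterwards because \<open>I\<close> is prime and \<open>g2\<close> lies
      outside it.\<close>
    have "g2 \<otimes>\<^bsub>S\<^esub> ((f1 \<otimes>\<^bsub>S\<^esub> g3) \<ominus>\<^bsub>S\<^esub> (f3 \<otimes>\<^bsub>S\<^esub> g1)) =
        g3 \<otimes>\<^bsub>S\<^esub> ((f1 \<otimes>\<^bsub>S\<^esub> g2) \<ominus>\<^bsub>S\<^esub> (f2 \<otimes>\<^bsub>S\<^esub> g1)) \<oplus>\<^bsub>S\<^esub> g1 \<otimes>\<^bsub>S\<^esub> ((f2 \<otimes>\<^bsub>S\<^esub> g3) \<ominus>\<^bsub>S\<^esub> (f3 \<otimes>\<^bsub>S\<^esub> g2))"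
      using c(1-6) unfolding a_minus_def by algebra
    then have "g2 \<otimes>\<^bsub>S\<^esub> ((f1 \<otimes>\<^bsub>S\<^esub> g3) \<ominus>\<^bsub>S\<^esub> (f3 \<otimes>\<^bsub>S\<^esub> g1)) \<in> I" using I_comb[OF i c(6) c(2)] by simp
    then have "(f1 \<otimes>\<^bsub>S\<^esub> g3) \<ominus>\<^bsub>S\<^esub> (f3 \<otimes>\<^bsub>S\<^esub> g1) \<in> I" using I_prime c by (meson S.m_closed S.minus_closed)
    then show "(x, z) \<in> R" using xy yz unfolding fg R_iff by simp
  qed
qed

lemma H_mult: "(f, g) \<in> H \<Longrightarrow> (f', g') \<in> H \<Longrightarrow> (f \<otimes>\<^bsub>S\<^esub> f', g \<otimes>\<^bsub>S\<^esub> g') \<in> H"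
  unfolding H_iff using homogeneous_mult I_prime by (meson S.m_closed)

lemma H_add: "(f, g) \<in> H \<Longrightarrow> (f', g') \<in> H \<Longrightarrow> ((f \<otimes>\<^bsub>S\<^esub> g') \<oplus>\<^bsub>S\<^esub> (f' \<otimes>\<^bsub>S\<^esub> g), g \<otimes>\<^bsub>S\<^esub> g') \<in> H"
proof -
  assume "(f, g) \<in> H" "(f', g') \<in> H"
  then obtain d d' where c: "f \<in> carrier S" "g \<in> carrier S" "g \<notin> I" "f' \<in> carrier S" "g' \<in> carrier S" "g' \<notin> I"
    and h: "homogeneous k d f" "homogeneous k d g" "homogeneous k d' f'" "homogeneous k d' g'"
    unfolding H_iff by blast
  have "homogeneous k (d + d') (f \<otimes>\<^bsub>S\<^esub> g')" "homogeneous k (d + d') (f' \<otimes>\<^bsub>S\<^esub> g)" "homogeneous k (d + d') (g \<otimes>\<^bsub>S\<^esub> g')"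
    using homogeneous_mult[OF c(1,5) h(1,4)] homogeneous_mult[OF c(4,2) h(3,2)] homogeneous_mult[OF c(2,5) h(2,4)]
    by (simp_all add: add.commute)
  then show ?thesis unfolding H_iff using c I_prime homogeneous_add by (meson S.m_closed S.a_closed)
qed

definition cls :: "'a mpol \<Rightarrow> 'a mpol \<Rightarrow> ('a mpol \<times> 'a mpol) set" where "cls f g = R `` {(f, g)}"

lemma cls_mult:
  assumes "(f, g) \<in> H" "(f', g') \<in> H"
  shows "cls f g \<otimes>\<^bsub>function_field k n I\<^esub> cls f' g' = cls (f \<otimes>\<^bsub>S\<^esub> f') (g \<otimes>\<^bsub>S\<^esub> g')"
proof -
  let ?F = "\<lambda>x y. case x of (f, g) \<Rightarrow> case y of (f', g') \<Rightarrow> R `` {(f \<otimes>\<^bsub>S\<^esub> f', g \<otimes>\<^bsub>S\<^esub> g')}"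
  have "congruent2 R R ?F"
  proof (rule congruent2I')
    fix x1 x2 y1 y2 assume x: "(x1, x2) \<in> R" and y: "(y1, y2) \<in> R"
    obtain f1 g1 f1' g1' f2 g2 f2' g2' where fg: "x1 = (f1, g1)" "x2 = (f1', g1')" "y1 = (f2, g2)" "y2 = (f2', g2')"
      by (metis surj_pair)
    have c: "f1 \<in> carrier S" "g1 \<in> carrier S" "f1' \<in> carrier S" "g1' \<in> carrier S"
      "f2 \<in> carrier S" "g2 \<in> carrier S" "f2' \<in> carrier S" "g2' \<in> carrier S"
      and i: "(f1 \<otimes>\<^bsub>S\<^esub> g1') \<ominus>\<^bsub>S\<^esub> (f1' \<otimes>\<^bsub>S\<^esub> g1) \<in> I" "(f2 \<otimes>\<^bsub>S\<^esub> g2') \<ominus>\<^bsub>S\<^esub> (f2' \<otimes>\<^bsub>S\<^esub> g2) \<in> I"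
      using x y unfolding fg R_iff H_iff by auto
    \<comment> \<open>The difference is a combination of the two elements of \<open>I\<close> that
      express the given equivalences.\<close>
    have "((f1 \<otimes>\<^bsub>S\<^esub> f2) \<otimes>\<^bsub>S\<^esub> (g1' \<otimes>\<^bsub>S\<^esub> g2')) \<ominus>\<^bsub>S\<^esub> ((f1' \<otimes>\<^bsub>S\<^esub> f2') \<otimes>\<^bsub>S\<^esub> (g1 \<otimes>\<^bsub>S\<^esub> g2)) =
       (f2 \<otimes>\<^bsub>S\<^esub> g2') \<otimes>\<^bsub>S\<^esub> ((f1 \<otimes>\<^bsub>S\<^esub> g1') \<ominus>\<^bsub>S\<^esub> (f1' \<otimes>\<^bsub>S\<^esub> g1)) \<oplus>\<^bsub>S\<^esub>
       (f1' \<otimes>\<^bsub>S\<^esub> g1) \<otimes>\<^bsub>S\<^esub> ((f2 \<otimes>\<^bsub>S\<^esub> g2') \<ominus>\<^bsub>S\<^esub> (f2' \<otimes>\<^bsub>S\<^esub> g2))"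
      using c unfolding a_minus_def by algebra
    then have "((f1 \<otimes>\<^bsub>S\<^esub> f2, g1 \<otimes>\<^bsub>S\<^esub> g2), (f1' \<otimes>\<^bsub>S\<^esub> f2', g1' \<otimes>\<^bsub>S\<^esub> g2')) \<in> R"
      using I_comb[OF i] c x y H_mult unfolding fg R_iff by simp
    then show "?F x1 y1 = ?F x2 y2" unfolding fg using equiv_class_eq[OF equiv_R] by simp
  qed
  from UN_equiv_class2[OF equiv_R equiv_R this assms] show ?thesis
    unfolding function_field_def cls_def by (simp add: Let_def case_prod_unfold)
qed

lemma cls_add:
  assumes "(f, g) \<in> H" "(f', g') \<in> H"
  shows "cls f g \<oplus>\<^bsub>function_field k n I\<^esub> cls f' g' = cls ((f \<otimes>\<^bsub>S\<^esub> g') \<oplus>\<^bsub>S\<^esub> (f' \<otimes>\<^bsub>S\<^esub> g)) (g \<otimes>\<^bsub>S\<^esub> g')"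
proof -
  let ?F = "\<lambda>x y. case x of (f, g) \<Rightarrow> case y of (f', g') \<Rightarrow> R `` {((f \<otimes>\<^bsub>S\<^esub> g') \<oplus>\<^bsub>S\<^esub> (f' \<otimes>\<^bsub>S\<^esub> g), g \<otimes>\<^bsub>S\<^esub> g')}"
  have "congruent2 R R ?F"
  proof (rule congruent2I')
    fix x1 x2 y1 y2 assume x: "(x1, x2) \<in> R" and y: "(y1, y2) \<in> R"
    obtain f1 g1 f1' g1' f2 g2 f2' g2' where fg: "x1 = (f1, g1)" "x2 = (f1', g1')" "y1 = (f2, g2)" "y2 = (f2', g2')"
      by (metis surj_pair)
    have c: "f1 \<in> carrier S" "g1 \<in> carrier S" "f1' \<in> carrier S" "g1' \<in> carrier S"
      "f2 \<in> carrier S" "g2 \<in> carrier S" "f2' \<in> carrier S" "g2' \<in> carrier S"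
      and i: "(f1 \<otimes>\<^bsub>S\<^esub> g1') \<ominus>\<^bsub>S\<^esub> (f1' \<otimes>\<^bsub>S\<^esub> g1) \<in> I" "(f2 \<otimes>\<^bsub>S\<^esub> g2') \<ominus>\<^bsub>S\<^esub> (f2' \<otimes>\<^bsub>S\<^esub> g2) \<in> I"
      using x y unfolding fg R_iff H_iff by auto
    have "((f1 \<otimes>\<^bsub>S\<^esub> g2 \<oplus>\<^bsub>S\<^esub> f2 \<otimes>\<^bsub>S\<^esub> g1) \<otimes>\<^bsub>S\<^esub> (g1' \<otimes>\<^bsub>S\<^esub> g2')) \<ominus>\<^bsub>S\<^esub>
         ((f1' \<otimes>\<^bsub>S\<^esub> g2' \<oplus>\<^bsub>S\<^esub> f2' \<otimes>\<^bsub>S\<^esub> g1') \<otimes>\<^bsub>S\<^esub> (g1 \<otimes>\<^bsub>S\<^esub> g2)) =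
       (g2 \<otimes>\<^bsub>S\<^esub> g2') \<otimes>\<^bsub>S\<^esub> ((f1 \<otimes>\<^bsub>S\<^esub> g1') \<ominus>\<^bsub>S\<^esub> (f1' \<otimes>\<^bsub>S\<^esub> g1)) \<oplus>\<^bsub>S\<^esub>
       (g1 \<otimes>\<^bsub>S\<^esub> g1') \<otimes>\<^bsub>S\<^esub> ((f2 \<otimes>\<^bsub>S\<^esub> g2') \<ominus>\<^bsub>S\<^esub> (f2' \<otimes>\<^bsub>S\<^esub> g2))"
      using c unfolding a_minus_def by algebra
    then have "((f1 \<otimes>\<^bsub>S\<^esub> g2 \<oplus>\<^bsub>S\<^esub> f2 \<otimes>\<^bsub>S\<^esub> g1, g1 \<otimes>\<^bsub>S\<^esub> g2), (f1' \<otimes>\<^bsub>S\<^esub> g2' \<oplus>\<^bsub>S\<^esub> f2' \<otimes>\<^bsub>S\<^esub> g1', g1' \<otimes>\<^bsub>S\<^esub> g2')) \<in> R"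
      using I_comb[OF i] c x y H_add unfolding fg R_iff by simp
    then show "?F x1 y1 = ?F x2 y2" unfolding fg using equiv_class_eq[OF equiv_R] by simp
  qed
  from UN_equiv_class2[OF equiv_R equiv_R this assms] show ?thesis
    unfolding function_field_def cls_def by (simp add: Let_def case_prod_unfold)
qed

lemma cls_closed: "(f, g) \<in> H \<Longrightarrow> cls f g \<in> carrier (function_field k n I)"
  unfolding function_field_def cls_def by (simp add: Let_def quotientI)

lemma cls_surj: "x \<in> carrier (function_field k n I) \<Longrightarrow> \<exists>f g. (f, g) \<in> H \<and> x = cls f g"
  unfolding function_field_def cls_def by (auto simp: Let_def quotient_def)

lemma cls_one: "\<one>\<^bsub>function_field k n I\<^esub> = cls \<one>\<^bsub>S\<^esub> \<one>\<^bsub>S\<^esub>"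
  unfolding function_field_def cls_def by (simp add: Let_def)

lemma cls_eq_iff:
  assumes "(f, g) \<in> H" "(f', g') \<in> H"
  shows "cls f g = cls f' g' \<longleftrightarrow> (f \<otimes>\<^bsub>S\<^esub> g') \<ominus>\<^bsub>S\<^esub> (f' \<otimes>\<^bsub>S\<^esub> g) \<in> I"
  unfolding cls_def using eq_equiv_class_iff[OF equiv_R assms] assms unfolding R_iff by simp

end

section \<open>The function field inside a field\<close>

text \<open>Fractions are studied through their images in a field \<open>Q\<close>, from which the
  field laws are taken. The variable of index \<open>j\<close> does not vanish identically on the
  variety and is the denominator used for dehomogenizing.\<close>

locale function_field_embedding = projective_domain +
  fixes Q :: "('c, 'd) ring_scheme" (structure) and \<rho> and j :: nat
  assumes Q: "field Q" and \<rho>: "\<rho> \<in> ring_hom (function_field k n I) Q"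
    and inj: "inj_on \<rho> (carrier (function_field k n I))"
    and j: "j \<le> n" "ring.indexed_var k j \<notin> I"
begin

sublocale Q: field Q by (rule Q)

definition q :: "'a mpol \<Rightarrow> 'a mpol \<Rightarrow> 'c" where "q f g = \<rho> (cls f g)"
definition \<kappa> :: "'a \<Rightarrow> 'c" where "\<kappa> a = q (cst a) \<one>\<^bsub>S\<^esub>"
abbreviation "y \<equiv> vr j"

lemma q_closed: "(f, g) \<in> H \<Longrightarrow> q f g \<in> carrier Q"
  unfolding q_def by (rule ring_hom_memE(1)[OF \<rho> cls_closed])

lemma q_mult: "(f, g) \<in> H \<Longrightarrow> (f', g') \<in> H \<Longrightarrow> q f g \<otimes> q f' g' = q (f \<otimes>\<^bsub>S\<^esub> f') (g \<otimes>\<^bsub>S\<^esub> g')"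
  unfolding q_def using ring_hom_memE(2)[OF \<rho> cls_closed cls_closed] cls_mult by metis

lemma q_add: "(f, g) \<in> H \<Longrightarrow> (f', g') \<in> H \<Longrightarrow>
    q f g \<oplus> q f' g' = q ((f \<otimes>\<^bsub>S\<^esub> g') \<oplus>\<^bsub>S\<^esub> (f' \<otimes>\<^bsub>S\<^esub> g)) (g \<otimes>\<^bsub>S\<^esub> g')"
  unfolding q_def using ring_hom_memE(3)[OF \<rho> cls_closed cls_closed] cls_add by metis

lemma q_one: "q \<one>\<^bsub>S\<^esub> \<one>\<^bsub>S\<^esub> = \<one>"
  unfolding q_def cls_one[symmetric] by (rule ring_hom_memE(4)[OF \<rho>])

lemma q_eq_iff:
  assumes "(f, g) \<in> H" "(f', g') \<in> H"
  shows "q f g = q f' g' \<longleftrightarrow> (f \<otimes>\<^bsub>S\<^esub> g') \<ominus>\<^bsub>S\<^esub> (f' \<otimes>\<^bsub>S\<^esub> g) \<in> I"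
  unfolding q_def using inj_on_eq_iff[OF inj cls_closed[OF assms(1)] cls_closed[OF assms(2)]] cls_eq_iff[OF assms]
  by simp

lemma q_cancel:
  assumes "(f, g) \<in> H" "(f \<otimes>\<^bsub>S\<^esub> h, g \<otimes>\<^bsub>S\<^esub> h) \<in> H" "h \<in> carrier S"
  shows "q (f \<otimes>\<^bsub>S\<^esub> h) (g \<otimes>\<^bsub>S\<^esub> h) = q f g"
proof -
  have c: "f \<in> carrier S" "g \<in> carrier S" using assms(1) unfolding H_iff by auto
  have "((f \<otimes>\<^bsub>S\<^esub> h) \<otimes>\<^bsub>S\<^esub> g) \<ominus>\<^bsub>S\<^esub> (f \<otimes>\<^bsub>S\<^esub> (g \<otimes>\<^bsub>S\<^esub> h)) = \<zero>\<^bsub>S\<^esub>"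
    using c assms(3) by (simp add: S.m_assoc S.m_comm[of h g])
  then show ?thesis using q_eq_iff[OF assms(2,1)] I.zero_closed by simp
qed

lemma q_add_same:
  assumes f: "(f, g) \<in> H" and f': "(f', g) \<in> H" and s: "(f \<oplus>\<^bsub>S\<^esub> f', g) \<in> H"
  shows "q f g \<oplus> q f' g = q (f \<oplus>\<^bsub>S\<^esub> f') g"
proof -
  have c: "f \<in> carrier S" "g \<in> carrier S" "f' \<in> carrier S" using f f' unfolding H_iff by auto
  have e: "(f \<otimes>\<^bsub>S\<^esub> g) \<oplus>\<^bsub>S\<^esub> (f' \<otimes>\<^bsub>S\<^esub> g) = (f \<oplus>\<^bsub>S\<^esub> f') \<otimes>\<^bsub>S\<^esub> g" using c by (simp add: S.l_distr)
  show ?thesis using q_add[OF f f'] q_cancel[OF s _ c(2)] H_add[OF f f'] unfolding e by simp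
qed

text \<open>Membership in \<open>ring_hom\<close> does not mention zero, so zero is recognized in
  \<open>Q\<close> as the element equal to its own double.\<close>

lemma q_zero: "(\<zero>\<^bsub>S\<^esub>, g) \<in> H \<Longrightarrow> q \<zero>\<^bsub>S\<^esub> g = \<zero>"
proof -
  assume z: "(\<zero>\<^bsub>S\<^esub>, g) \<in> H"
  have "q \<zero>\<^bsub>S\<^esub> g \<oplus> q \<zero>\<^bsub>S\<^esub> g = q \<zero>\<^bsub>S\<^esub> g" using q_add_same[OF z z] z by simp
  then show ?thesis using q_closed[OF z] Q.add.l_cancel_one' by (metis Q.add.l_cancel_one)
qed

lemma q_zero_iff: "(f, g) \<in> H \<Longrightarrow> q f g = \<zero> \<longleftrightarrow> f \<in> I"
proof -
  assume f: "(f, g) \<in> H"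
  have c: "f \<in> carrier S" "g \<in> carrier S" "g \<notin> I" using f unfolding H_iff by auto
  have z: "(\<zero>\<^bsub>S\<^esub>, g) \<in> H" using f homogeneous_zero unfolding H_iff by auto
  have "q f g = \<zero> \<longleftrightarrow> (f \<otimes>\<^bsub>S\<^esub> g) \<ominus>\<^bsub>S\<^esub> (\<zero>\<^bsub>S\<^esub> \<otimes>\<^bsub>S\<^esub> g) \<in> I"
    using q_eq_iff[OF f z] q_zero[OF z] by simp
  also have "(f \<otimes>\<^bsub>S\<^esub> g) \<ominus>\<^bsub>S\<^esub> (\<zero>\<^bsub>S\<^esub> \<otimes>\<^bsub>S\<^esub> g) = f \<otimes>\<^bsub>S\<^esub> g" using c by (simp add: a_minus_def)
  also have "f \<otimes>\<^bsub>S\<^esub> g \<in> I \<longleftrightarrow> f \<in> I" using I_prime[OF c(1,2)] I.I_r_closed[OF _ c(2)] c(3) by blast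
  finally show ?thesis .
qed

lemma y_closed: "y \<in> carrier S" by (rule vr_closed[OF j(1)])

lemma one_notin: "\<one>\<^bsub>S\<^esub> \<notin> I"
  using I.I_notcarr I.one_imp_carrier by blast

lemma ypow_notin: "y [^]\<^bsub>S\<^esub> (d::nat) \<notin> I"
proof (induct d)
  case (Suc d)
  then show ?case using I_prime[of "y [^]\<^bsub>S\<^esub> d" y] j(2) y_closed by auto
qed (simp add: one_notin)

lemma homogeneous_ypow: "homogeneous k d (y [^]\<^bsub>S\<^esub> d)"
  using homogeneous_pow[OF y_closed homogeneous_vr, of d] by simp

lemma H_ypow: "f \<in> carrier S \<Longrightarrow> homogeneous k d f \<Longrightarrow> (f, y [^]\<^bsub>S\<^esub> d) \<in> H"
  unfolding H_iff using y_closed ypow_notin homogeneous_ypow by auto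

lemma H_cst: "a \<in> carrier k \<Longrightarrow> (cst a, \<one>\<^bsub>S\<^esub>) \<in> H"
  unfolding H_iff using cst_closed one_notin homogeneous_cst homogeneous_one by blast

lemma \<kappa>_hom: "\<kappa> \<in> ring_hom k Q"
proof (rule ring_hom_memI)
  fix a b assume ab: "a \<in> carrier k" "b \<in> carrier k"
  show "\<kappa> a \<in> carrier Q" unfolding \<kappa>_def by (rule q_closed[OF H_cst[OF ab(1)]])
  show "\<kappa> (a \<otimes>\<^bsub>k\<^esub> b) = \<kappa> a \<otimes> \<kappa> b"
    unfolding \<kappa>_def using q_mult[OF H_cst[OF ab(1)] H_cst[OF ab(2)]] mult_cst[OF ab] by simp
  show "\<kappa> (a \<oplus>\<^bsub>k\<^esub> b) = \<kappa> a \<oplus> \<kappa> b"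
    unfolding \<kappa>_def using q_add_same[OF H_cst[OF ab(1)] H_cst[OF ab(2)]] add_cst[OF ab] H_cst[of "a \<oplus>\<^bsub>k\<^esub> b"] ab
    by simp
next
  show "\<kappa> \<one>\<^bsub>k\<^esub> = \<one>" unfolding \<kappa>_def using q_one by (simp add: S_simps(3))
qed

text \<open>Dehomogenization: a component of degree \<open>d\<close>, divided by
  \<open>y ^ d\<close>, is a polynomial in the quotients of the variables by \<open>y\<close>. The
  induction follows the construction of \<open>f\<close> with \<open>d\<close> arbitrary, as a
  factor \<open>vr i\<close> moves the component of degree \<open>d'\<close> to degree
  \<open>Suc d'\<close>.\<close>

lemma component_in_subring:
  assumes F: "subring F Q" and \<kappa>F: "\<kappa> ` carrier k \<subseteq> F" and xF: "\<And>i. i \<le> n \<Longrightarrow> q (vr i) y \<in> F"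
    and f: "f \<in> carrier S"
  shows "hom_component k d f \<in> carrier S \<and> q (hom_component k d f) (y [^]\<^bsub>S\<^esub> d) \<in> F"
proof -
  have hc: "homogeneous k d (hom_component k d g)" for d g
    unfolding homogeneous_def hom_component_def by simp
  have zeroF: "q \<zero>\<^bsub>S\<^esub> (y [^]\<^bsub>S\<^esub> d) \<in> F" for d :: nat
    using q_zero[OF H_ypow[OF S.zero_closed homogeneous_zero]] subringE(2)[OF F] by simp
  have zeroE: "\<zero>\<^bsub>S\<^esub> = (\<lambda>m. \<zero>\<^bsub>k\<^esub>)" using zero_coeff by auto
  from f have "f \<in> ring.indexed_pset k {..n} (carrier k)" unfolding S_simps .
  then show ?thesis
  proof (induct arbitrary: d rule: k.indexed_pset.induct)
    case (indexed_const a)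
    show ?case
    proof (cases "d = 0")
      case True
      then have "hom_component k d (cst a) = cst a"
        unfolding hom_component_def k.indexed_const_def by auto
      then show ?thesis using True indexed_const \<kappa>F cst_closed unfolding \<kappa>_def by auto
    next
      case False
      then have "hom_component k d (cst a) = \<zero>\<^bsub>S\<^esub>"
        unfolding hom_component_def k.indexed_const_def zeroE by auto
      then show ?thesis using zeroF by simp
    qed
  next
    case (indexed_padd f g)
    have "hom_component k d (ring.indexed_padd k f g) = hom_component k d f \<oplus>\<^bsub>S\<^esub> hom_component k d g"
      unfolding hom_component_def by (auto simp: add_coeff k.indexed_padd_def)
    moreover have "hom_component k d f \<oplus>\<^bsub>S\<^esub> hom_component k d g \<in> carrier S"
      using indexed_padd by simp
    moreover have "q (hom_component k d f \<oplus>\<^bsub>S\<^esub> hom_component k d g) (y [^]\<^bsub>S\<^esub> d) =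
        q (hom_component k d f) (y [^]\<^bsub>S\<^esub> d) \<oplus> q (hom_component k d g) (y [^]\<^bsub>S\<^esub> d)"
      by (rule q_add_same[symmetric]) (use H_ypow hc homogeneous_add indexed_padd in simp_all)
    ultimately show ?case using indexed_padd subringE(7)[OF F] by simp
  next
    case (indexed_pmult f i)
    show ?case
    proof (cases d)
      case 0
      then have "hom_component k d (ring.indexed_pmult k f i) = \<zero>\<^bsub>S\<^esub>"
        unfolding hom_component_def zeroE k.indexed_pmult_def by auto
      then show ?thesis using zeroF by simp
    next
      case (Suc d')
      have i: "i \<le> n" using indexed_pmult by simp
      have hf: "hom_component k d' f \<in> carrier S" using indexed_pmult by blast
      have "hom_component k d (ring.indexed_pmult k f i) = ring.indexed_pmult k (hom_component k d' f) i"
      proof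
        fix m
        show "hom_component k d (ring.indexed_pmult k f i) m = ring.indexed_pmult k (hom_component k d' f) i m"
        proof (cases "i \<in># m")
          case True
          then have "size m = Suc (size (m - {#i#}))" using size_Suc_Diff1[OF True] by simp
          then show ?thesis using True Suc by (simp add: hom_component_def k.indexed_pmult_def)
        qed (simp add: hom_component_def k.indexed_pmult_def)
      qed
      also have "\<dots> = hom_component k d' f \<otimes>\<^bsub>S\<^esub> vr i" by (rule mult_vr[OF hf i, symmetric])
      finally have e: "hom_component k d (ring.indexed_pmult k f i) = hom_component k d' f \<otimes>\<^bsub>S\<^esub> vr i" .
      have Hv: "(vr i, y) \<in> H"
        unfolding H_iff using vr_closed[OF i] y_closed j(2) homogeneous_vr by blast
      have "q (hom_component k d' f \<otimes>\<^bsub>S\<^esub> vr i) (y [^]\<^bsub>S\<^esub> d' \<otimes>\<^bsub>S\<^esub> y) = q (hom_component k d' f) (y [^]\<^bsub>S\<^esub> d') \<otimes> q (vr i) y"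
        using q_mult[OF H_ypow[OF hf hc] Hv] by simp
      then show ?thesis
        using indexed_pmult xF[OF i] subringE(6)[OF F] hf vr_closed[OF i] e[unfolded Suc] Suc by simp
    qed
  qed
qed

text \<open>\<open>f / g\<close> is the quotient of \<open>f / y ^ d\<close> by
  \<open>g / y ^ d\<close>, and both are polynomials in the affine coordinates. Hence these
  coordinates generate the function field over the constants.\<close>

lemma image_generated:
  assumes F: "subfield F Q" and \<kappa>F: "\<kappa> ` carrier k \<subseteq> F" and xF: "\<And>i. i \<le> n \<Longrightarrow> q (vr i) y \<in> F"
  shows "\<rho> ` carrier (function_field k n I) \<subseteq> F"
proof
  fix x assume "x \<in> \<rho> ` carrier (function_field k n I)"
  then obtain f g where fg: "(f, g) \<in> H" "x = q f g" using cls_surj unfolding q_def by blast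
  then obtain d where d: "f \<in> carrier S" "g \<in> carrier S" "g \<notin> I" "homogeneous k d f" "homogeneous k d g"
    unfolding H_iff by blast
  have comp: "hom_component k d f = f" "hom_component k d g = g"
    using d(4,5) unfolding hom_component_def homogeneous_def by (auto simp: fun_eq_iff)
  note SF = subfieldE(1)[OF F]
  have qf: "q f (y [^]\<^bsub>S\<^esub> d) \<in> F" "q g (y [^]\<^bsub>S\<^esub> d) \<in> F"
    using component_in_subring[OF SF \<kappa>F xF d(1), of d] component_in_subring[OF SF \<kappa>F xF d(2), of d] comp by auto
  have Hf: "(f, y [^]\<^bsub>S\<^esub> d) \<in> H" "(g, y [^]\<^bsub>S\<^esub> d) \<in> H" using H_ypow d by auto
  have yd: "y [^]\<^bsub>S\<^esub> d \<in> carrier S" using y_closed by simp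
  have "q f g \<otimes> q g (y [^]\<^bsub>S\<^esub> d) = q (f \<otimes>\<^bsub>S\<^esub> g) (g \<otimes>\<^bsub>S\<^esub> (y [^]\<^bsub>S\<^esub> d))" by (rule q_mult[OF fg(1) Hf(2)])
  also have "\<dots> = q (f \<otimes>\<^bsub>S\<^esub> g) ((y [^]\<^bsub>S\<^esub> d) \<otimes>\<^bsub>S\<^esub> g)" using d(2) yd by (simp add: S.m_comm)
  also have "\<dots> = q f (y [^]\<^bsub>S\<^esub> d)"
    by (rule q_cancel[OF Hf(1) _ d(2)]) (use H_mult[OF fg(1) Hf(2)] d(2) yd in \<open>simp add: S.m_comm\<close>)
  finally have eq: "q f g \<otimes> q g (y [^]\<^bsub>S\<^esub> d) = q f (y [^]\<^bsub>S\<^esub> d)" .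
  have nz: "q g (y [^]\<^bsub>S\<^esub> d) \<noteq> \<zero>" using q_zero_iff[OF Hf(2)] d(3) by simp
  have c: "q f g \<in> carrier Q" "q g (y [^]\<^bsub>S\<^esub> d) \<in> carrier Q" using q_closed fg Hf by auto
  have u: "q g (y [^]\<^bsub>S\<^esub> d) \<in> Units Q" using nz c Q.field_Units by simp
  have "q f g = q f (y [^]\<^bsub>S\<^esub> d) \<otimes> inv (q g (y [^]\<^bsub>S\<^esub> d))"
    unfolding eq[symmetric] using c u by (simp add: Q.m_assoc)
  then show "x \<in> F"
    using fg(2) qf Q.subfield_m_inv(1)[OF F] nz subringE(6)[OF SF] by simp
qed

text \<open>A polynomial is a function on all multisets, so a bound on its degree is recovered from
  its inductive construction.\<close>

lemma eventually_zero:
  assumes "f \<in> carrier S"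
  shows "\<exists>D. \<forall>m. size m > D \<longrightarrow> f m = \<zero>\<^bsub>k\<^esub>"
proof -
  from assms have "f \<in> ring.indexed_pset k {..n} (carrier k)" unfolding S_simps .
  then show ?thesis
  proof (induct rule: k.indexed_pset.induct)
    case (indexed_const a)
    show ?case by (rule exI[of _ 0]) (auto simp: k.indexed_const_def)
  next
    case (indexed_padd f g)
    then obtain D D' where "\<forall>m. size m > D \<longrightarrow> f m = \<zero>\<^bsub>k\<^esub>" "\<forall>m. size m > D' \<longrightarrow> g m = \<zero>\<^bsub>k\<^esub>" by blast
    then show ?case by (intro exI[of _ "max D D'"]) (auto simp: k.indexed_padd_def)
  next
    case (indexed_pmult f i)
    then obtain D where D: "\<forall>m. size m > D \<longrightarrow> f m = \<zero>\<^bsub>k\<^esub>" by blast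
    show ?case
    proof (rule exI[of _ "Suc D"], intro allI impI)
      fix m :: "nat multiset" assume "size m > Suc D"
      then have "i \<in># m \<Longrightarrow> size (m - {#i#}) > D" by (simp add: size_Diff_singleton)
      then show "ring.indexed_pmult k f i m = \<zero>\<^bsub>k\<^esub>" using D unfolding k.indexed_pmult_def by simp
    qed
  qed
qed

text \<open>A polynomial is the finite sum of its homogeneous components, so not all components of
  \<open>f\<close> can lie in \<open>I\<close>; they stay in \<open>P\<close> because
  \<open>P\<close> is homogeneous.\<close>

lemma exists_homogeneous_notin:
  assumes P: "homogeneous_ideal k n P" and f: "f \<in> P" "f \<notin> I"
  obtains d g where "g \<in> P" "g \<notin> I" "homogeneous k d g"
proof (rule ccontr)
  assume no: "\<not> thesis"
  have idP: "ideal P S" using P unfolding homogeneous_ideal_def by simp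
  have fS: "f \<in> carrier S" using ideal.Icarr[OF idP f(1)] .
  have comp: "hom_component k d f \<in> I" for d
  proof -
    have "hom_component k d f \<in> P" using P f(1) unfolding homogeneous_ideal_def by blast
    moreover have "homogeneous k d (hom_component k d f)"
      unfolding homogeneous_def hom_component_def by simp
    ultimately show ?thesis using no that by blast
  qed
  define tr where "tr D = (\<lambda>m. if size m < D then f m else \<zero>\<^bsub>k\<^esub>)" for D
  have "tr D \<in> I" for D
  proof (induct D)
    case 0
    have "tr 0 = \<zero>\<^bsub>S\<^esub>" unfolding tr_def using zero_coeff by auto
    then show ?case using I.zero_closed by simp
  next
    case (Suc D)
    have "tr (Suc D) = tr D \<oplus>\<^bsub>S\<^esub> hom_component k D f"
      unfolding tr_def hom_component_def using coeff_closed[OF fS] by (auto simp: add_coeff less_Suc_eq)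
    then show ?case using I.a_closed[OF Suc comp] by simp
  qed
  moreover obtain D where "\<forall>m. size m > D \<longrightarrow> f m = \<zero>\<^bsub>k\<^esub>" using eventually_zero[OF fS] by blast
  then have "tr (Suc D) = f" unfolding tr_def by (auto simp: fun_eq_iff less_Suc_eq not_less)
  ultimately show False using f(2) by metis
qed

text \<open>The function \<open>f / y ^ d\<close> is nonzero but vanishes at the point
  \<open>P\<close>. A relation over the constants may be assumed to have nonzero constant term;
  modulo \<open>P\<close> its numerator is that term times a power of \<open>y\<close>, which is
  outside \<open>P\<close>.\<close>

lemma transcendental_quotient:
  assumes P: "primeideal P S" "I \<subseteq> P" "y \<notin> P" and f: "f \<in> P" "f \<notin> I" "homogeneous k d f"
  shows "(Q.transcendental over (\<kappa> ` carrier k)) (q f (y [^]\<^bsub>S\<^esub> d))"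
proof -
  interpret P: primeideal P S by (rule P(1))
  interpret \<kappa>: ring_hom_ring k Q \<kappa>
    by (rule ring_hom_ringI2[OF k.ring_axioms Q.ring_axioms \<kappa>_hom])
  define u where "u = y [^]\<^bsub>S\<^esub> d"
  define z where "z = q f u"
  have fS: "f \<in> carrier S" by (rule P.Icarr[OF f(1)])
  have uS: "u \<in> carrier S" unfolding u_def using y_closed by simp
  have hu: "homogeneous k d u" unfolding u_def by (rule homogeneous_ypow)
  have uI: "u [^]\<^bsub>S\<^esub> (l::nat) \<notin> I" for l
    using ypow_notin[of "d * l"] unfolding u_def by (simp add: S.nat_pow_pow y_closed)
  have yP: "y [^]\<^bsub>S\<^esub> (l::nat) \<notin> P" for l
  proof (induct l)
    case 0
    then show ?case using P.I_notcarr P.one_imp_carrier by auto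
  next
    case (Suc l)
    then show ?case using P.I_prime[of "y [^]\<^bsub>S\<^esub> l" y] P(3) y_closed by auto
  qed
  have uP: "u [^]\<^bsub>S\<^esub> (l::nat) \<notin> P" for l
    using yP[of "d * l"] unfolding u_def by (simp add: S.nat_pow_pow y_closed)
  have HuI: "g \<in> carrier S \<Longrightarrow> homogeneous k (d * l) g \<Longrightarrow> (g, u [^]\<^bsub>S\<^esub> l) \<in> H" for g l
    unfolding H_iff using uS uI homogeneous_pow[OF uS hu, of l] by auto
  have Hf: "(f, u) \<in> H" using HuI[OF fS, of 1] f(3) uS by simp
  have zc: "z \<in> carrier Q" unfolding z_def by (rule q_closed[OF Hf])
  have z0: "z \<noteq> \<zero>" unfolding z_def using q_zero_iff[OF Hf] f(2) by simp
  have zpow: "z [^] (l::nat) = q (f [^]\<^bsub>S\<^esub> l) (u [^]\<^bsub>S\<^esub> l)" for l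
  proof (induct l)
    case (Suc l)
    then show ?case
      unfolding z_def
      using q_mult[OF HuI[OF _ homogeneous_pow[OF fS f(3)], of l] Hf] fS by simp
  qed (simp add: q_one)
  \<comment> \<open>Horner's scheme for the numerator of the polynomial \<open>as\<close> at \<open>f / u\<close>, with denominator \<open>u ^ length as\<close>.\<close>
  define G where "G = rec_list \<zero>\<^bsub>S\<^esub> (\<lambda>a as g. (cst a \<otimes>\<^bsub>S\<^esub> f [^]\<^bsub>S\<^esub> length as \<oplus>\<^bsub>S\<^esub> g) \<otimes>\<^bsub>S\<^esub> u)"
  have G: "G [] = \<zero>\<^bsub>S\<^esub>" "G (a # as) = (cst a \<otimes>\<^bsub>S\<^esub> f [^]\<^bsub>S\<^esub> length as \<oplus>\<^bsub>S\<^esub> G as) \<otimes>\<^bsub>S\<^esub> u" for a as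
    unfolding G_def by simp_all
  have Gh: "G as \<in> carrier S \<and> homogeneous k (d * length as) (G as)" if "set as \<subseteq> carrier k" for as
    using that
  proof (induct as)
    case (Cons a as)
    have c: "cst a \<in> carrier S" "f [^]\<^bsub>S\<^esub> length as \<in> carrier S" using Cons cst_closed fS by auto
    have "homogeneous k (d * length as) (cst a \<otimes>\<^bsub>S\<^esub> f [^]\<^bsub>S\<^esub> length as)"
      using homogeneous_mult[OF c homogeneous_cst homogeneous_pow[OF fS f(3)]] by simp
    then have h: "homogeneous k (d * length as) (cst a \<otimes>\<^bsub>S\<^esub> f [^]\<^bsub>S\<^esub> length as \<oplus>\<^bsub>S\<^esub> G as)"
      using homogeneous_add Cons by simp
    have "homogeneous k (d * length as + d) (G (a # as))"
      unfolding G by (rule homogeneous_mult[OF _ uS h hu]) (use c Cons in simp)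
    then show ?case using c Cons uS by (simp add: G add.commute)
  qed (simp add: G homogeneous_zero)
  have ev: "Q.eval (map \<kappa> as) z = q (G as) (u [^]\<^bsub>S\<^esub> length as)" if "set as \<subseteq> carrier k" for as
    using that
  proof (induct as)
    case Nil
    then show ?case using q_zero[OF HuI[OF S.zero_closed homogeneous_zero, of 0]] by (simp add: G)
  next
    case (Cons a as)
    let ?l = "length as"
    have a: "a \<in> carrier k" and as: "set as \<subseteq> carrier k" using Cons.prems by auto
    have c: "cst a \<in> carrier S" "f [^]\<^bsub>S\<^esub> ?l \<in> carrier S" using cst_closed[OF a] fS by auto
    have ul: "u [^]\<^bsub>S\<^esub> ?l \<in> carrier S" using uS by simp
    note Gas = Gh[OF as]
    have hl: "homogeneous k (d * ?l) (cst a \<otimes>\<^bsub>S\<^esub> f [^]\<^bsub>S\<^esub> ?l)"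
      using homogeneous_mult[OF c homogeneous_cst homogeneous_pow[OF fS f(3)]] by simp
    have H1: "(cst a \<otimes>\<^bsub>S\<^esub> f [^]\<^bsub>S\<^esub> ?l, u [^]\<^bsub>S\<^esub> ?l) \<in> H" using HuI[OF _ hl] c by simp
    have H2: "(G as, u [^]\<^bsub>S\<^esub> ?l) \<in> H" using HuI Gas by blast
    have H3: "(cst a \<otimes>\<^bsub>S\<^esub> f [^]\<^bsub>S\<^esub> ?l \<oplus>\<^bsub>S\<^esub> G as, u [^]\<^bsub>S\<^esub> ?l) \<in> H"
      using HuI[OF _ homogeneous_add[OF hl]] Gas c by simp
    have H4: "(G (a # as), u [^]\<^bsub>S\<^esub> ?l \<otimes>\<^bsub>S\<^esub> u) \<in> H"
      using HuI[of "G (a # as)" "Suc ?l"] Gh[OF Cons.prems] by simp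
    have "\<kappa> a \<otimes> z [^] ?l = q (cst a \<otimes>\<^bsub>S\<^esub> f [^]\<^bsub>S\<^esub> ?l) (\<one>\<^bsub>S\<^esub> \<otimes>\<^bsub>S\<^esub> u [^]\<^bsub>S\<^esub> ?l)"
      unfolding \<kappa>_def zpow by (rule q_mult[OF H_cst[OF a] HuI[OF c(2) homogeneous_pow[OF fS f(3)]]])
    then have "\<kappa> a \<otimes> z [^] ?l = q (cst a \<otimes>\<^bsub>S\<^esub> f [^]\<^bsub>S\<^esub> ?l) (u [^]\<^bsub>S\<^esub> ?l)" using ul by simp
    then have "Q.eval (map \<kappa> (a # as)) z = q (cst a \<otimes>\<^bsub>S\<^esub> f [^]\<^bsub>S\<^esub> ?l) (u [^]\<^bsub>S\<^esub> ?l) \<oplus> q (G as) (u [^]\<^bsub>S\<^esub> ?l)"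
      using Cons.hyps[OF as] by simp
    also have "\<dots> = q (cst a \<otimes>\<^bsub>S\<^esub> f [^]\<^bsub>S\<^esub> ?l \<oplus>\<^bsub>S\<^esub> G as) (u [^]\<^bsub>S\<^esub> ?l)" by (rule q_add_same[OF H1 H2 H3])
    also have "\<dots> = q (G (a # as)) (u [^]\<^bsub>S\<^esub> ?l \<otimes>\<^bsub>S\<^esub> u)"
      unfolding G by (rule q_cancel[symmetric, OF H3 _ uS]) (use H4 in \<open>simp add: G\<close>)
    finally show ?case by simp
  qed
  \<comment> \<open>Lists start with the leading coefficient, so \<open>last as\<close> is the
    constant term; every other term of the numerator carries a factor \<open>f\<close> and lies in
    \<open>P\<close>.\<close>
  have mod: "G as \<ominus>\<^bsub>S\<^esub> cst (last as) \<otimes>\<^bsub>S\<^esub> u [^]\<^bsub>S\<^esub> length as \<in> P" if "set as \<subseteq> carrier k" "as \<noteq> []" for as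
    using that
  proof (induct as)
    case (Cons a as)
    have a: "a \<in> carrier k" and as: "set as \<subseteq> carrier k" using Cons.prems by auto
    show ?case
    proof (cases "as = []")
      case True
      have "G [a] = cst a \<otimes>\<^bsub>S\<^esub> u" unfolding G using cst_closed[OF a] uS by simp
      moreover have "cst a \<otimes>\<^bsub>S\<^esub> u \<ominus>\<^bsub>S\<^esub> cst a \<otimes>\<^bsub>S\<^esub> u = \<zero>\<^bsub>S\<^esub>" using cst_closed[OF a] uS by simp
      ultimately show ?thesis using True uS P.zero_closed by simp
    next
      case False
      let ?l = "length as"
      have la: "last as \<in> carrier k" using False as last_in_set by blast
      have "f [^]\<^bsub>S\<^esub> ?l \<in> P"
      proof -
        obtain l where "?l = Suc l" using False by (cases as) auto
        then show ?thesis using P.I_l_closed[OF f(1), of "f [^]\<^bsub>S\<^esub> l"] fS by simp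
      qed
      then have p1: "cst a \<otimes>\<^bsub>S\<^esub> f [^]\<^bsub>S\<^esub> ?l \<in> P" using P.I_l_closed cst_closed[OF a] by blast
      note p2 = Cons.hyps[OF as False]
      have c: "cst a \<otimes>\<^bsub>S\<^esub> f [^]\<^bsub>S\<^esub> ?l \<in> carrier S" "G as \<in> carrier S" "cst (last as) \<in> carrier S" "u [^]\<^bsub>S\<^esub> ?l \<in> carrier S"
        using P.Icarr[OF p1] Gh[OF as] cst_closed[OF la] uS by auto
      have alg: "(x \<oplus>\<^bsub>S\<^esub> g) \<otimes>\<^bsub>S\<^esub> u \<ominus>\<^bsub>S\<^esub> b \<otimes>\<^bsub>S\<^esub> (v \<otimes>\<^bsub>S\<^esub> u) = (x \<oplus>\<^bsub>S\<^esub> (g \<ominus>\<^bsub>S\<^esub> b \<otimes>\<^bsub>S\<^esub> v)) \<otimes>\<^bsub>S\<^esub> u"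
        if "x \<in> carrier S" "g \<in> carrier S" "b \<in> carrier S" "v \<in> carrier S" for x g b v
        using that uS unfolding a_minus_def by algebra
      have "G (a # as) \<ominus>\<^bsub>S\<^esub> cst (last (a # as)) \<otimes>\<^bsub>S\<^esub> u [^]\<^bsub>S\<^esub> length (a # as) =
          (cst a \<otimes>\<^bsub>S\<^esub> f [^]\<^bsub>S\<^esub> ?l \<oplus>\<^bsub>S\<^esub> (G as \<ominus>\<^bsub>S\<^esub> cst (last as) \<otimes>\<^bsub>S\<^esub> u [^]\<^bsub>S\<^esub> ?l)) \<otimes>\<^bsub>S\<^esub> u"
        using alg[OF c] False unfolding G by simp
      also have "\<dots> \<in> P" by (rule P.I_r_closed[OF P.a_closed[OF p1 p2] uS])
      finally show ?thesis .
    qed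
  qed simp
  have ne: "Q.eval (map \<kappa> as) z \<noteq> \<zero>"
    if as: "set as \<subseteq> carrier k" "as \<noteq> []" and l: "last as \<noteq> \<zero>\<^bsub>k\<^esub>" for as
  proof
    assume "Q.eval (map \<kappa> as) z = \<zero>"
    then have "G as \<in> I" using ev[OF as(1)] q_zero_iff[OF HuI] Gh[OF as(1)] by simp
    then have GP: "G as \<in> P" using P(2) by auto
    have la: "last as \<in> carrier k" using as last_in_set by blast
    let ?w = "cst (last as) \<otimes>\<^bsub>S\<^esub> u [^]\<^bsub>S\<^esub> length as"
    have wS: "?w \<in> carrier S" "G as \<in> carrier S" using cst_closed[OF la] uS P.Icarr[OF GP] by auto
    have "?w = G as \<oplus>\<^bsub>S\<^esub> \<ominus>\<^bsub>S\<^esub> (G as \<ominus>\<^bsub>S\<^esub> ?w)"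
      using wS by (simp add: a_minus_def S.minus_add S.r_neg2)
    then have "?w \<in> P" using P.a_closed[OF GP P.a_inv_closed[OF mod[OF as]]] by simp
    then have "cst (last as) \<in> P" using P.I_prime[OF cst_closed[OF la]] uP uS by blast
    then have "cst (last as) \<otimes>\<^bsub>S\<^esub> cst (inv\<^bsub>k\<^esub> (last as)) \<in> P"
      using P.I_r_closed cst_closed la l k.field_Units by simp
    then have "\<one>\<^bsub>S\<^esub> \<in> P" using mult_cst[OF la] la l k.field_Units by (simp add: S_simps(3))
    then show False using P.I_notcarr P.one_imp_carrier by blast
  qed
  have main: "Q.eval p z \<noteq> \<zero>" if "set p \<subseteq> \<kappa> ` carrier k" "p \<noteq> []" "hd p \<noteq> \<zero>" for p
    using that
  proof (induct p rule: rev_induct)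
    case (snoc c p)
    define as where "as = map (inv_into (carrier k) \<kappa>) (p @ [c])"
    have as: "set as \<subseteq> carrier k" "p @ [c] = map \<kappa> as"
    proof -
      have mem: "v \<in> \<kappa> ` carrier k" if "v \<in> set (p @ [c])" for v
        using subsetD[OF snoc.prems(1) that] .
      show "set as \<subseteq> carrier k"
      proof
        fix v assume "v \<in> set as"
        then obtain w where "w \<in> set (p @ [c])" "v = inv_into (carrier k) \<kappa> w" unfolding as_def set_map by blast
        then show "v \<in> carrier k" using inv_into_into[OF mem] by simp
      qed
      have "map (\<kappa> \<circ> inv_into (carrier k) \<kappa>) (p @ [c]) = p @ [c]"
        by (rule map_idI) (simp only: o_apply f_inv_into_f[OF mem])
      then show "p @ [c] = map \<kappa> as" unfolding as_def by simp
    qed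
    show ?case
    proof (cases "c = \<zero>")
      case False
      have "as \<noteq> []" using as(2) by auto
      then have "c = \<kappa> (last as)" using as(2) by (metis last_map last_snoc)
      then have "last as \<noteq> \<zero>\<^bsub>k\<^esub>" using False \<kappa>.hom_zero by auto
      then show ?thesis using ne[OF as(1) \<open>as \<noteq> []\<close>] as(2) by simp
    next
      case True
      then have p: "p \<noteq> []" "hd p \<noteq> \<zero>" using snoc.prems(3) by (cases p; auto)+
      have IH: "Q.eval p z \<noteq> \<zero>" using snoc.hyps snoc.prems(1) p by simp
      have pc: "set p \<subseteq> carrier Q" using snoc.prems(1) \<kappa>.hom_closed by auto
      have "Q.eval (p @ [c]) z = Q.eval p z \<otimes> z"
        using Q.eval_append_aux[OF pc, of c z] True zc Q.eval_in_carrier[OF pc zc] by simp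
      then show ?thesis using Q.integral IH z0 zc Q.eval_in_carrier[OF pc zc] by metis
    qed
  qed simp
  have sub: "subring (\<kappa> ` carrier k) Q" by (rule \<kappa>.img_is_subring[OF k.carrier_is_subring])
  show ?thesis
  proof (rule ccontr)
    assume "\<not> (Q.transcendental over (\<kappa> ` carrier k)) (q f (y [^]\<^bsub>S\<^esub> d))"
    then have "(Q.algebraic over (\<kappa> ` carrier k)) z" unfolding z_def u_def by (simp add: over_def)
    then obtain p where "p \<in> carrier ((\<kappa> ` carrier k)[X]\<^bsub>Q\<^esub>)" "p \<noteq> []" "Q.eval p z = \<zero>"
      using Q.algebraicE[OF sub zc] by blast
    then show False using main[of p] unfolding univ_poly_def polynomial_def by auto
  qed
qed

end

theorem corollary3p18:
  fixes p n :: nat and k :: "'a ring" and I :: "'a mpol set"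
    and K :: "'b ring" and A :: "'c monoid"
  assumes "Factorial_Ring.prime p" and "padic_field p k"
    and "smooth_projective_curve k n I"
    and "field K" and "K \<simeq> function_field k n I"
    and "comm_group A" and "finite (carrier A)"
  shows "\<exists>(L :: (('b list \<times> nat) multiset \<Rightarrow> 'b) ring) h.
    h \<in> ring_hom K L \<and> finite_galois_extension L (h ` carrier K) \<and>
    galois_group L (h ` carrier K) \<cong> A"
proof -
  interpret K: field K by fact
  have k: "field k" using assms(2) unfolding padic_field_def by simp
  interpret k: field k by (rule k)
  have I: "I \<in> proj_points k n I" and dim: "proj_chain k n I 1"
    using assms(3) unfolding smooth_projective_curve_def geometrically_integral_def proj_dim_eq_def by auto
  have prime: "primeideal I (mpoly_ring k n)" using I unfolding proj_points_def by simp
  \<comment> \<open>Dimension one supplies a strict chain of two points. A form in the larger prime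
    but outside \<open>I\<close> becomes the numerator of the transcendental element, and a variable
    outside the larger prime its denominator.\<close>
  obtain C where "\<forall>j\<le>1. C j \<in> proj_points k n I" "\<forall>j<1. C j \<subset> C (Suc j)"
    using dim unfolding proj_chain_def by blast
  then have C: "C 0 \<in> proj_points k n I" "C 1 \<in> proj_points k n I" "C 0 \<subset> C 1"
    by auto
  define P where "P = C 1"
  have P: "primeideal P (mpoly_ring k n)" "homogeneous_ideal k n P" "I \<subseteq> P"
    and ex_j: "\<exists>i\<le>n. k.indexed_var i \<notin> P"
    using C(2) unfolding P_def proj_points_def by auto
  obtain j where j: "j \<le> n" "k.indexed_var j \<notin> P" using ex_j by blast
  obtain f0 where f0: "f0 \<in> P" "f0 \<notin> I"
    using C(1,3) unfolding P_def proj_points_def by blast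
  \<comment> \<open>Everything is moved into the algebraic closure of \<open>K\<close>, whose
    elements have the type demanded of \<open>L\<close>.\<close>
  define \<Omega> where "\<Omega> = K.alg_closure"
  define \<iota> where "\<iota> = (K.indexed_const :: 'b \<Rightarrow> ('b list \<times> nat) multiset \<Rightarrow> 'b)"
  have \<iota>: "\<iota> \<in> ring_hom K \<Omega>" unfolding \<iota>_def \<Omega>_def by (rule K.alg_closureE(2))
  interpret \<Omega>: algebraic_closure \<Omega> "\<iota> ` carrier K"
    unfolding \<iota>_def \<Omega>_def by (rule K.alg_closureE(1))
  interpret \<iota>: ring_hom_ring K \<Omega> \<iota> by (rule ring_hom_ringI2[OF K.ring_axioms \<Omega>.ring_axioms \<iota>])
  have \<iota>_inj: "inj_on \<iota> (carrier K)"
    using \<iota>.img_is_subfield(1)[OF K.carrier_is_subfield] by simp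
  obtain g where g: "g \<in> ring_iso (function_field k n I) K"
    using ring_iso_sym[OF K.ring_axioms assms(5)] unfolding is_ring_iso_def by blast
  then have g_hom: "g \<in> ring_hom (function_field k n I) K"
    and g_bij: "bij_betw g (carrier (function_field k n I)) (carrier K)"
    unfolding ring_iso_def by auto
  define \<rho> where "\<rho> = \<iota> \<circ> g"
  have \<rho>: "\<rho> \<in> ring_hom (function_field k n I) \<Omega>"
    unfolding \<rho>_def by (rule ring_hom_trans[OF g_hom \<iota>])
  have \<rho>_inj: "inj_on \<rho> (carrier (function_field k n I))"
    unfolding \<rho>_def using g_bij \<iota>_inj by (auto simp: bij_betw_def intro: comp_inj_on)
  have \<rho>_img: "\<rho> ` carrier (function_field k n I) = \<iota> ` carrier K"
    unfolding \<rho>_def using g_bij by (metis bij_betw_imp_surj_on image_comp)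
  have "k.indexed_var j \<notin> I" using j(2) P(3) by blast
  then interpret X: function_field_embedding k n I \<Omega> \<rho> j
    by (intro function_field_embedding.intro projective_domain.intro function_field_embedding_axioms.intro
        k prime \<rho> \<rho>_inj j(1) \<Omega>.field_axioms)
  interpret \<kappa>: ring_hom_ring k \<Omega> X.\<kappa>
    by (rule ring_hom_ringI2[OF k.ring_axioms \<Omega>.ring_axioms X.\<kappa>_hom])
  have q_mem: "X.q f g \<in> \<iota> ` carrier K" if "(f, g) \<in> hom_fractions k n I" for f g
    unfolding X.q_def \<rho>_img[symmetric] using X.cls_closed[OF that] by blast
  obtain d f where f: "f \<in> P" "f \<notin> I" "homogeneous k d f"
    using X.exists_homogeneous_notin[OF P(2) f0] .
  define t where "t = X.q f (X.y [^]\<^bsub>mpoly_ring k n\<^esub> d)"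
  have "f \<in> carrier (mpoly_ring k n)"
    using primeideal.axioms(1)[OF P(1)] f(1) by (rule ideal.Icarr)
  then have t: "t \<in> \<iota> ` carrier K" unfolding t_def using q_mem X.H_ypow f(3) by blast
  have tr: "(\<Omega>.transcendental over (X.\<kappa> ` carrier k)) t"
    unfolding t_def by (rule X.transcendental_quotient[OF P(1,3) j(2) f])
  \<comment> \<open>The affine coordinates, that is, the quotients of all variables by the one of
    index \<open>j\<close>.\<close>
  define gs where "gs = map (\<lambda>i. X.q (k.indexed_var i) X.y) [0..<Suc n]"
  have "(k.indexed_var i, X.y) \<in> hom_fractions k n I" if "i \<le> n" for i
    unfolding X.H_iff using X.vr_closed[OF that] X.y_closed X.j(2) X.homogeneous_vr by blast
  then have gs: "set gs \<subseteq> carrier \<Omega>" unfolding gs_def using X.q_closed by auto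
  have gen: "\<iota> ` carrier K \<subseteq> F"
    if "subfield F \<Omega>" "X.\<kappa> ` carrier k \<subseteq> F" "set gs \<subseteq> F" for F
  proof (rule X.image_generated[OF that(1,2), unfolded \<rho>_img])
    show "X.q (k.indexed_var i) X.y \<in> F" if "i \<le> n" for i
      using \<open>set gs \<subseteq> F\<close> that unfolding gs_def by (simp add: image_subset_iff less_Suc_eq_le del: upt_Suc)
  qed
  have sub_k: "subfield (X.\<kappa> ` carrier k) \<Omega>"
    using \<kappa>.img_is_subfield(2)[OF k.carrier_is_subfield] by simp
  have k_sub: "X.\<kappa> ` carrier k \<subseteq> \<iota> ` carrier K"
    unfolding X.\<kappa>_def using q_mem X.H_cst by blast
  \<comment> \<open>Characteristic zero passes from \<open>k\<close> to the closure along the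
    embedding of the constants.\<close>
  have char0: "add_pow \<Omega> m \<one>\<^bsub>\<Omega>\<^esub> \<noteq> \<zero>\<^bsub>\<Omega>\<^esub>" if m: "m > 0" for m :: nat
  proof -
    have pow: "X.\<kappa> (add_pow k m \<one>\<^bsub>k\<^esub>) = add_pow \<Omega> m \<one>\<^bsub>\<Omega>\<^esub>" for m :: nat
      by (induct m) simp_all
    have "inj_on X.\<kappa> (carrier k)"
      using \<kappa>.img_is_subfield(1)[OF k.carrier_is_subfield] by simp
    then have "X.\<kappa> (add_pow k m \<one>\<^bsub>k\<^esub>) \<noteq> X.\<kappa> \<zero>\<^bsub>k\<^esub>"
      using padic_field_char_zero[OF assms(1,2) m]
      by (subst inj_on_eq_iff[where A = "carrier k"]) auto
    then show ?thesis unfolding pow by simp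
  qed
  obtain M where M: "subfield M \<Omega>" "\<iota> ` carrier K \<subseteq> M"
    "finite_galois_extension (\<Omega>\<lparr>carrier := M\<rparr>) (\<iota> ` carrier K)"
    "galois_group (\<Omega>\<lparr>carrier := M\<rparr>) (\<iota> ` carrier K) \<cong> A"
    using exists_abelian_extension[OF \<Omega>.algebraically_closed_axioms char0 sub_k \<Omega>.subfield_axioms k_sub gs gen t tr
        assms(6,7)] by blast
  \<comment> \<open>The required \<open>h\<close> is \<open>\<iota>\<close>; its target is cut down
    from the closure to the extension \<open>M\<close>.\<close>
  have "\<iota> \<in> ring_hom K (\<Omega>\<lparr>carrier := M\<rparr>)"
    using ring_hom_memE[OF \<iota>] M(2) by (intro ring_hom_memI) auto
  then show ?thesis using M(3,4) by blast
qed

end
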